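(* Let $(\lambda_n)_{n\geq 2}$ be a sequence of compositions with $\lambda_n$ a composition of $n$. If $U_{\lambda_n}$ converges in $\mathcal{U}^{(2)}$ to $U=(U_{\uparrow},U_{\downarrow})$, then for every composition $\mu$ (every vertex of $\mathcal{Z}$), $$K_{\mu}(\lambda_n)\longrightarrow p_{U}(\mu)\quad (n\to\infty).$$
   Context: A composition $\lambda$ of $n$ is a sequence $(\lambda_1,\dots,\lambda_r)$ of positive integers with $\sum\lambda_j=n$; its descent set is $D_\lambda=\{\lambda_1,\lambda_1+\lambda_2,\dots,\lambda_1+\dots+\lambda_{r-1}\}\subset[1,n-1]$. For a permutation $\sigma\in\mathfrak{S}_k$ (written as the word $\sigma(1)\cdots\sigma(k)$), $des(\sigma)=\{i:\sigma(i+1)<\sigma(i)\}$. The graded graph $\mathcal{Z}$ has as vertices of degree $n$ the compositions of $n$ (and the empty composition $\emptyset$ in degree 0, joined to $(1)$). For $\mu=(\mu_1,\dots,\mu_s)$, $\lambda=(\lambda_1,\dots,\lambda_r)$ with $|\lambda|=|\mu|+1$, there is an edge $\mu\nearrow\lambda$ iff either $r=s$ and $\lambda$ is obtained from $\mu$ by increasing exactly one part by one, or $r=s+1$ and there is $j$ with $\lambda_k=\mu_k$ for $k<j$, $\lambda_j+\lambda_{j+1}-1=\mu_j$, and $\lambda_{k+1}=\mu_k$ for $k>j$. Let $d(\mu,\lambda)$ be the number of paths $\mu=\nu_0\nearrow\nu_1\nearrow\cdots\nearrow\nu_m=\lambda$ (zero if $|\mu|>|\lambda|$), $d(\lambda)=d(\emptyset,\lambda)$,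 and the Martin kernel $K_\mu(\lambda)=d(\mu,\lambda)/d(\lambda)$. $\mathcal{U}^{(2)}$ is the set of pairs $(U_\uparrow,U_\downarrow)$ of disjoint open subsets of $]0,1[$, with metric $d((U_\uparrow,U_\downarrow),(V_\uparrow,V_\downarrow))=\max(d_{Haus}(U_\uparrow^c,V_\uparrow^c),d_{Haus}(U_\downarrow^c,V_\downarrow^c))$, complements taken in $[0,1]$ and $d_{Haus}$ the Hausdorff distance. Paintbox: for $U\in\mathcal{U}^{(2)}$ and $x_1,\dots,x_k\in[0,1]$, $\sigma_U(x_1,\dots,x_k)\in\mathfrak{S}_k$ is defined by: $\sigma^{-1}(i)<\sigma^{-1}(j)$ iff either ($x_i,x_j$ are not in a common connected component of $U_\uparrow$ or of $U_\downarrow$, and $x_i<x_j$), or ($x_i,x_j$ lie in the same component of $U_\uparrow$ and $i<j$), or ($x_i,x_j$ lie in the same component of $U_\downarrow$ and $j<i$). With $X_1,X_2,\dots$ i.i.d. uniform on $[0,1]$, set $\sigma_U(k)=\sigma_U(X_1,\dots,X_k)$. For a composition $\mu$ of $k$, $p_U(\mu)=\mathbb{P}(\sigma_U(k)=\sigma)$ for any $\sigma\in\mathfrak{S}_k$ with $des(\sigma)=D_\mu$ (this is known to depend only on $\mu$). For a composition $\lambda$ of $n\geq2$, let $I_s=[\frac{s-1}{n-1},\frac{s}{n-1}]$ for $1\le s\le n-1$ and $U_\lambda=(U_\uparrow(\lambda),U_\downarrow(\lambda))$ with $U_\uparrow(\lambda)=\mathrm{int}\bigcup_{s\notin D_\lambda}I_s$,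 $U_\downarrow(\lambda)=\mathrm{int}\bigcup_{s\in D_\lambda}I_s$. *)

theory Defs
  imports "HOL-Probability.Probability"
begin

definition is_comp :: "nat list \<Rightarrow> bool" where
  "is_comp xs \<longleftrightarrow> (\<forall>x\<in>set xs. 0 < x)"

definition comp_of :: "nat \<Rightarrow> nat list \<Rightarrow> bool" where
  "comp_of n xs \<longleftrightarrow> is_comp xs \<and> sum_list xs = n"

definition descent_set :: "nat list \<Rightarrow> nat set" where
  "descent_set lam = {sum_list (take i lam) | i. 1 \<le> i \<and> i < length lam}"

definition Z_edge :: "nat list \<Rightarrow> nat list \<Rightarrow> bool" where
  "Z_edge mu lam \<longleftrightarrow> is_comp mu \<and> is_comp lam \<and> sum_list lam = sum_list mu + 1 \<and>
     ((mu = [] \<and> lam = [1]) \<or>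
      (length lam = length mu \<and>
         (\<exists>j < length mu. lam = mu[j := mu ! j + 1])) \<or>
      (length lam = length mu + 1 \<and>
         (\<exists>j < length mu. take j lam = take j mu \<and>
            lam ! j + lam ! (j + 1) - 1 = mu ! j \<and>
            drop (j + 2) lam = drop (j + 1) mu)))"

definition Z_paths :: "nat list \<Rightarrow> nat list \<Rightarrow> nat list list set" where
  "Z_paths mu lam = {ps. ps \<noteq> [] \<and> hd ps = mu \<and> last ps = lam \<and>
      (\<forall>i. i + 1 < length ps \<longrightarrow> Z_edge (ps ! i) (ps ! (i + 1)))}"

definition d_Z :: "nat list \<Rightarrow> nat list \<Rightarrow> nat" where
  "d_Z mu lam = card (Z_paths mu lam)"

definition martin_kernel :: "nat list \<Rightarrow> nat list \<Rightarrow> real" where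
  "martin_kernel mu lam = real (d_Z mu lam) / real (d_Z [] lam)"

definition U2 :: "(real set \<times> real set) set" where
  "U2 = {(A, B). open A \<and> open B \<and> A \<subseteq> {0<..<1} \<and> B \<subseteq> {0<..<1} \<and> A \<inter> B = {}}"

text \<open>Hausdorff distance between (nonempty bounded) subsets of the reals.\<close>
definition hausdist :: "real set \<Rightarrow> real set \<Rightarrow> real" where
  "hausdist A B = max (SUP a\<in>A. infdist a B) (SUP b\<in>B. infdist b A)"

definition U2_dist :: "real set \<times> real set \<Rightarrow> real set \<times> real set \<Rightarrow> real" where
  "U2_dist U V = max (hausdist ({0..1} - fst U) ({0..1} - fst V))
                     (hausdist ({0..1} - snd U) ({0..1} - snd V))"

definition I_int :: "nat \<Rightarrow> nat \<Rightarrow> real set" where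
  "I_int n s = {(real s - 1) / (real n - 1) .. real s / (real n - 1)}"

definition U_of_comp :: "nat list \<Rightarrow> real set \<times> real set" where
  "U_of_comp lam = (let n = sum_list lam in
     (interior (\<Union>s\<in>{1..n-1} - descent_set lam. I_int n s),
      interior (\<Union>s\<in>{1..n-1} \<inter> descent_set lam. I_int n s)))"

text \<open>A permutation of {1..k} written as the word sigma(1)...sigma(k).\<close>
definition perm_word :: "nat \<Rightarrow> nat list \<Rightarrow> bool" where
  "perm_word k w \<longleftrightarrow> distinct w \<and> set w = {1..k}"

text \<open>des(sigma) = {i. sigma(i+1) < sigma(i)}, 1-indexed (w ! (i-1) = sigma(i)).\<close>
definition des :: "nat list \<Rightarrow> nat set" where
  "des w = {i. 1 \<le> i \<and> i < length w \<and> w ! i < w ! (i - 1)}"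

text \<open>i precedes j in the paintbox permutation (i.e. sigma^-1(i) < sigma^-1(j)).\<close>
definition pb_prec :: "real set \<times> real set \<Rightarrow> (nat \<Rightarrow> real) \<Rightarrow> nat \<Rightarrow> nat \<Rightarrow> bool" where
  "pb_prec U x i j \<longleftrightarrow>
     (\<not> connected_component (fst U) (x i) (x j) \<and> \<not> connected_component (snd U) (x i) (x j)
        \<and> x i < x j)
   \<or> (connected_component (fst U) (x i) (x j) \<and> i < j)
   \<or> (connected_component (snd U) (x i) (x j) \<and> j < i)"

definition paintbox :: "real set \<times> real set \<Rightarrow> nat \<Rightarrow> (nat \<Rightarrow> real) \<Rightarrow> nat list" where
  "paintbox U k x = (THE w. perm_word k w \<and>
      (\<forall>p q. p < q \<and> q < k \<longrightarrow> pb_prec U x (w ! p) (w ! q)))"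

definition unif_cube :: "nat \<Rightarrow> (nat \<Rightarrow> real) measure" where
  "unif_cube k = PiM {1..k} (\<lambda>_. uniform_measure lborel {0..1::real})"

definition paintbox_prob :: "real set \<times> real set \<Rightarrow> nat list \<Rightarrow> real" where
  "paintbox_prob U w = (let k = length w in
     measure (unif_cube k) {x \<in> space (unif_cube k). paintbox U k x = w})"

definition p_U :: "real set \<times> real set \<Rightarrow> nat list \<Rightarrow> real" where
  "p_U U mu = paintbox_prob U
     (SOME w. perm_word (sum_list mu) w \<and> des w = descent_set mu)"

end

theory Submission
  imports Defs "HOL-Real_Asymp.Real_Asymp"
begin

text \<open>
  Encode a composition of n by its descent word in the letters ascent/descent. Edges of the graph
  insert one letter into the descent word, and inserting an arbitrary new value into a permutation
  at all places produces every such extension exactly once. Hence, for \<^emph>\<open>every\<close> set S of k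
  values, the number of permutations with descent word \<lambda> whose restriction to S has a given
  pattern w with descents \<mu> is d(\<mu>, \<lambda>). So the Martin kernel is the probability that a uniform
  permutation \<sigma> with descent word \<lambda> shows the pattern w on S, and S may be averaged over: take one
  uniform value from each of k disjoint intervals of values.

  Suppose the descent word changes letter at position c. Dropping one comparison at c enlarges the
  descent class by a factor of at most n (overwrite a peak by a new maximum, a valley by a new
  minimum), and then the set of the first c values is uniform. Since hypergeometric tails are
  exponentially small, in the original class too every macroscopic interval of values meets the
  first c positions in the proportion c/n, up to a vanishing error.

  A point outside both limit sets is a limit of such change positions. Finitely many of these points
  cut [0,1] into pieces that are short or lie inside one component of the limit, where \<sigma> is monotone.
  The pieces hit by the k random values are thus asymptotically independent with probabilities given
  by their lengths, exactly as for k uniform points in the paintbox, and up to small probability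
  they determine the pattern in the same way.
\<close>

subsection \<open>Compositions, descent words and path counts\<close>

text \<open>The obstacle is that cutting is cheap only at changes of letter. Dropping a comparison
  in the middle of a long run can enlarge a descent class exponentially, and then no tail bound
  survives. So nothing is shown about where a value sits inside a run, and nothing is needed: two
  values in one increasing (decreasing) run appear in the order (reverse order) of their sizes. This
  is why the intervals of values are arranged in the order of their labels: order by size becomes
  order by label, the rule of the paintbox inside a component. Averaging over S is forced because
  concentration speaks of the proportions of large sets of values, never of a single value. In a
  short piece the order of two points is not controlled at all; such collisions are only made rare,
  through the length of the piece. The constants are therefore chosen in this order: the bound on
  short pieces, which determines the breaks and their number, and only then the accuracies, which
  have to beat a power of that number.\<close>

fun dword :: "nat list \<Rightarrow> bool list" where
  "dword (x # y # r) = (y < x) # dword (y # r)"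
| "dword _ = []"

text \<open>A word of length n - 1 encodes a composition of n; True marks a descent.\<close>
fun comp_of_word :: "bool list \<Rightarrow> nat list" where
  "comp_of_word [] = [1]"
| "comp_of_word (True # s) = 1 # comp_of_word s"
| "comp_of_word (False # s) = Suc (hd (comp_of_word s)) # tl (comp_of_word s)"

text \<open>The words obtained by inserting one letter. A letter equal to its right neighbour can be
  moved past it, so in front of c only the opposite letter is recorded; every word arises once, and
  sums over \<open>supers\<close> split along the recursion.\<close>

fun supers :: "bool list \<Rightarrow> bool list set" where
  "supers [] = {[True], [False]}"
| "supers (c # s) = insert ((\<not> c) # c # s) ((#) c ` supers s)"

lemma comp_of_word_nonempty [simp]: "comp_of_word s \<noteq> []"
  by (cases s rule: comp_of_word.cases) auto

lemma is_comp_comp_of_word [simp]: "is_comp (comp_of_word s)"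
proof (induction s rule: comp_of_word.induct)
  case (3 s)
  then show ?case by (cases "comp_of_word s") (auto simp: is_comp_def)
qed (auto simp: is_comp_def)

lemma sum_list_comp_of_word [simp]: "sum_list (comp_of_word s) = Suc (length s)"
proof (induction s rule: comp_of_word.induct)
  case (3 s)
  then show ?case by (cases "comp_of_word s") auto
qed auto

lemma hd_comp_of_word_pos: "0 < hd (comp_of_word s)"
  by (metis comp_of_word_nonempty hd_in_set is_comp_comp_of_word is_comp_def)

lemma comp_of_word_inject [simp]: "comp_of_word s = comp_of_word t \<longleftrightarrow> s = t"
proof (induction s arbitrary: t rule: comp_of_word.induct)
  case 1
  show ?case
    using hd_comp_of_word_pos comp_of_word_nonempty[symmetric]
    by (cases t rule: comp_of_word.cases) auto
next
  case (2 s)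
  show ?case
    using hd_comp_of_word_pos 2 by (cases t rule: comp_of_word.cases) auto
next
  case (3 s)
  show ?case
  proof (cases t rule: comp_of_word.cases)
    case (3 u)
    then show ?thesis using "3.IH"(1)[of u]
      by simp (metis comp_of_word_nonempty list.expand)
  qed (use hd_comp_of_word_pos in auto)
qed

lemma comp_of_word_surj:
  assumes "is_comp mu" "mu \<noteq> []"
  obtains s where "mu = comp_of_word s"
proof -
  have "\<exists>s. mu = comp_of_word s"
    using assms
  proof (induction "sum_list mu" arbitrary: mu rule: less_induct)
    case less
    then obtain a r where mu: "mu = a # r" by (cases mu) auto
    have a: "a > 0" using less.prems mu by (auto simp: is_comp_def)
    show ?case
    proof (cases "a = 1")
      case True
      show ?thesis
      proof (cases "r = []")
        case True
        then show ?thesis using mu \<open>a = 1\<close> by (intro exI[of _ "[]"]) auto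
      next
        case False
        then obtain s where "r = comp_of_word s"
          using less.hyps[of r] less.prems mu a by (auto simp: is_comp_def)
        then show ?thesis using mu \<open>a = 1\<close> by (intro exI[of _ "True # s"]) auto
      qed
    next
      case False
      then obtain s where s: "(a - 1) # r = comp_of_word s"
        using less.hyps[of "(a - 1) # r"] less.prems mu a by (auto simp: is_comp_def)
      then have "mu = comp_of_word (False # s)"
        using mu a by (simp add: s[symmetric])
      then show ?thesis by blast
    qed
  qed
  then show ?thesis using that by blast
qed

lemma descent_set_Cons:
  "r \<noteq> [] \<Longrightarrow> descent_set (a # r) = insert a ((+) a ` descent_set r)"
  (is "_ \<Longrightarrow> ?L = ?R")
proof -
  assume r: "r \<noteq> []"
  have "x \<in> ?L \<longleftrightarrow> x \<in> ?R" for x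
  proof
    assume "x \<in> ?L"
    then obtain i where i: "1 \<le> i" "i < length (a # r)" "x = sum_list (take i (a # r))"
      unfolding descent_set_def by blast
    then obtain j where j: "i = Suc j" by (cases i) auto
    show "x \<in> ?R"
    proof (cases "j = 0")
      case False
      then have "sum_list (take j r) \<in> descent_set r" using i j unfolding descent_set_def by auto
      then show ?thesis using i j by auto
    qed (use i j in auto)
  next
    assume "x \<in> ?R"
    then consider "x = a" | j where "1 \<le> j" "j < length r" "x = a + sum_list (take j r)"
      unfolding descent_set_def by blast
    then show "x \<in> ?L"
    proof cases
      case 1
      then show ?thesis unfolding descent_set_def using r by (auto intro!: exI[of _ 1])
    next
      case (2 j)
      then show ?thesis unfolding descent_set_def by (auto intro!: exI[of _ "Suc j"])
    qed
  qed
  then show ?thesis by blast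
qed

lemma descent_set_single [simp]: "descent_set [a] = {}"
  by (auto simp: descent_set_def)

lemma descent_set_Suc: "descent_set (Suc a # r) = Suc ` descent_set (a # r)"
proof (cases "r = []")
  case False
  then show ?thesis by (auto simp: descent_set_Cons image_image)
qed simp

lemma descent_set_comp_of_word:
  "descent_set (comp_of_word s) = {i. 1 \<le> i \<and> i \<le> length s \<and> s ! (i - 1)}"
proof (induction s rule: comp_of_word.induct)
  case (2 s)
  have "x \<in> insert 1 (Suc ` {i. 1 \<le> i \<and> i \<le> length s \<and> s ! (i - 1)}) \<longleftrightarrow>
     x \<in> {i. 1 \<le> i \<and> i \<le> length (True # s) \<and> (True # s) ! (i - 1)}" for x
    by (cases x; cases "x - 1") (auto simp: image_iff)
  then show ?case using 2 by (simp add: descent_set_Cons) blast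
next
  case (3 s)
  have "x \<in> Suc ` {i. 1 \<le> i \<and> i \<le> length s \<and> s ! (i - 1)} \<longleftrightarrow>
     x \<in> {i. 1 \<le> i \<and> i \<le> length (False # s) \<and> (False # s) ! (i - 1)}" for x
    by (cases x; cases "x - 1") (auto simp: image_iff)
  moreover have "descent_set (comp_of_word (False # s)) = Suc ` descent_set (comp_of_word s)"
    by (metis comp_of_word.simps(3) comp_of_word_nonempty descent_set_Suc list.collapse)
  ultimately show ?case unfolding "3.IH"(1) by blast
qed auto

lemma length_dword [simp]: "length (dword w) = length w - 1"
  by (induction w rule: dword.induct) auto

lemma nth_dword: "Suc i < length w \<Longrightarrow> dword w ! i \<longleftrightarrow> w ! Suc i < w ! i"
proof (induction w arbitrary: i rule: dword.induct)
  case (1 x y r)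
  then show ?case by (cases i) auto
qed auto

lemma comp_of_word_dword_eq:
  assumes "is_comp mu" "mu \<noteq> []" "length w = sum_list mu" "des w = descent_set mu"
  shows "comp_of_word (dword w) = mu"
proof -
  obtain s where s: "mu = comp_of_word s" using comp_of_word_surj assms by blast
  have l: "length w = Suc (length s)" using assms s by simp
  have "dword w = s"
  proof (rule nth_equalityI)
    fix i assume i: "i < length (dword w)"
    have "dword w ! i \<longleftrightarrow> Suc i \<in> des w"
      using i by (auto simp: nth_dword des_def)
    also have "\<dots> \<longleftrightarrow> s ! i"
      using i l by (auto simp: assms(4) s descent_set_comp_of_word)
    finally show "dword w ! i = s ! i" .
  qed (use l in simp)
  then show ?thesis using s by simp
qed

text \<open>Greedy choice: the largest remaining value before a descent, the smallest before an
  ascent. Whatever follows, the comparison comes out right.\<close>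

lemma exists_dword:
  assumes "finite T" "card T = Suc (length t)"
  shows "\<exists>w. distinct w \<and> set w = T \<and> dword w = t"
  using assms
proof (induction t arbitrary: T)
  case Nil
  then obtain x where "T = {x}" by (auto simp: card_Suc_eq)
  then show ?case by (intro exI[of _ "[x]"]) auto
next
  case (Cons c t)
  define x where "x = (if c then Max T else Min T)"
  have ne: "T \<noteq> {}" using Cons.prems by auto
  have x: "x \<in> T" using ne Cons.prems(1) by (auto simp: x_def)
  obtain w where w: "distinct w" "set w = T - {x}" "dword w = t"
    using Cons.IH[of "T - {x}"] Cons.prems x by auto
  have "w \<noteq> []" using w(2) Cons.prems x by (metis card.empty card_Suc_Diff1 length_Cons nat.distinct(1) nat.inject set_empty)
  then obtain y r where y: "w = y # r" by (cases w) auto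
  have yT: "y \<in> T" "y \<noteq> x" using w y by auto
  have "(y < x) = c"
    using yT Max_ge[OF Cons.prems(1), of y] Min_le[OF Cons.prems(1), of y]
    by (cases c) (auto simp: x_def)
  then show ?case using w y x by (intro exI[of _ "x # w"]) auto
qed

lemma exists_word_des:
  assumes "is_comp mu"
  shows "\<exists>w. perm_word (sum_list mu) w \<and> des w = descent_set mu"
proof (cases "mu = []")
  case True
  then show ?thesis by (intro exI[of _ "[]"]) (auto simp: perm_word_def des_def descent_set_def)
next
  case False
  then obtain s where s: "mu = comp_of_word s" using comp_of_word_surj assms by blast
  obtain w where w: "distinct w" "set w = {1..Suc (length s)}" "dword w = s"
    using exists_dword[of "{1..Suc (length s)}" s] by auto
  have l: "length w = Suc (length s)" using w by (metis card_atLeastAtMost diff_Suc_1 distinct_card)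
  have "i \<in> des w \<longleftrightarrow> i \<in> descent_set mu" for i
    using l w(3) nth_dword[of "i - 1" w]
    by (cases i) (auto simp: des_def s descent_set_comp_of_word)
  then show ?thesis using w s by (intro exI[of _ w]) (auto simp: perm_word_def)
qed

lemma finite_supers [simp]: "finite (supers s)"
  by (induction s) auto

lemma length_supers: "t \<in> supers s \<Longrightarrow> length t = Suc (length s)"
  by (induction s arbitrary: t) auto

lemma Cons_in_supers [simp]: "c # s \<in> supers s"
  by (induction s arbitrary: c) auto

text \<open>Index-free form, suited to induction along a list. Positivity of the parts makes the
  truncated subtraction in \<open>Z_edge\<close> harmless.\<close>

lemma Z_edge_iff:
  assumes "is_comp mu" "mu \<noteq> []"
  shows "Z_edge mu lam \<longleftrightarrow> (\<exists>pre a post. mu = pre @ a # post \<and>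
     (lam = pre @ Suc a # post \<or> (\<exists>b c. 0 < b \<and> 0 < c \<and> b + c = Suc a \<and> lam = pre @ b # c # post)))"
    (is "_ \<longleftrightarrow> ?R")
proof
  assume "Z_edge mu lam"
  then consider j where "j < length mu" "lam = mu[j := mu ! j + 1]"
    | j where "length lam = length mu + 1" "j < length mu" "take j lam = take j mu"
       "lam ! j + lam ! (j + 1) - 1 = mu ! j" "drop (j + 2) lam = drop (j + 1) mu" "is_comp lam"
    using assms unfolding Z_edge_def by blast
  then show ?R
  proof cases
    case (1 j)
    then show ?thesis
      by (intro exI[of _ "take j mu"] exI[of _ "mu ! j"] exI[of _ "drop (Suc j) mu"])
        (simp add: id_take_nth_drop[symmetric] upd_conv_take_nth_drop)
  next
    case (2 j)
    have "lam = take j mu @ lam ! j # lam ! (j+1) # drop (Suc j) mu"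
      using 2 id_take_nth_drop[of j lam] Cons_nth_drop_Suc[of "Suc j" lam] by simp
    moreover have "0 < lam ! j" "0 < lam ! (j + 1)"
      using 2 unfolding is_comp_def by auto
    moreover have "mu = take j mu @ mu ! j # drop (Suc j) mu"
      using 2 id_take_nth_drop by blast
    moreover have "lam ! j + lam ! (j + 1) = Suc (mu ! j)" using calculation 2 by linarith
    ultimately show ?thesis by blast
  qed
next
  assume ?R
  then obtain pre a post where mu: "mu = pre @ a # post" and
    "lam = pre @ Suc a # post \<or> (\<exists>b c. 0 < b \<and> 0 < c \<and> b + c = Suc a \<and> lam = pre @ b # c # post)"
    by blast
  then consider "lam = pre @ Suc a # post"
    | b c where "0 < b" "0 < c" "b + c = Suc a" "lam = pre @ b # c # post" by blast
  then show "Z_edge mu lam"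
  proof cases
    case 1
    have "lam = mu[length pre := mu ! length pre + 1]" using 1 mu by (simp add: nth_append)
    then show ?thesis unfolding Z_edge_def using assms 1 mu
      by (auto simp: is_comp_def intro!: disjI2 exI[of _ "length pre"])
  next
    case (2 b c)
    then show ?thesis unfolding Z_edge_def using assms mu
      by (auto simp: is_comp_def nth_append intro!: exI[of _ "length pre"])
  qed
qed

text \<open>A part a stands for a - 1 consecutive ascents. Raising it adds an ascent; splitting it
  into b + c = a + 1 keeps these ascents and places a descent after the first b - 1 of them. Either
  way one letter is inserted.\<close>

lemma Z_edge_comp_of_word_imp:
  assumes "comp_of_word s = pre @ a # post"
    and "lam = pre @ Suc a # post \<or> (\<exists>b c. 0 < b \<and> 0 < c \<and> b + c = Suc a \<and> lam = pre @ b # c # post)"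
  shows "\<exists>t\<in>supers s. lam = comp_of_word t"
  using assms
proof (induction s arbitrary: pre a lam rule: comp_of_word.induct)
  case 1
  then have [simp]: "pre = []" "a = 1" "post = []" by (auto simp: Cons_eq_append_conv)
  from 1(2) have "lam = [2] \<or> lam = [1, 1]"
    using nat_neq_iff by force
  then show ?case by auto
next
  case (2 s)
  show ?case
  proof (cases pre)
    case Nil
    then have [simp]: "a = 1" "post = comp_of_word s" using 2(2) by auto
    have "lam = 2 # comp_of_word s \<or> lam = 1 # 1 # comp_of_word s"
      using 2(3) Nil nat_neq_iff by force
    then have "lam = comp_of_word (False # True # s) \<or> lam = comp_of_word (True # True # s)"
      by (simp add: numeral_2_eq_2)
    moreover have "False # True # s \<in> supers (True # s)" "True # True # s \<in> supers (True # s)"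
      by auto
    ultimately show ?thesis by blast
  next
    case (Cons x pre')
    then have x: "x = 1" "comp_of_word s = pre' @ a # post" using 2(2) by auto
    then have "\<exists>t\<in>supers s. tl lam = comp_of_word t" "lam = 1 # tl lam"
      using 2(1)[OF x(2), of "tl lam"] 2(3) Cons by auto
    then show ?thesis by (metis comp_of_word.simps(2) image_eqI insertCI supers.simps(2))
  qed
next
  case (3 s)
  obtain h r where hr: "comp_of_word s = h # r" by (cases "comp_of_word s") auto
  show ?case
  proof (cases pre)
    case Nil
    then have a: "a = Suc h" "post = r" using "3.prems"(1) hr by auto
    consider "lam = Suc (Suc h) # r" | "lam = 1 # Suc h # r"
      | b c where "0 < b" "0 < c" "b + c = Suc h" "lam = Suc b # c # r"
    proof -
      assume h: "lam = Suc (Suc h) # r \<Longrightarrow> thesis" "lam = 1 # Suc h # r \<Longrightarrow> thesis"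
        "\<And>b c. 0 < b \<Longrightarrow> 0 < c \<Longrightarrow> b + c = Suc h \<Longrightarrow> lam = Suc b # c # r \<Longrightarrow> thesis"
      have "lam = Suc (Suc h) # r \<or> (\<exists>b c. 0 < b \<and> 0 < c \<and> b + c = Suc (Suc h) \<and> lam = b # c # r)"
        using "3.prems"(2) Nil a by simp
      then show thesis
      proof (elim disjE exE conjE)
        fix b c :: nat
        assume bc: "0 < b" "0 < c" "b + c = Suc (Suc h)" "lam = b # c # r"
        \<comment> \<open>For b = 1 the new descent becomes the first letter. Otherwise the leading
          ascent is stripped, and the split of h into \<open>b'\<close> and c is left to the
          induction hypothesis.\<close>
        then obtain b' where "b = Suc b'" by (cases b) auto
        then show thesis using h(2) h(3)[of b' c] bc by (cases "b' = 0") auto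
      qed (use h in blast)
    qed
    then show ?thesis
    proof cases
      case 1
      then show ?thesis using hr by (intro bexI[of _ "False # False # s"]) auto
    next
      case 2
      then show ?thesis using hr by (intro bexI[of _ "True # False # s"]) auto
    next
      case (3 b c)
      then obtain t where t: "t \<in> supers s" "b # c # r = comp_of_word t"
        using "3.IH"(1)[of "[]" h "b # c # r"] hr a by auto
      then have "lam = comp_of_word (False # t)" using 3 by (simp add: t(2)[symmetric])
      then show ?thesis using t by auto
    qed
  next
    case (Cons x pre')
    then have x: "x = Suc h" "r = pre' @ a # post" using "3.prems"(1) hr by auto
    then obtain t where t: "t \<in> supers s" "h # tl lam = comp_of_word t" "lam = Suc h # tl lam"
      using "3.IH"(1)[of "h # pre'" a "h # tl lam"] "3.prems"(2) hr Cons by auto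
    then have "lam = comp_of_word (False # t)" by (simp add: t(2)[symmetric])
    then show ?thesis using t by auto
  qed
qed

text \<open>The relation \<open>?E\<close> survives both ways in which \<open>comp_of_word\<close>
  adds a letter: a new part 1 in front, or the first part raised by one. So only an insertion at the
  very front has to be checked.\<close>

lemma Z_edge_supers:
  assumes "t \<in> supers s"
  shows "Z_edge (comp_of_word s) (comp_of_word t)"
proof -
  let ?E = "\<lambda>mu lam. \<exists>pre a post. mu = pre @ a # post \<and>
     (lam = pre @ Suc a # post \<or> (\<exists>b c. 0 < b \<and> 0 < c \<and> b + c = Suc a \<and> lam = pre @ b # c # post))"
  have first: "?E (comp_of_word s) (comp_of_word (c # s))" for c s
  proof -
    obtain h r where hr: "comp_of_word s = h # r" by (cases "comp_of_word s") auto
    then have "0 < h" using hd_comp_of_word_pos[of s] by simp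
    then show ?thesis using hr
      by (intro exI[of _ "[]"] exI[of _ h] exI[of _ r], cases c) auto
  qed
  have pre: "?E mu lam \<Longrightarrow> ?E (x # mu) (x # lam)" for mu lam x
    by (metis append_Cons)
  have inc: "?E mu lam \<Longrightarrow> ?E (Suc (hd mu) # tl mu) (Suc (hd lam) # tl lam)" for mu lam
  proof (elim exE conjE)
    fix p a q assume mu: "mu = p @ a # q"
      and lam: "lam = p @ Suc a # q \<or> (\<exists>b c. 0 < b \<and> 0 < c \<and> b + c = Suc a \<and> lam = p @ b # c # q)"
    show ?thesis
    proof (cases p)
      case Nil
      then show ?thesis using mu lam
        by (intro exI[of _ "[]"] exI[of _ "Suc a"] exI[of _ q]) (auto intro: exI[of _ "Suc b" for b])
    next
      case (Cons x p')
      then show ?thesis using mu lam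
        by (intro exI[of _ "Suc x # p'"] exI[of _ a] exI[of _ q]) auto
    qed
  qed
  have "?E (comp_of_word s) (comp_of_word t)"
    using assms
  proof (induction s arbitrary: t)
    case Nil
    then have "t = [True] \<or> t = [False]" by auto
    then show ?case using first[of "[]" True] first[of "[]" False] by (elim disjE) (simp_all only:)
  next
    case (Cons c s)
    show ?case
    proof (cases "t = (\<not> c) # c # s")
      case True
      then show ?thesis using first[of "c # s" "\<not> c"] by (simp only: True)
    next
      case False
      then obtain u where u: "u \<in> supers s" "t = c # u" using Cons.prems by auto
      show ?thesis
        using Cons.IH[OF u(1)] pre inc u(2) by (cases c) (simp_all only: comp_of_word.simps)
    qed
  qed
  then show ?thesis using Z_edge_iff by simp
qed

lemma Z_edge_comp_of_word:
  "Z_edge (comp_of_word s) lam \<longleftrightarrow> lam \<in> comp_of_word ` supers s"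
proof
  assume "Z_edge (comp_of_word s) lam"
  then show "lam \<in> comp_of_word ` supers s"
    using Z_edge_comp_of_word_imp[of s] Z_edge_iff[of "comp_of_word s" lam] by (auto simp: image_iff)
qed (auto intro: Z_edge_supers)

section \<open>Path counts by decomposition at the first step\<close>

lemma Z_paths_step:
  "Z_paths mu lam = (if mu = lam then {[mu]} else {}) \<union>
     (\<Union>nu\<in>{nu. Z_edge mu nu}. (#) mu ` Z_paths nu lam)" (is "?L = ?R")
proof (intro set_eqI iffI)
  fix ps assume ps: "ps \<in> ?L"
  then obtain qs where qs: "ps = mu # qs" by (cases ps) (auto simp: Z_paths_def)
  show "ps \<in> ?R"
  proof (cases qs)
    case Nil
    then show ?thesis using ps qs by (auto simp: Z_paths_def)
  next
    case (Cons nu rs)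
    have E: "Z_edge (ps ! i) (ps ! Suc i)" if "Suc i < length ps" for i
      using ps that by (auto simp: Z_paths_def)
    have "Z_edge mu nu" using E[of 0] qs Cons by simp
    moreover have "qs \<in> Z_paths nu lam"
      using E[of "Suc i" for i] ps qs Cons by (auto simp: Z_paths_def)
    ultimately show ?thesis using qs by auto
  qed
next
  fix ps assume "ps \<in> ?R"
  then consider "mu = lam" "ps = [mu]" | nu qs where "Z_edge mu nu" "qs \<in> Z_paths nu lam" "ps = mu # qs"
    by (auto split: if_splits)
  then show "ps \<in> ?L"
  proof cases
    case (2 nu qs)
    have "Z_edge (ps ! i) (ps ! Suc i)" if "Suc i < length ps" for i
      using 2 that by (cases i) (auto simp: Z_paths_def hd_conv_nth)
    then show ?thesis using 2 by (auto simp: Z_paths_def)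
  qed (auto simp: Z_paths_def)
qed

lemma Z_paths_sum_list: "ps \<in> Z_paths mu lam \<Longrightarrow> sum_list mu \<le> sum_list lam"
proof (induction ps arbitrary: mu)
  case Nil
  then show ?case by (simp add: Z_paths_def)
next
  case (Cons p ps)
  then consider "mu = lam" | nu where "Z_edge mu nu" "ps \<in> Z_paths nu lam"
    using Z_paths_step[of mu lam] by (auto split: if_splits)
  then show ?case
  proof cases
    case (2 nu)
    then have "sum_list nu \<le> sum_list lam" using Cons.IH by blast
    then show ?thesis using 2 by (auto simp: Z_edge_def)
  qed simp
qed

lemma Z_paths_empty: "sum_list lam < sum_list mu \<Longrightarrow> Z_paths mu lam = {}"
  using Z_paths_sum_list by fastforce

lemma Z_paths_same_size:
  assumes "sum_list mu = sum_list lam"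
  shows "Z_paths mu lam = (if mu = lam then {[mu]} else {})"
proof -
  have "Z_paths nu lam = {}" if "Z_edge mu nu" for nu
    using that assms by (intro Z_paths_empty) (auto simp: Z_edge_def)
  then show ?thesis using Z_paths_step[of mu lam] by simp
qed

lemma Z_paths_comp_of_word:
  assumes "length s < length t"
  shows "Z_paths (comp_of_word s) (comp_of_word t) =
    (\<Union>u\<in>supers s. (#) (comp_of_word s) ` Z_paths (comp_of_word u) (comp_of_word t))"
proof -
  have "{nu. Z_edge (comp_of_word s) nu} = comp_of_word ` supers s"
    using Z_edge_comp_of_word by blast
  then show ?thesis using assms by (subst Z_paths_step) auto
qed

text \<open>\<open>d_Z\<close> is a cardinality and would be 0 on an infinite set, so finiteness
  must precede any counting. Sizes grow by one along a path, which bounds the induction.\<close>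

lemma finite_Z_paths: "finite (Z_paths (comp_of_word s) (comp_of_word t))"
proof (induction "length t - length s" arbitrary: s)
  case 0
  then consider "length t = length s" | "length t < length s" by linarith
  then show ?case
    by cases (simp_all add: Z_paths_same_size Z_paths_empty)
next
  case (Suc d)
  then have "length s < length t" by simp
  moreover have "finite (Z_paths (comp_of_word u) (comp_of_word t))" if "u \<in> supers s" for u
    using Suc that by (auto simp: length_supers)
  ultimately show ?case by (auto simp: Z_paths_comp_of_word)
qed

lemma d_Z_same_size:
  "length s = length t \<Longrightarrow> d_Z (comp_of_word s) (comp_of_word t) = (if s = t then 1 else 0)"
  by (simp add: d_Z_def Z_paths_same_size)

lemma d_Z_step:
  assumes "length s < length t"
  shows "d_Z (comp_of_word s) (comp_of_word t) = (\<Sum>u\<in>supers s. d_Z (comp_of_word u) (comp_of_word t))"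
proof -
  have "hd ps = mu" if "ps \<in> Z_paths mu lam" for ps mu lam
    using that by (simp add: Z_paths_def)
  then have "Z_paths (comp_of_word u) (comp_of_word t) \<inter> Z_paths (comp_of_word v) (comp_of_word t) = {}"
    if "u \<noteq> v" for u v
    using that by (metis comp_of_word_inject disjoint_iff)
  then have "d_Z (comp_of_word s) (comp_of_word t)
    = (\<Sum>u\<in>supers s. card ((#) (comp_of_word s) ` Z_paths (comp_of_word u) (comp_of_word t)))"
    unfolding d_Z_def Z_paths_comp_of_word[OF assms]
    by (intro card_UN_disjoint) (auto simp: finite_Z_paths)
  also have "\<dots> = (\<Sum>u\<in>supers s. d_Z (comp_of_word u) (comp_of_word t))"
    by (simp add: card_image d_Z_def)
  finally show ?thesis .
qed

text \<open>The empty composition has no descent word. Its only neighbour is \<open>[1]\<close>,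
  which is coded by the empty word.\<close>

lemma d_Z_Nil: "d_Z [] (comp_of_word t) = d_Z [1] (comp_of_word t)"
proof -
  have "{nu. Z_edge [] nu} = {[1]}" by (auto simp: Z_edge_def is_comp_def)
  then have "Z_paths [] (comp_of_word t) = (#) [] ` Z_paths [1] (comp_of_word t)"
    using Z_paths_step[of "[]" "comp_of_word t"] comp_of_word_nonempty[of t]
    by (simp del: comp_of_word_nonempty)
  then show ?thesis by (simp add: d_Z_def card_image)
qed

section \<open>Insertion of a value and restriction to a set of values\<close>

fun inserts :: "nat \<Rightarrow> nat list \<Rightarrow> nat list list" where
  "inserts x [] = [[x]]"
| "inserts x (a # v) = (x # a # v) # map ((#) a) (inserts x v)"

text \<open>Whatever the relative size of the new letter, the descent words obtained by inserting it
  at all places are the one-letter extensions of the old descent word, each exactly once.\<close>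
lemma sum_list_inserts:
  fixes f :: "bool list \<Rightarrow> nat"
  assumes "distinct v" "x \<notin> set v" "v \<noteq> []"
  shows "(\<Sum>u\<leftarrow>inserts x v. f (dword u)) = sum f (supers (dword v))"
  using assms
proof (induction v arbitrary: f rule: dword.induct)
  case (1 a b r)
  define c where "c = (b < a)"
  let ?s = "dword (b # r)"
  have IH: "(\<Sum>u\<leftarrow>inserts x (b # r). f (c # dword u)) = (\<Sum>u\<in>supers ?s. f (c # u))"
    using 1 by (intro "1.IH") auto
  have "a \<noteq> b" "x \<noteq> a" "x \<noteq> b" using 1 by auto
  \<comment> \<open>The induction hypothesis counts the insertion between a and b as if the first
    letter stayed c. The identity exchanges that term for the true one and adds the insertion in
    front; the surplus is the one word of \<open>supers\<close> that does not start with c.\<close>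
  then have "f ((a < x) # c # ?s) + f ((x < a) # (b < x) # ?s) = f (c # (b < x) # ?s) + f ((\<not> c) # c # ?s)"
    unfolding c_def by (cases "b < a"; cases "a < x"; cases "b < x") auto
  moreover have "sum f (supers (c # ?s)) = f ((\<not> c) # c # ?s) + (\<Sum>u\<in>supers ?s. f (c # u))"
    by (simp, subst sum.insert) (auto simp: sum.reindex)
  ultimately show ?case using IH by (simp add: c_def comp_def)
next
  case ("2_2" a)
  then show ?case by (cases "x < a") auto
qed auto

text \<open>Insertion described through its inverse, the deletion of x. In this form a word
  restricted to one more value is recognised as an insertion.\<close>

lemma set_inserts:
  assumes "x \<notin> set v" "distinct v"
  shows "set (inserts x v) = {u. distinct u \<and> x \<in> set u \<and> filter (\<lambda>y. y \<noteq> x) u = v}"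
  using assms
proof (induction v)
  case Nil
  have "u = [x] \<longleftrightarrow> distinct u \<and> x \<in> set u \<and> filter (\<lambda>y. y \<noteq> x) u = []" for u
    by (cases u; cases "tl u") (auto simp: filter_empty_conv)
  then show ?case by (simp only: inserts.simps set_simps singleton_conv[symmetric])
next
  case (Cons a v)
  have IH: "u \<in> set (inserts x v) \<longleftrightarrow> distinct u \<and> x \<in> set u \<and> filter (\<lambda>y. y \<noteq> x) u = v" for u
    by (subst Cons.IH) (use Cons.prems in simp_all)
  have f: "filter (\<lambda>y. y \<noteq> x) v = v" using Cons.prems by (auto simp: filter_id_conv)
  show ?case
  proof (intro set_eqI iffI)
    fix u assume "u \<in> set (inserts x (a # v))"
    then consider "u = x # a # v" | u' where "u = a # u'" "u' \<in> set (inserts x v)"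
      by auto
    then show "u \<in> {u. distinct u \<and> x \<in> set u \<and> filter (\<lambda>y. y \<noteq> x) u = a # v}"
    proof cases
      case 1
      then show ?thesis using Cons.prems f by simp
    next
      case (2 u')
      then have u': "distinct u'" "x \<in> set u'" "filter (\<lambda>y. y \<noteq> x) u' = v" using IH by auto
      then have "a \<notin> set u'" using Cons.prems by auto
      then show ?thesis using 2 u' Cons.prems by auto
    qed
  next
    fix u assume u: "u \<in> {u. distinct u \<and> x \<in> set u \<and> filter (\<lambda>y. y \<noteq> x) u = a # v}"
    then obtain b u' where b: "u = b # u'" by (cases u) auto
    show "u \<in> set (inserts x (a # v))"
    proof (cases "b = x")
      case True
      then have "x \<notin> set u'" "filter (\<lambda>y. y \<noteq> x) u' = a # v" using u b by simp_all
      then have "u' = a # v" by (metis (mono_tags, lifting) filter_True)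
      then show ?thesis using b True by simp
    next
      case False
      then have "b = a" "u' \<in> set (inserts x v)" using u b unfolding IH by simp_all
      then show ?thesis using b by simp
    qed
  qed
qed

lemma distinct_inserts: "x \<notin> set v \<Longrightarrow> distinct (inserts x v)"
  by (induction v) (auto simp: distinct_map)

text \<open>The set T of values is arbitrary, because cutting a word or overwriting one of its
  letters leads away from the values 1..n.\<close>

definition desc_class :: "nat set \<Rightarrow> bool list \<Rightarrow> nat list set" where
  "desc_class T t = {w. distinct w \<and> set w = T \<and> dword w = t}"

lemma finite_desc_class [simp]: "finite T \<Longrightarrow> finite (desc_class T t)"
  by (rule finite_subset[OF _ finite_subset_distinct[of T]])
     (auto simp: desc_class_def)

text \<open>Induction on the number of values of T that v does not show. Reveal one more value x:
  the words with pattern v split according to the place of x among the letters of v, and the new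
  descent words run through \<open>supers\<close>, which is the recursion \<open>d_Z_step\<close>.
  How large x is never enters, so the count depends on v only through
  \<open>dword v\<close>.\<close>

lemma card_desc_class_restrict:
  assumes "finite T" "card T = Suc (length t)" "set v \<subseteq> T" "distinct v" "v \<noteq> []"
  shows "card {w \<in> desc_class T t. filter (\<lambda>y. y \<in> set v) w = v} = d_Z (comp_of_word (dword v)) (comp_of_word t)"
  using assms(3-5)
proof (induction "card (T - set v)" arbitrary: v)
  case 0
  then have T: "set v = T" using assms(1) by auto
  have "{w \<in> desc_class T t. filter (\<lambda>y. y \<in> set v) w = v} = (if dword v = t then {v} else {})"
    using 0 T by (auto simp: desc_class_def)
  moreover have "length (dword v) = length t"
    using assms(2) T distinct_card[OF 0(3)] by simp
  ultimately show ?case by (simp add: d_Z_same_size)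
next
  case (Suc d)
  then obtain x where x: "x \<in> T - set v" by (metis card.empty equals0I nat.distinct(1))
  let ?A = "\<lambda>v. {w \<in> desc_class T t. filter (\<lambda>y. y \<in> set v) w = v}"
  have ins: "distinct u" "set u = insert x (set v)" "u \<noteq> []" if "u \<in> set (inserts x v)" for u
    using that x Suc.prems by (auto simp: set_inserts)
  have "?A v = (\<Union>u\<in>set (inserts x v). ?A u)"
  proof (intro set_eqI iffI)
    fix w assume w: "w \<in> ?A v"
    define u where "u = filter (\<lambda>y. y \<in> insert x (set v)) w"
    have "filter (\<lambda>y. y \<noteq> x) u = filter (\<lambda>y. y \<in> set v) w"
      unfolding u_def filter_filter using x by (intro filter_cong) auto
    then have "u \<in> set (inserts x v)"
      using w x Suc.prems by (auto simp: set_inserts desc_class_def u_def)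
    then show "w \<in> (\<Union>u\<in>set (inserts x v). ?A u)"
      using w ins(2) unfolding u_def by (auto simp: u_def[symmetric])
  next
    fix w assume "w \<in> (\<Union>u\<in>set (inserts x v). ?A u)"
    then obtain u where u: "u \<in> set (inserts x v)" "w \<in> desc_class T t" "filter (\<lambda>y. y \<in> set u) w = u" by auto
    have "filter (\<lambda>y. y \<in> set v) w = filter (\<lambda>y. y \<noteq> x) (filter (\<lambda>y. y \<in> set u) w)"
      unfolding filter_filter using x ins(2)[OF u(1)] by (intro filter_cong) auto
    also have "\<dots> = v" using u x Suc.prems by (simp add: set_inserts)
    finally show "w \<in> ?A v" using u by auto
  qed
  moreover have "?A u \<inter> ?A u' = {}" if "u \<in> set (inserts x v)" "u' \<in> set (inserts x v)" "u \<noteq> u'" for u u'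
    using ins(2)[OF that(1)] ins(2)[OF that(2)] that(3) by auto
  then have "card (\<Union>u\<in>set (inserts x v). ?A u) = (\<Sum>u\<in>set (inserts x v). card (?A u))"
    using assms(1) by (intro card_UN_disjoint ballI impI) simp_all
  ultimately have "card (?A v) = (\<Sum>u\<in>set (inserts x v). card (?A u))"
    by (simp only:)
  also have "\<dots> = (\<Sum>u\<in>set (inserts x v). d_Z (comp_of_word (dword u)) (comp_of_word t))"
  proof (intro sum.cong refl Suc.hyps(1))
    fix u assume u: "u \<in> set (inserts x v)"
    have "T - set v = insert x (T - set u)" using ins(2)[OF u] x by auto
    moreover have "card (insert x (T - set u)) = Suc (card (T - set u))"
      by (rule card_insert_disjoint) (use ins(2)[OF u] assms(1) in auto)
    ultimately have "card (T - set v) = Suc (card (T - set u))" by metis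
    then show "d = card (T - set u)" using Suc.hyps(2) by linarith
  qed (use ins x Suc.prems in auto)
  also have "\<dots> = (\<Sum>u\<leftarrow>inserts x v. d_Z (comp_of_word (dword u)) (comp_of_word t))"
    using x by (subst sum_list_distinct_conv_sum_set) (simp_all add: distinct_inserts)
  also have "\<dots> = (\<Sum>u\<in>supers (dword v). d_Z (comp_of_word u) (comp_of_word t))"
    using sum_list_inserts[where f = "\<lambda>u. d_Z (comp_of_word u) (comp_of_word t)", OF Suc.prems(2) _ Suc.prems(3)] x
    by blast
  also have "\<dots> = d_Z (comp_of_word (dword v)) (comp_of_word t)"
  proof (rule d_Z_step[symmetric])
    have "card (set v) < card T" using x Suc.prems assms(1) by (intro psubset_card_mono) auto
    then show "length (dword v) < length t"
      using assms(2) distinct_card[OF Suc.prems(2)] Suc.prems(3) by (cases v) auto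
  qed
  finally show ?case .
qed

text \<open>Every word shows a pattern of one letter, so the total is a special case; in particular
  it depends on T only through its size.\<close>

lemma card_desc_class:
  assumes "finite T" "card T = Suc (length t)"
  shows "card (desc_class T t) = d_Z [] (comp_of_word t)"
proof -
  obtain x where x: "x \<in> T" using assms by fastforce
  have "filter (\<lambda>y. y \<in> set [x]) w = [x]" if "w \<in> desc_class T t" for w
  proof -
    have "distinct w" "x \<in> set w" using that x by (auto simp: desc_class_def)
    then have "filter (\<lambda>y. y = x) w = [x]"
      by (induction w) (auto simp: filter_empty_conv)
    then show ?thesis by simp
  qed
  then have "{w \<in> desc_class T t. filter (\<lambda>y. y \<in> set [x]) w = [x]} = desc_class T t" by blast
  then show ?thesis using card_desc_class_restrict[of T t "[x]"] assms x by (simp add: d_Z_Nil)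
qed

lemma card_desc_class_pos:
  assumes "finite T" "card T = Suc (length t)"
  shows "0 < card (desc_class T t)"
  using exists_dword[OF assms] finite_desc_class[OF assms(1)]
  by (auto simp: card_gt_0_iff) (auto simp: desc_class_def)

subsection \<open>Concentration of the prefix sets of a descent class\<close>

text \<open>For 0 < b < n consecutive terms have the ratio (n - j) b / ((j + 1) (n - b)), which is
  at least 1 for j < b and at most 1 for j >= b.\<close>

lemma binomial_mode_le:
  assumes "b \<le> n" "j \<le> n"
  shows "(n choose j) * b ^ j * (n - b) ^ (n - j) \<le> (n choose b) * b ^ b * (n - b) ^ (n - b)"
proof -
  define T where "T j = (n choose j) * b ^ j * (n - b) ^ (n - j)" for j
  \<comment> \<open>The ratio in cross-multiplied form. Where a factor vanishes, for b = n or b = 0,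
    monotonicity is checked separately below.\<close>
  have step: "T (Suc j) * (Suc j * (n - b)) = T j * ((n - j) * b)" if "j < n" for j
  proof -
    have "n - j = Suc (n - Suc j)" using that by simp
    moreover have "(n choose Suc j) * Suc j = (n choose j) * (n - j)"
      using binomial_absorb_comp[of n j] binomial_absorption[of j "n - 1"] that
      by (metis Suc_diff_1 bot_nat_0.not_eq_extremum mult.commute not_less_zero Suc_times_binomial_eq binomial_absorption)
    ultimately show ?thesis
      unfolding T_def
      by (smt (verit) mult.assoc mult.commute mult.left_commute power_Suc)
  qed
  have up: "T j \<le> T (Suc j)" if "j < b" for j
  proof (cases "b = n")
    case True
    then have "T j = 0" using that unfolding T_def by (simp add: zero_power)
    then show ?thesis by simp
  next
    case False
    have "(Suc j * (n - b)) \<le> (n - j) * b"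
      using that by (metis Suc_leI diff_le_mono2 less_imp_le mult.commute mult_le_mono)
    then have "T j * (Suc j * (n - b)) \<le> T (Suc j) * (Suc j * (n - b))"
      using step[of j] that assms by simp
    moreover have "0 < Suc j * (n - b)" using False assms by simp
    ultimately show ?thesis using mult_le_cancel2 by blast
  qed
  have down: "T (Suc j) \<le> T j" if "b \<le> j" "j < n" for j
  proof (cases "b = 0")
    case True
    then have "T (Suc j) = 0" unfolding T_def by simp
    then show ?thesis by simp
  next
    case False
    have "(n - j) * b \<le> (Suc j * (n - b))"
      using that by (metis diff_le_mono2 le_SucI mult.commute mult_le_mono)
    then have "T (Suc j) * ((n - j) * b) \<le> T j * ((n - j) * b)"
      using step[of j] that by (metis mult_le_mono2)
    moreover have "0 < (n - j) * b" using False that by simp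
    ultimately show ?thesis using mult_le_cancel2 by blast
  qed
  have "T j \<le> T b"
  proof (cases "j \<le> b")
    case True
    then show ?thesis
      by (induction rule: inc_induct) (use up order_trans in blast)+
  next
    case False
    then have "b \<le> j" by simp
    then show ?thesis using assms(2)
    proof (induction rule: dec_induct)
      case (step i)
      then show ?case using down[of i] by linarith
    qed simp
  qed
  then show ?thesis by (simp add: T_def)
qed

text \<open>None of the n + 1 terms in the expansion of (b + (n - b)) ^ n exceeds the modal one, so
  the mode has probability at least 1 / (n + 1).\<close>

lemma binomial_mode_lower:
  assumes "b \<le> n" "0 < n"
  defines "p \<equiv> real b / real n"
  shows "1 \<le> real (n + 1) * (real (n choose b) * p ^ b * (1 - p) ^ (n - b))"
proof -
  have "n ^ n = (b + (n - b)) ^ n" using assms by simp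
  also have "\<dots> = (\<Sum>j\<le>n. (n choose j) * b ^ j * (n - b) ^ (n - j))"
    by (subst binomial) simp
  also have "\<dots> \<le> (\<Sum>j\<le>n. (n choose b) * b ^ b * (n - b) ^ (n - b))"
    using binomial_mode_le assms(1) by (intro sum_mono) auto
  also have "\<dots> = (n + 1) * ((n choose b) * b ^ b * (n - b) ^ (n - b))" by simp
  finally have "real (n ^ n) \<le> real ((n + 1) * ((n choose b) * b ^ b * (n - b) ^ (n - b)))"
    using of_nat_le_iff by blast
  then have "real n ^ n \<le> real (n + 1) * (real (n choose b) * real b ^ b * (real n - real b) ^ (n - b))"
    using assms(1) by (simp only: of_nat_mult of_nat_power of_nat_diff)
  moreover have "real n ^ n = real n ^ b * real n ^ (n - b)"
    using assms by (simp add: power_add[symmetric])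
  moreover have "1 - p = (real n - real b) / real n" using assms by (simp add: field_simps)
  ultimately show ?thesis
    using assms(2) by (simp add: p_def power_divide field_simps)
qed

lemma card_subsets_inter:
  assumes "finite T" "V \<subseteq> T" "j \<le> b"
  shows "card {A. A \<subseteq> T \<and> card A = b \<and> card (A \<inter> V) = j}
    = (card V choose j) * ((card T - card V) choose (b - j))"
proof -
  have fV: "finite V" using assms finite_subset by blast
  have "bij_betw (\<lambda>A. (A \<inter> V, A - V)) {A. A \<subseteq> T \<and> card A = b \<and> card (A \<inter> V) = j}
     ({B. B \<subseteq> V \<and> card B = j} \<times> {C. C \<subseteq> T - V \<and> card C = b - j})"
  proof (rule bij_betw_byWitness[where f' = "\<lambda>(B, C). B \<union> C"])
    show "(\<lambda>A. (A \<inter> V, A - V)) ` {A. A \<subseteq> T \<and> card A = b \<and> card (A \<inter> V) = j}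
      \<subseteq> {B. B \<subseteq> V \<and> card B = j} \<times> {C. C \<subseteq> T - V \<and> card C = b - j}"
      using assms(1) by (auto simp: card_Diff_subset_Int finite_subset)
    show "(\<lambda>(B, C). B \<union> C) ` ({B. B \<subseteq> V \<and> card B = j} \<times> {C. C \<subseteq> T - V \<and> card C = b - j})
      \<subseteq> {A. A \<subseteq> T \<and> card A = b \<and> card (A \<inter> V) = j}"
    proof clarify
      fix B C assume B: "B \<subseteq> V" "j = card B" and C: "C \<subseteq> T - V" "card C = b - card B"
      have "card (B \<union> C) = card B + card C"
        using B C assms(1) fV by (intro card_Un_disjoint) (auto intro: finite_subset)
      moreover have "(B \<union> C) \<inter> V = B" using B C by auto
      ultimately show "B \<union> C \<subseteq> T \<and> card (B \<union> C) = b \<and> card ((B \<union> C) \<inter> V) = card B"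
        using B C assms by auto
    qed
  qed auto
  then have "card {A. A \<subseteq> T \<and> card A = b \<and> card (A \<inter> V) = j}
      = card ({B. B \<subseteq> V \<and> card B = j} \<times> {C. C \<subseteq> T - V \<and> card C = b - j})"
    by (rule bij_betw_same_card)
  also have "\<dots> = (card V choose j) * (card (T - V) choose (b - j))"
    using assms(1) fV by (simp add: card_cartesian_product n_subsets)
  finally show ?thesis using fV assms(2) by (simp add: card_Diff_subset)
qed

text \<open>A hypergeometric variable is binomial conditioned on a modal event, which costs a factor
  of at most n + 1.\<close>
lemma hypergeometric_tail:
  fixes \<delta> :: real
  assumes T: "finite T" "V \<subseteq> T" "V \<noteq> {}" and b: "0 < b" "b < card T" and \<delta>: "0 \<le> \<delta>"
  shows "real (card {A. A \<subseteq> T \<and> card A = b \<and>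
            \<delta> \<le> \<bar>real (card (A \<inter> V)) / real (card V) - real b / real (card T)\<bar>})
     \<le> 2 * real (card T + 1) * exp (- 2 * real (card V) * \<delta>\<^sup>2) * real (card T choose b)"
proof -
  define n m p q where "n = card T" and "m = card V" and "p = real b / real n" and "q = 1 - p"
  have fV: "finite V" using T finite_subset by blast
  have m: "0 < m" "m \<le> n" using T fV by (auto simp: m_def n_def card_gt_0_iff card_mono)
  have pq: "0 < p" "p < 1" "0 < q" "q < 1" using b by (auto simp: p_def q_def n_def)
  define J where "J = {j. j \<le> b \<and> \<delta> \<le> \<bar>real j / real m - p\<bar>}"
  have fJ: "finite J" by (rule finite_subset[of _ "{..b}"]) (auto simp: J_def)
  define X where "X = {A. A \<subseteq> T \<and> card A = b \<and> \<delta> \<le> \<bar>real (card (A \<inter> V)) / real m - p\<bar>}"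
  have "X = (\<Union>j\<in>J. {A. A \<subseteq> T \<and> card A = b \<and> card (A \<inter> V) = j})"
    using T(1) by (auto simp: X_def J_def intro!: card_mono) (metis finite_subset)
  moreover have "card (\<Union>j\<in>J. {A. A \<subseteq> T \<and> card A = b \<and> card (A \<inter> V) = j})
     = (\<Sum>j\<in>J. card {A. A \<subseteq> T \<and> card A = b \<and> card (A \<inter> V) = j})"
    using T(1) by (intro card_UN_disjoint) (auto simp: J_def)
  ultimately have "card X = (\<Sum>j\<in>J. card {A. A \<subseteq> T \<and> card A = b \<and> card (A \<inter> V) = j})" by simp
  also have "\<dots> = (\<Sum>j\<in>J. (m choose j) * ((n - m) choose (b - j)))"
    using T by (intro sum.cong refl) (simp add: card_subsets_inter J_def m_def n_def)
  \<comment> \<open>The left side is the probability that a random subset of T, containing each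
    element independently with probability p, lies in X.\<close>
  finally have "card X * (p ^ b * q ^ (n - b)) =
      (\<Sum>j\<in>J. real ((m choose j) * ((n - m) choose (b - j))) * (p ^ b * q ^ (n - b)))"
    by (simp add: sum_distrib_right)
  also have "\<dots> \<le> (\<Sum>j\<in>J. pmf (binomial_pmf m p) j)"
  proof (rule sum_mono)
    fix j assume j: "j \<in> J"
    show "real ((m choose j) * ((n - m) choose (b - j))) * (p ^ b * q ^ (n - b)) \<le> pmf (binomial_pmf m p) j"
    proof (cases "j \<le> m \<and> b - j \<le> n - m")
      case True
      have "p ^ b * q ^ (n - b) = (p ^ j * q ^ (m - j)) * (p ^ (b - j) * q ^ (n - m - (b - j)))"
      proof -
        have "j + (b - j) = b" "m - j + (n - m - (b - j)) = n - b"
          using True j m b by (auto simp: J_def n_def)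
        then have "p ^ b = p ^ j * p ^ (b - j)" "q ^ (n - b) = q ^ (m - j) * q ^ (n - m - (b - j))"
          by (metis power_add)+
        then show ?thesis by simp
      qed
      then have "real ((m choose j) * ((n - m) choose (b - j))) * (p ^ b * q ^ (n - b)) =
        pmf (binomial_pmf m p) j * pmf (binomial_pmf (n - m) p) (b - j)"
        using pq by (simp add: pmf_binomial q_def)
      \<comment> \<open>The number of chosen elements outside V is forgotten. What remains is a
        binomial variable on V, to which Hoeffding's inequality applies.\<close>
      also have "\<dots> \<le> pmf (binomial_pmf m p) j" by (simp add: mult_left_le pmf_le_1)
      finally show ?thesis .
    next
      case False
      then have "(m choose j) * ((n - m) choose (b - j)) = 0" by (auto simp: binomial_eq_0)
      then show ?thesis by (simp only: of_nat_0 mult_zero_left pmf_nonneg)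
    qed
  qed
  also have "\<dots> = measure_pmf.prob (binomial_pmf m p) J"
    by (rule measure_measure_pmf_finite[symmetric]) (rule fJ)
  also have "\<dots> \<le> measure_pmf.prob (binomial_pmf m p) {x. \<bar>x / m - p\<bar> \<ge> \<delta>}"
    by (intro measure_pmf.finite_measure_mono) (auto simp: J_def)
  also have "\<dots> \<le> 2 * exp (- 2 * real m * \<delta>\<^sup>2)"
    using binomial_distribution.prob_abs_ge'[of p m \<delta>] pq m \<delta> by (simp add: binomial_distribution_def)
  finally have 1: "card X * (p ^ b * q ^ (n - b)) \<le> 2 * exp (- 2 * real m * \<delta>\<^sup>2)" .
  have 2: "1 \<le> real (n + 1) * (real (n choose b) * p ^ b * q ^ (n - b))"
    using binomial_mode_lower[of b n] b by (simp add: p_def q_def n_def)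
  have "real (card X) \<le> real (card X) * (real (n + 1) * (real (n choose b) * p ^ b * q ^ (n - b)))"
    using mult_left_mono[OF 2, of "real (card X)"] by simp
  also have "\<dots> = (real (n + 1) * real (n choose b)) * (card X * (p ^ b * q ^ (n - b)))"
    by (simp add: mult_ac)
  also have "\<dots> \<le> (real (n + 1) * real (n choose b)) * (2 * exp (- 2 * real m * \<delta>\<^sup>2))"
    by (intro mult_left_mono 1) simp
  finally have "real (card X) \<le> 2 * real (n + 1) * exp (- 2 * real m * \<delta>\<^sup>2) * real (n choose b)"
    by (simp only: mult_ac)
  then show ?thesis unfolding X_def n_def m_def p_def .
qed

section \<open>Cutting a descent class at a change of letter\<close>

lemma dword_take: "dword (take c w) = take (c - 1) (dword w)"
proof (rule nth_equalityI)
  fix i assume "i < length (dword (take c w))"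
  then have "Suc i < length (take c w)" by (simp only: length_dword)
  then show "dword (take c w) ! i = take (c - 1) (dword w) ! i" by (auto simp: nth_dword)
qed auto

lemma dword_drop: "dword (drop c w) = drop c (dword w)"
proof (rule nth_equalityI)
  fix i assume "i < length (dword (drop c w))"
  then have "Suc i < length (drop c w)" by (simp only: length_dword)
  then show "dword (drop c w) ! i = drop c (dword w) ! i" by (simp add: nth_dword)
qed auto

text \<open>Indices start at 0: the letter left free is \<open>t ! (c - 1)\<close>, the comparison
  of the last letter of the prefix of length c with its successor.\<close>

definition cut_class :: "nat set \<Rightarrow> bool list \<Rightarrow> nat \<Rightarrow> nat list set" where
  "cut_class T t c = {w. distinct w \<and> set w = T \<and> dword (take c w) = take (c - 1) t \<and>
     dword (drop c w) = drop c t}"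

lemma finite_cut_class [simp]: "finite T \<Longrightarrow> finite (cut_class T t c)"
  by (rule finite_subset[OF _ finite_subset_distinct[of T]]) (auto simp: cut_class_def)

text \<open>If the letter at index c sits at a peak (valley), overwriting it by a new maximum (minimum)
  restores the missing comparison; only the overwritten value is lost.\<close>
lemma card_cut_class_le:
  assumes T: "finite T" "card T = Suc (length t)" "\<forall>x\<in>T. 0 < x"
    and c: "0 < c" "c < length t" "t ! (c - 1) \<noteq> t ! c"
  shows "card (cut_class T t c) \<le> card T * card (desc_class T t)"
proof -
  \<comment> \<open>If \<open>t ! c\<close> is a descent, the letter before it is an ascent, so
    position c has to become a peak; otherwise a valley. 0 is a new minimum because all values are
    positive.\<close>
  define z where "z = (if t ! c then Suc (Max T) else 0)"
  have z: "(x < z) = t ! c" "(z < x) = (\<not> t ! c)" if "x \<in> T" for x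
  proof -
    define M where "M = Max T"
    have "x \<le> M" "0 < x" using T that by (auto simp: M_def)
    then show "(x < z) = t ! c" "(z < x) = (\<not> t ! c)" by (auto simp: z_def M_def[symmetric])
  qed
  then have zT: "z \<notin> T" by blast
  \<comment> \<open>Overwriting alone is not injective. The lost value is recorded, and its
    \<open>card T\<close> possibilities are the factor in the bound.\<close>
  let ?f = "\<lambda>w. (w ! c, w[c := z])"
  have len: "length w = Suc (length t)" if "w \<in> cut_class T t c" for w
    using that T distinct_card by (fastforce simp: cut_class_def)
  have "?f ` cut_class T t c \<subseteq> (SIGMA a:T. desc_class (insert z (T - {a})) t)"
  proof clarify
    fix w assume w: "w \<in> cut_class T t c"
    then have d: "distinct w" "set w = T" and dw: "dword (take c w) = take (c - 1) t" "dword (drop c w) = drop c t"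
      by (auto simp: cut_class_def)
    have cl: "c < length w" using len[OF w] c by simp
    have wc: "w ! c \<in> T" using d cl by auto
    have "set (w[c := z]) = insert z (T - {w ! c})"
      using d cl by (simp add: set_update_distinct)
    moreover have "distinct (w[c := z])" using d zT by (intro distinct_list_update) auto
    moreover have "dword (w[c := z]) = t"
    proof (rule nth_equalityI)
      fix i assume "i < length (dword (w[c := z]))"
      then have i: "Suc i < length w" by simp
      have inT: "w ! j \<in> T" if "j < length w" for j using d that by auto
      have e: "dword (w[c := z]) ! i \<longleftrightarrow> w[c := z] ! Suc i < w[c := z] ! i"
        using i by (intro nth_dword) simp
      consider "i = c" | "Suc i = c" | "Suc i < c" | "c < i" by linarith
      then show "dword (w[c := z]) ! i = t ! i"
      proof cases
        case 1
        then show ?thesis using e i z(1)[OF inT[of "Suc i"]] cl by simp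
      next
        case 2
        then have "t ! i \<longleftrightarrow> \<not> t ! c" using c(3) by auto
        then show ?thesis using 2 e i z(2)[OF inT[of i]] cl by simp
      next
        case 3
        have "take (c - 1) t ! i \<longleftrightarrow> take c w ! Suc i < take c w ! i"
          unfolding dw(1)[symmetric] using 3 i by (intro nth_dword) auto
        then show ?thesis using e 3 by auto
      next
        case 4
        then obtain j where j: "i = c + j" using less_imp_add_positive by blast
        have "drop c t ! j \<longleftrightarrow> drop c w ! Suc j < drop c w ! j"
          unfolding dw(2)[symmetric] using i j by (intro nth_dword) auto
        then show ?thesis using e 4 j len[OF w] i by auto
      qed
    qed (use len[OF w] in simp)
    ultimately show "w ! c \<in> T \<and> w[c := z] \<in> desc_class (insert z (T - {w ! c})) t"
      using wc by (auto simp: desc_class_def)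
  qed
  moreover have "inj_on ?f (cut_class T t c)"
  proof (rule inj_onI)
    fix v w assume "?f v = ?f w"
    then have "list_update (v[c := z]) c (v ! c) = list_update (w[c := z]) c (w ! c)" by simp
    then show "v = w" by simp
  qed
  moreover have "finite (SIGMA a:T. desc_class (insert z (T - {a})) t)" using T by auto
  ultimately have "card (cut_class T t c) \<le> card (SIGMA a:T. desc_class (insert z (T - {a})) t)"
    using card_inj_on_le by blast
  also have "\<dots> = (\<Sum>a\<in>T. card (desc_class (insert z (T - {a})) t))"
    using T by simp
  also have "\<dots> = (\<Sum>a\<in>T. card (desc_class T t))"
  proof (rule sum.cong)
    fix a assume "a \<in> T"
    then have "card (insert z (T - {a})) = Suc (length t)"
      using T zT by (simp add: card.insert_remove)
    then show "card (desc_class (insert z (T - {a})) t) = card (desc_class T t)"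
      using T by (simp add: card_desc_class)
  qed simp
  finally show ?thesis by simp
qed

text \<open>Once the set of prefix values is fixed, both sides of the cut are filled independently,
  in a number of ways that depends on sizes only. So the prefix set is uniform over the subsets of
  size c.\<close>

lemma card_cut_class_prefix:
  assumes T: "finite T" "card T = Suc (length t)" and c: "0 < c" "c \<le> length t"
    and A: "A \<subseteq> T" "card A = c"
  shows "card {w \<in> cut_class T t c. set (take c w) = A}
     = d_Z [] (comp_of_word (take (c - 1) t)) * d_Z [] (comp_of_word (drop c t))"
proof -
  have fA: "finite A" using A T finite_subset by blast
  have cTA: "card (T - A) = Suc (length (drop c t))" using A T fA c by (simp add: card_Diff_subset)
  have "{w \<in> cut_class T t c. set (take c w) = A}
    = (\<lambda>(u, v). u @ v) ` (desc_class A (take (c - 1) t) \<times> desc_class (T - A) (drop c t))" (is "?L = ?R")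
  proof (intro set_eqI iffI)
    fix w assume w: "w \<in> ?L"
    then have "distinct (take c w @ drop c w)" "set (take c w @ drop c w) = T" "set (take c w) = A"
      unfolding append_take_drop_id by (auto simp: cut_class_def)
    then have "set (drop c w) = T - A" unfolding distinct_append set_append by blast
    then have "(take c w, drop c w) \<in> desc_class A (take (c - 1) t) \<times> desc_class (T - A) (drop c t)"
      using w by (auto simp: desc_class_def cut_class_def)
    then show "w \<in> ?R" by (metis (no_types, lifting) append_take_drop_id image_eqI old.prod.case)
  next
    fix w assume "w \<in> ?R"
    then obtain u v where uv: "w = u @ v" "u \<in> desc_class A (take (c - 1) t)" "v \<in> desc_class (T - A) (drop c t)"
      by auto
    then have "length u = c" using A(2) distinct_card[of u] by (simp add: desc_class_def)
    then show "w \<in> ?L" using uv A by (auto simp: cut_class_def desc_class_def)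
  qed
  moreover have "inj_on (\<lambda>(u, v). u @ v) (desc_class A (take (c - 1) t) \<times> desc_class (T - A) (drop c t))"
  proof (rule inj_onI, clarify)
    fix u v u' v' assume uv: "u \<in> desc_class A (take (c - 1) t)" "u' \<in> desc_class A (take (c - 1) t)" "u @ v = u' @ v'"
    then have "length u = length u'" by (metis (mono_tags, lifting) desc_class_def distinct_card mem_Collect_eq)
    then show "u = u' \<and> v = v'" using uv by simp
  qed
  ultimately have "card {w \<in> cut_class T t c. set (take c w) = A}
    = card (desc_class A (take (c - 1) t)) * card (desc_class (T - A) (drop c t))"
    by (simp add: card_image card_cartesian_product)
  then show ?thesis using T fA cTA A c by (simp add: card_desc_class)
qed

lemma card_cut_class_pred:
  assumes T: "finite T" "card T = Suc (length t)" and c: "0 < c" "c \<le> length t"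
  shows "card {w \<in> cut_class T t c. Q (set (take c w))}
     = card {A. A \<subseteq> T \<and> card A = c \<and> Q A} *
       (d_Z [] (comp_of_word (take (c - 1) t)) * d_Z [] (comp_of_word (drop c t)))"
proof -
  have "card (set (take c w)) = c" if "w \<in> cut_class T t c" for w
  proof -
    have "length w = Suc (length t)" "distinct w"
      using that T distinct_card by (fastforce simp: cut_class_def)+
    then show ?thesis using c by (simp add: distinct_card)
  qed
  then have "{w \<in> cut_class T t c. Q (set (take c w))} =
     (\<Union>A\<in>{A. A \<subseteq> T \<and> card A = c \<and> Q A}. {w \<in> cut_class T t c. set (take c w) = A})"
    by (auto simp: cut_class_def dest: in_set_takeD)
  also have "card \<dots> = (\<Sum>A\<in>{A. A \<subseteq> T \<and> card A = c \<and> Q A}. card {w \<in> cut_class T t c. set (take c w) = A})"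
    using T by (intro card_UN_disjoint) auto
  also have "\<dots> = (\<Sum>A\<in>{A. A \<subseteq> T \<and> card A = c \<and> Q A}.
       d_Z [] (comp_of_word (take (c - 1) t)) * d_Z [] (comp_of_word (drop c t)))"
    using assms by (intro sum.cong refl card_cut_class_prefix) auto
  finally show ?thesis by simp
qed

text \<open>A bad word of the descent class is also bad in the cut class, where the tail is
  hypergeometric. Returning to the size of the descent class costs the factor n, and only there the
  change of letter at c enters.\<close>

lemma desc_class_prefix_concentration:
  fixes \<delta> :: real
  assumes V: "V \<subseteq> {1..n}" "V \<noteq> {}" and t: "n = Suc (length t)"
    and c: "0 < c" "c < length t" "t ! (c - 1) \<noteq> t ! c" and \<delta>: "0 \<le> \<delta>"
  shows "real (card {w \<in> desc_class {1..n} t.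
            \<delta> \<le> \<bar>real (card (set (take c w) \<inter> V)) / real (card V) - real c / real n\<bar>})
     \<le> 2 * real n * real (n + 1) * exp (- 2 * real (card V) * \<delta>\<^sup>2) * real (card (desc_class {1..n} t))"
proof -
  let ?T = "{1..n}"
  let ?Q = "\<lambda>A. \<delta> \<le> \<bar>real (card (A \<inter> V)) / real (card V) - real c / real n\<bar>"
  define d where "d = d_Z [] (comp_of_word (take (c - 1) t)) * d_Z [] (comp_of_word (drop c t))"
  have "{w \<in> cut_class ?T t c. True} = cut_class ?T t c" by simp
  then have free: "card (cut_class ?T t c) = (n choose c) * d"
    using card_cut_class_pred[of ?T t c "\<lambda>_. True"] t c n_subsets[of ?T c] by (simp add: d_def)
  have "desc_class ?T t \<subseteq> cut_class ?T t c"
    by (auto simp: desc_class_def cut_class_def dword_take dword_drop)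
  then have "card {w \<in> desc_class ?T t. ?Q (set (take c w))} \<le> card {w \<in> cut_class ?T t c. ?Q (set (take c w))}"
    using finite_cut_class[of ?T t c]
    by (intro card_mono) auto
  also have "\<dots> = card {A. A \<subseteq> ?T \<and> card A = c \<and> ?Q A} * d"
    using t c by (subst card_cut_class_pred) (simp_all add: d_def)
  finally have "real (card {w \<in> desc_class ?T t. ?Q (set (take c w))})
     \<le> real (card {A. A \<subseteq> ?T \<and> card A = c \<and> ?Q A}) * real d"
    by (simp only: of_nat_mult[symmetric] of_nat_le_iff)
  also have "\<dots> \<le> (2 * real (n + 1) * exp (- 2 * real (card V) * \<delta>\<^sup>2) * real (n choose c)) * real d"
  proof (rule mult_right_mono)
    have "c < card ?T" using c t by simp
    from hypergeometric_tail[OF finite_atLeastAtMost V c(1) this \<delta>]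
    show "real (card {A. A \<subseteq> ?T \<and> card A = c \<and> ?Q A})
        \<le> 2 * real (n + 1) * exp (- 2 * real (card V) * \<delta>\<^sup>2) * real (n choose c)"
      by (simp only: card_atLeastAtMost diff_Suc_1)
  qed simp
  also have "\<dots> = (2 * real (n + 1) * exp (- 2 * real (card V) * \<delta>\<^sup>2)) * real (card (cut_class ?T t c))"
    by (simp only: free of_nat_mult mult.assoc)
  also have "\<dots> \<le> (2 * real (n + 1) * exp (- 2 * real (card V) * \<delta>\<^sup>2)) * real (n * card (desc_class ?T t))"
  proof (intro mult_left_mono)
    have "card (cut_class ?T t c) \<le> n * card (desc_class ?T t)"
      using card_cut_class_le[of ?T t c] t c by simp
    then show "real (card (cut_class ?T t c)) \<le> real (n * card (desc_class ?T t))"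
      by (rule of_nat_mono)
  qed simp
  finally show ?thesis by (simp only: mult_ac of_nat_mult)
qed

subsection \<open>Hausdorff convergence of the run diagrams\<close>

text \<open>A supremum of reals dominates its elements only when they are bounded above, which the
  inclusion in [0,1] provides. Strictness of the bound yields an actual nearby point without any
  closedness.\<close>

lemma hausdist_near:
  assumes "A \<subseteq> {0..1}" "B \<subseteq> {0..1}" "A \<noteq> {}" "B \<noteq> {}" "hausdist A B < \<eta>"
  shows "a \<in> A \<Longrightarrow> \<exists>b\<in>B. \<bar>a - b\<bar> < \<eta>" and "b \<in> B \<Longrightarrow> \<exists>a\<in>A. \<bar>a - b\<bar> < \<eta>"
proof -
  have near: "\<exists>y\<in>Y. \<bar>x - y\<bar> < \<eta>"
    if "X \<subseteq> {0..1}" "Y \<subseteq> {0..1}" "Y \<noteq> {}" "(SUP x\<in>X. infdist x Y) < \<eta>" "x \<in> X" for X Y :: "real set" and x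
  proof -
    have "infdist z Y \<le> 1" if "z \<in> X" for z
    proof -
      obtain y where y: "y \<in> Y" using \<open>Y \<noteq> {}\<close> by blast
      have "infdist z Y \<le> dist z y" by (rule infdist_le[OF y])
      also have "\<dots> \<le> 1"
        using subsetD[OF \<open>X \<subseteq> {0..1}\<close> that] subsetD[OF \<open>Y \<subseteq> {0..1}\<close> y] by (auto simp: dist_real_def)
      finally show ?thesis .
    qed
    then have "bdd_above ((\<lambda>x. infdist x Y) ` X)" by (auto intro!: bdd_aboveI2)
    then have "infdist x Y < \<eta>"
      using cSUP_upper[of x X "\<lambda>x. infdist x Y"] that by linarith
    then have "(INF y\<in>Y. dist x y) < \<eta>" using that(3) by (simp add: infdist_def)
    moreover have "bdd_below (dist x ` Y)" by (rule bdd_belowI2[of _ 0]) simp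
    ultimately show ?thesis using cINF_less_iff[OF that(3), of "dist x" \<eta>] by (auto simp: dist_real_def)
  qed
  show "a \<in> A \<Longrightarrow> \<exists>b\<in>B. \<bar>a - b\<bar> < \<eta>"
    using assms by (intro near[of A B]) (auto simp: hausdist_def)
  show "b \<in> B \<Longrightarrow> \<exists>a\<in>A. \<bar>a - b\<bar> < \<eta>"
    using near[of B A b] assms by (auto simp: hausdist_def abs_minus_commute)
qed

lemma I_int_iff:
  "2 \<le> n \<Longrightarrow> x \<in> I_int n s \<longleftrightarrow> real s - 1 \<le> x * (real n - 1) \<and> x * (real n - 1) \<le> real s"
  by (simp add: I_int_def pos_divide_le_eq pos_le_divide_eq)

text \<open>Tested at the midpoint of cell s, which lies in no other cell. Were it outside the
  interior, some point outside \<open>Gs\<close> would be closer than \<eta> to it, hence still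
  between \<beta> and \<beta>'.\<close>

lemma I_int_cell_in:
  assumes n: "2 \<le> n" and s: "s \<in> {1..n-1}" and S: "S \<subseteq> {1..n-1}"
    and Gs: "{\<beta><..<\<beta>'} \<subseteq> Gs" "0 \<notin> Gs"
    and H: "hausdist ({0..1} - interior (\<Union>s\<in>S. I_int n s)) ({0..1} - Gs) < \<eta>"
    and x: "(\<beta> + \<eta>) * (real n - 1) \<le> real s - 1/2" "real s - 1/2 \<le> (\<beta>' - \<eta>) * (real n - 1)"
  shows "s \<in> S"
proof -
  define x where "x = (real s - 1/2) / (real n - 1)"
  have n1: "0 < real n - 1" using n by simp
  have sr: "1 \<le> real s" "real s \<le> real n - 1" using s n by (auto simp: of_nat_diff)
  have x01: "0 < x" "x < 1" using n1 sr by (auto simp: x_def field_simps)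
  have xb: "\<beta> + \<eta> \<le> x" "x \<le> \<beta>' - \<eta>" using x n1 by (auto simp: x_def field_simps)
  have "x \<in> interior (\<Union>s\<in>S. I_int n s)"
  proof (rule ccontr)
    assume "x \<notin> interior (\<Union>s\<in>S. I_int n s)"
    then have "x \<in> {0..1} - interior (\<Union>s\<in>S. I_int n s)" using x01 by auto
    moreover have "{0..1} - Gs \<noteq> {}" using Gs(2) by (metis DiffI atLeastAtMost_iff empty_iff order_refl zero_le_one)
    ultimately obtain y where y: "y \<in> {0..1} - Gs" "\<bar>x - y\<bar> < \<eta>"
      using hausdist_near(1)[OF _ _ _ _ H, of x] by blast
    then have "\<beta> < y" "y < \<beta>'" using xb by auto
    then show False using y Gs by auto
  qed
  then have "x \<in> (\<Union>s\<in>S. I_int n s)" using interior_subset by blast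
  then obtain s' where s': "s' \<in> S" "x \<in> I_int n s'" by blast
  then have "real s' - 1 \<le> real s - 1/2" "real s - 1/2 \<le> real s'"
    using n1 n by (auto simp: I_int_iff x_def)
  then have "s' = s" by linarith
  then show ?thesis using s' by simp
qed

text \<open>A point outside the interior may be an end point of cells of S. Since the cells are
  closed and finite in number, it still belongs to an omitted cell: otherwise a neighbourhood of it
  would be covered by the cells of S.\<close>

lemma I_int_cell_notin:
  assumes n: "2 \<le> n" and S: "S \<subseteq> {1..n-1}" and Gs: "0 \<notin> Gs"
    and H: "hausdist ({0..1} - interior (\<Union>s\<in>S. I_int n s)) ({0..1} - Gs) < \<eta>"
    and b: "\<beta> \<in> {0..1} - Gs" "\<eta> \<le> \<beta>" "\<eta> \<le> 1 - \<beta>"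
  shows "\<exists>s\<in>{1..n-1} - S. \<bar>real s - \<beta> * (real n - 1)\<bar> \<le> \<eta> * (real n - 1) + 1"
proof -
  have n1: "0 < real n - 1" using n by simp
  let ?I = "interior (\<Union>s\<in>S. I_int n s)"
  have "0 \<notin> ?I"
  proof
    assume "0 \<in> ?I"
    then obtain e where e: "0 < e" "ball 0 e \<subseteq> (\<Union>s\<in>S. I_int n s)" by (auto simp: mem_interior)
    then have "- e / 2 \<in> (\<Union>s\<in>S. I_int n s)" by (auto simp: subset_iff dist_real_def)
    then obtain s where s: "s \<in> S" "(real s - 1) / (real n - 1) \<le> - e / 2" by (auto simp: I_int_def)
    have "0 \<le> (real s - 1) / (real n - 1)" using s S n1 by auto
    then show False using s e by linarith
  qed
  then have "{0..1} - ?I \<noteq> {}" by (metis DiffI atLeastAtMost_iff empty_iff order_refl zero_le_one)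
  then obtain y where y: "y \<in> {0..1} - ?I" "\<bar>y - \<beta>\<bar> < \<eta>"
    using hausdist_near(2)[OF _ _ _ _ H, of \<beta>] b by blast
  \<comment> \<open>The bounds on \<eta> exclude the end points 0 and 1, which lie outside the
    interior whatever S is and so carry no information.\<close>
  then have y01: "0 < y" "y < 1" using b by auto
  let ?F = "\<Union>s\<in>{1..n-1} - S. I_int n s"
  have "y \<in> ?F"
  proof (rule ccontr)
    assume yF: "y \<notin> ?F"
    have "closed ?F" by (intro closed_UN) (auto simp: I_int_def)
    then have op: "open (- ?F \<inter> {0<..<1})" by (intro open_Int open_Compl) auto
    have "- ?F \<inter> {0<..<1} \<subseteq> (\<Union>s\<in>S. I_int n s)"
    proof
      fix z assume z: "z \<in> - ?F \<inter> {0<..<1}"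
      define s where "s = nat \<lceil>z * (real n - 1)\<rceil>"
      have zp: "0 < z * (real n - 1)" "z * (real n - 1) \<le> real n - 1"
        using z n1 mult_right_mono[of z 1 "real n - 1"] by auto
      have sz: "real s - 1 < z * (real n - 1)" "z * (real n - 1) \<le> real s"
        using zp unfolding s_def by linarith+
      have "0 < real s" "real s < real n" using sz zp by linarith+
      then have "s \<in> {1..n-1}" by auto
      moreover have "z \<in> I_int n s" using sz n by (simp add: I_int_iff)
      ultimately show "z \<in> (\<Union>s\<in>S. I_int n s)" using z by auto
    qed
    then have "- ?F \<inter> {0<..<1} \<subseteq> ?I" using op by (rule interior_maximal)
    then show False using yF y y01 by auto
  qed
  then obtain s where s: "s \<in> {1..n-1} - S" "y \<in> I_int n s" by blast
  then have "real s - 1 \<le> y * (real n - 1)" "y * (real n - 1) \<le> real s"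
    using n by (simp_all add: I_int_iff)
  moreover have "\<bar>(y - \<beta>) * (real n - 1)\<bar> \<le> \<eta> * (real n - 1)"
    unfolding abs_mult using y n1 by (intro mult_mono) auto
  ultimately have "\<bar>real s - \<beta> * (real n - 1)\<bar> \<le> \<eta> * (real n - 1) + 1"
    unfolding left_diff_distrib by linarith
  then show ?thesis using s by blast
qed

lemma change_between:
  fixes f :: "nat \<Rightarrow> bool"
  assumes "f a \<noteq> f b" "a < b"
  obtains c where "a \<le> c" "c < b" "f c \<noteq> f (Suc c)"
proof -
  have "\<exists>c. a \<le> c \<and> c < b \<and> f c \<noteq> f (Suc c)"
  proof (rule ccontr)
    assume *: "\<not> ?thesis"
    have "c \<le> b \<longrightarrow> f c = f a" if "a \<le> c" for c
      using that
    proof (induction c rule: dec_induct)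
      case (step c)
      have "c < b \<Longrightarrow> f c = f (Suc c)" using * step.hyps by blast
      then show ?case using step.IH by (metis Suc_le_lessD less_imp_le)
    qed simp
    then show False using assms by (metis less_imp_le order_refl)
  qed
  then show ?thesis using that by blast
qed

lemma U_of_comp_of_word:
  "fst (U_of_comp (comp_of_word t)) =
     interior (\<Union>s\<in>{s \<in> {1..length t}. \<not> t ! (s - 1)}. I_int (Suc (length t)) s)"
  "snd (U_of_comp (comp_of_word t)) =
     interior (\<Union>s\<in>{s \<in> {1..length t}. t ! (s - 1)}. I_int (Suc (length t)) s)"
proof -
  have "{1..length t} - descent_set (comp_of_word t) = {s \<in> {1..length t}. \<not> t ! (s - 1)}"
    "{1..length t} \<inter> descent_set (comp_of_word t) = {s \<in> {1..length t}. t ! (s - 1)}"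
    by (auto simp: descent_set_comp_of_word)
  then show "fst (U_of_comp (comp_of_word t)) =
     interior (\<Union>s\<in>{s \<in> {1..length t}. \<not> t ! (s - 1)}. I_int (Suc (length t)) s)"
  "snd (U_of_comp (comp_of_word t)) =
     interior (\<Union>s\<in>{s \<in> {1..length t}. t ! (s - 1)}. I_int (Suc (length t)) s)"
    by (simp_all add: U_of_comp_def Let_def)
qed

text \<open>Being outside \<open>fst U\<close> forces a descent cell near \<beta>, being outside
  \<open>snd U\<close> an ascent cell; between the two the letter changes.\<close>

lemma change_near_break:
  assumes U: "U \<in> U2" and t: "t \<noteq> []" and H: "U2_dist (U_of_comp (comp_of_word t)) U < \<eta>"
    and b: "\<beta> \<in> {0..1}" "\<beta> \<notin> fst U" "\<beta> \<notin> snd U" "\<eta> \<le> \<beta>" "\<eta> \<le> 1 - \<beta>"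
  shows "\<exists>c. 0 < c \<and> c < length t \<and> t ! (c - 1) \<noteq> t ! c \<and>
     \<bar>real c - \<beta> * real (length t)\<bar> \<le> \<eta> * real (length t) + 1"
proof -
  let ?n = "Suc (length t)"
  have U0: "0 \<notin> fst U" "0 \<notin> snd U" using U by (auto simp: U2_def)
  have n: "2 \<le> ?n" using t by (cases t) auto
  have H1: "hausdist ({0..1} - interior (\<Union>s\<in>{s \<in> {1..length t}. \<not> t ! (s - 1)}. I_int ?n s)) ({0..1} - fst U) < \<eta>"
    and H2: "hausdist ({0..1} - interior (\<Union>s\<in>{s \<in> {1..length t}. t ! (s - 1)}. I_int ?n s)) ({0..1} - snd U) < \<eta>"
    using H by (simp_all add: U2_dist_def U_of_comp_of_word)
  obtain s where s: "s \<in> {1..length t}" "t ! (s - 1)" "\<bar>real s - \<beta> * real (length t)\<bar> \<le> \<eta> * real (length t) + 1"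
    using I_int_cell_notin[OF n _ U0(1) H1, of \<beta>] b by (force simp: subset_iff)
  obtain s' where s': "s' \<in> {1..length t}" "\<not> t ! (s' - 1)" "\<bar>real s' - \<beta> * real (length t)\<bar> \<le> \<eta> * real (length t) + 1"
    using I_int_cell_notin[OF n _ U0(2) H2, of \<beta>] b by (force simp: subset_iff)
  have key: ?thesis if asm: "a \<in> {1..length t}" "b \<in> {1..length t}" "a < b" "t ! (a - 1) \<noteq> t ! (b - 1)"
     "\<bar>real a - \<beta> * real (length t)\<bar> \<le> \<eta> * real (length t) + 1"
     "\<bar>real b - \<beta> * real (length t)\<bar> \<le> \<eta> * real (length t) + 1" for a b
  proof -
    obtain c where c: "a \<le> c" "c < b" "t ! (c - 1) \<noteq> t ! (Suc c - 1)"
      using change_between[of "\<lambda>i. t ! (i - 1)" a b] asm(3,4) by blast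
    have "real a \<le> real c" "real c \<le> real b" using c by auto
    then have "\<bar>real c - \<beta> * real (length t)\<bar> \<le> \<eta> * real (length t) + 1" using asm by linarith
    then show ?thesis using c asm by (intro exI[of _ c]) auto
  qed
  have "s \<noteq> s'" using s s' by auto
  then show ?thesis using key[of s s'] key[of s' s] s s' by (cases "s < s'") auto
qed

text \<open>The letter with index r belongs to cell r + 1, whose midpoint is r + 1/2 divided by
  \<open>length t\<close>; this is the origin of the 1/2.\<close>

lemma monotone_inside:
  assumes U: "U \<in> U2" and t: "t \<noteq> []" and H: "U2_dist (U_of_comp (comp_of_word t)) U < \<eta>"
    and r: "r < length t" and x: "(\<beta> + \<eta>) * real (length t) \<le> real r + 1/2" "real r + 1/2 \<le> (\<beta>' - \<eta>) * real (length t)"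
  shows "{\<beta><..<\<beta>'} \<subseteq> fst U \<Longrightarrow> \<not> t ! r" and "{\<beta><..<\<beta>'} \<subseteq> snd U \<Longrightarrow> t ! r"
proof -
  let ?n = "Suc (length t)"
  have U0: "0 \<notin> fst U" "0 \<notin> snd U" using U by (auto simp: U2_def)
  have n: "2 \<le> ?n" using t by (cases t) auto
  have H1: "hausdist ({0..1} - interior (\<Union>s\<in>{s \<in> {1..length t}. \<not> t ! (s - 1)}. I_int ?n s)) ({0..1} - fst U) < \<eta>"
    and H2: "hausdist ({0..1} - interior (\<Union>s\<in>{s \<in> {1..length t}. t ! (s - 1)}. I_int ?n s)) ({0..1} - snd U) < \<eta>"
    using H by (simp_all add: U2_dist_def U_of_comp_of_word)
  show "\<not> t ! r" if "{\<beta><..<\<beta>'} \<subseteq> fst U"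
    using I_int_cell_in[OF n _ _ that U0(1) H1, of "Suc r"] r x by (force simp: subset_iff)
  show "t ! r" if "{\<beta><..<\<beta>'} \<subseteq> snd U"
    using I_int_cell_in[OF n _ _ that U0(2) H2, of "Suc r"] r x by (force simp: subset_iff)
qed

text \<open>Each further position adds at most one value. This allows the change position, known
  only approximately, to be replaced by the fixed cut at \<beta> n.\<close>

lemma card_take_inter_diff:
  "\<bar>real (card (set (take c w) \<inter> V)) - real (card (set (take b w) \<inter> V))\<bar> \<le> \<bar>real c - real b\<bar>"
proof -
  have *: "\<bar>real (card (set (take c w) \<inter> V)) - real (card (set (take b w) \<inter> V))\<bar> \<le> \<bar>real c - real b\<bar>"
    if "b \<le> c" for b c
  proof -
    have "take c w = take b w @ take (c - b) (drop b w)"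
      using that by (metis le_add_diff_inverse take_add)
    then have "set (take c w) \<inter> V \<subseteq> (set (take b w) \<inter> V) \<union> set (take (c - b) (drop b w))" by auto
    then have "card (set (take c w) \<inter> V) \<le> card ((set (take b w) \<inter> V) \<union> set (take (c - b) (drop b w)))"
      by (intro card_mono) auto
    also have "\<dots> \<le> card (set (take b w) \<inter> V) + card (set (take (c - b) (drop b w)))"
      by (rule card_Un_le)
    also have "card (set (take (c - b) (drop b w))) \<le> c - b"
      using card_length[of "take (c - b) (drop b w)"] by simp
    finally have 1: "card (set (take c w) \<inter> V) \<le> card (set (take b w) \<inter> V) + (c - b)" by simp
    have 2: "card (set (take b w) \<inter> V) \<le> card (set (take c w) \<inter> V)"
      using that by (intro card_mono) (auto dest: subsetD[OF set_take_subset_set_take])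
    show ?thesis using 1 2 that by linarith
  qed
  show ?thesis using *[of b c] *[of c b] by (cases "b \<le> c") (auto simp: abs_minus_commute)
qed

lemma desc_class_break_concentration:
  fixes \<beta> \<alpha> \<delta> :: real and t :: "nat \<Rightarrow> bool list" and V :: "nat \<Rightarrow> nat set"
  assumes U: "U \<in> U2" and t: "\<And>n. 2 \<le> n \<Longrightarrow> length (t n) = n - 1"
    and H: "(\<lambda>n. U2_dist (U_of_comp (comp_of_word (t n))) U) \<longlonglongrightarrow> 0"
    and b: "\<beta> \<in> {0..1}" "\<beta> \<notin> fst U" "\<beta> \<notin> snd U"
    and V: "\<And>n. V n \<subseteq> {1..n}" "0 < \<alpha>" "eventually (\<lambda>n. \<alpha> * real n \<le> real (card (V n))) sequentially"
    and \<delta>: "0 < \<delta>"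
  shows "(\<lambda>n. real (card {w \<in> desc_class {1..n} (t n).
       \<delta> \<le> \<bar>real (card (set (take (nat \<lfloor>\<beta> * real n\<rfloor>) w) \<inter> V n)) / real (card (V n)) - \<beta>\<bar>})
     / real (card (desc_class {1..n} (t n)))) \<longlonglongrightarrow> 0" (is "?f \<longlonglongrightarrow> 0")
proof -
  \<comment> \<open>The end points need not have a change of letter nearby, but there the prefix is
    empty or the whole word, and the proportion is exact.\<close>
  consider "\<beta> = 0" | "\<beta> = 1" | "0 < \<beta>" "\<beta> < 1" using b by fastforce
  then show ?thesis
  proof cases
    case 1
    then show ?thesis using \<delta> by simp
  next
    case 2
    have "eventually (\<lambda>n. ?f n = 0) sequentially"
      using V(3) eventually_gt_at_top[of 0]
    proof eventually_elim
      case (elim n)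
      have pos: "0 < real (card (V n))"
        using elim V(2) by (meson less_le_trans mult_pos_pos of_nat_0_less_iff)
      have "set (take (nat \<lfloor>\<beta> * real n\<rfloor>) w) \<inter> V n = V n" if "w \<in> desc_class {1..n} (t n)" for w
      proof -
        have "length w = n" "set w = {1..n}" using that distinct_card[of w] by (auto simp: desc_class_def)
        then show ?thesis using 2 V(1)[of n] by auto
      qed
      then have "{w \<in> desc_class {1..n} (t n).
       \<delta> \<le> \<bar>real (card (set (take (nat \<lfloor>\<beta> * real n\<rfloor>) w) \<inter> V n)) / real (card (V n)) - \<beta>\<bar>} = {}"
        using 2 pos \<delta> by auto
      then show ?case by (simp only: card.empty of_nat_0 div_0)
    qed
    then show ?thesis by (rule tendsto_eventually)
  next
    case 3
    \<comment> \<open>The first two bounds keep \<beta> at distance at least \<eta> from 0 and 1.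
      The others make two errors at most \<delta> / 4 each: replacing c / n by \<beta>, and moving
      the cut from c to \<beta> n, which affects at most 2 \<eta> n values while \<open>V n\<close>
      has at least \<alpha> n.\<close>
    define \<eta> where "\<eta> = min (min (\<beta> / 2) ((1 - \<beta>) / 2)) (min (\<delta> / 8) (\<delta> * \<alpha> / 8))"
    have \<eta>: "0 < \<eta>" "\<eta> \<le> \<beta>" "\<eta> \<le> 1 - \<beta>" "\<eta> \<le> \<delta> / 8" "\<eta> \<le> \<delta> * \<alpha> / 8"
      using 3 \<delta> V(2) by (auto simp: \<eta>_def min_le_iff_disj)
    define g where "g n = 2 * real n * real (n + 1) * exp (- 2 * (\<alpha> * real n) * (\<delta>/4)\<^sup>2)" for n
    define \<kappa> where "\<kappa> = 2 * \<alpha> * (\<delta>/4)\<^sup>2"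
    have \<kappa>: "0 < \<kappa>" using V(2) \<delta> by (simp add: \<kappa>_def)
    have geq: "g = (\<lambda>n. 2 * real n * real (n + 1) * exp (- \<kappa> * real n))"
      by (rule ext) (simp add: g_def \<kappa>_def)
    have g0: "g \<longlonglongrightarrow> 0" unfolding geq using \<kappa> by real_asymp
    have Hev: "eventually (\<lambda>n. U2_dist (U_of_comp (comp_of_word (t n))) U < \<eta>) sequentially"
      using order_tendstoD(2)[OF H \<eta>(1)] .
    have big: "eventually (\<lambda>n. 3 \<le> \<eta> * real n) sequentially"
      using \<eta>(1) by real_asymp
    have "eventually (\<lambda>n. norm (?f n) \<le> g n) sequentially"
      using V(3) Hev big eventually_ge_at_top[of 2]
    proof eventually_elim
      case (elim n)
      have len: "length (t n) = n - 1" "n = Suc (length (t n))" "t n \<noteq> []" using t[of n] elim by auto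
      obtain c where c: "0 < c" "c < length (t n)" "t n ! (c - 1) \<noteq> t n ! c"
        and cb: "\<bar>real c - \<beta> * real (length (t n))\<bar> \<le> \<eta> * real (length (t n)) + 1"
        using change_near_break[OF U len(3) elim(2) b \<eta>(2,3)] by blast
      have ln: "real (length (t n)) = real n - 1" using len elim by (simp add: of_nat_diff)
      have "\<bar>real c - \<beta> * real n\<bar> \<le> \<bar>real c - \<beta> * real (length (t n))\<bar> + \<beta>"
        using 3 by (simp add: ln algebra_simps)
      also have "\<dots> \<le> \<eta> * real n + 2"
      proof -
        have "\<eta> * real (length (t n)) \<le> \<eta> * real n" using \<eta>(1) ln by (intro mult_left_mono) auto
        then show ?thesis using cb 3 by linarith
      qed
      finally have c1: "\<bar>real c - \<beta> * real n\<bar> \<le> \<eta> * real n + 2" .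
      let ?b = "nat \<lfloor>\<beta> * real n\<rfloor>"
      have "0 \<le> \<beta> * real n" using 3 by simp
      then have "\<bar>real ?b - \<beta> * real n\<bar> \<le> 1" by linarith
      then have c2: "\<bar>real c - real ?b\<bar> \<le> 2 * (\<eta> * real n)" using c1 elim by linarith
      define m where "m = real (card (V n))"
      have n0: "0 < real n" using elim by simp
      have m0: "0 < m" "\<alpha> * real n \<le> m" using elim V(2) n0 unfolding m_def
        by (meson less_le_trans mult_pos_pos)+
      have c3: "\<bar>real c / real n - \<beta>\<bar> \<le> \<delta> / 4"
      proof -
        have "\<bar>real c - \<beta> * real n\<bar> \<le> 2 * \<eta> * real n" using c1 elim by linarith
        then have "\<bar>real c / real n - \<beta>\<bar> \<le> 2 * \<eta>" using n0 by (simp add: abs_le_iff field_simps)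
        then show ?thesis using \<eta> by linarith
      qed
      have c4: "\<bar>real c - real ?b\<bar> / m \<le> \<delta> / 4"
      proof -
        have "2 * (\<eta> * real n) \<le> 2 * ((\<delta> * \<alpha> / 8) * real n)" using \<eta> by (intro mult_left_mono mult_right_mono) auto
        also have "\<dots> = \<delta> / 4 * (\<alpha> * real n)" by simp
        also have "\<dots> \<le> \<delta> / 4 * m" using m0 \<delta> by (intro mult_left_mono) auto
        finally have "\<bar>real c - real ?b\<bar> \<le> \<delta> / 4 * m" using c2 by linarith
        then show ?thesis using m0 by (simp add: pos_divide_le_eq)
      qed
      let ?W = "desc_class {1..n} (t n)"
      have "{w \<in> ?W. \<delta> \<le> \<bar>real (card (set (take ?b w) \<inter> V n)) / m - \<beta>\<bar>}
        \<subseteq> {w \<in> ?W. \<delta> / 4 \<le> \<bar>real (card (set (take c w) \<inter> V n)) / m - real c / real n\<bar>}"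
      proof safe
        fix w assume *: "\<delta> \<le> \<bar>real (card (set (take ?b w) \<inter> V n)) / m - \<beta>\<bar>"
        have "\<bar>real (card (set (take c w) \<inter> V n)) / m - real (card (set (take ?b w) \<inter> V n)) / m\<bar>
          = \<bar>real (card (set (take c w) \<inter> V n)) - real (card (set (take ?b w) \<inter> V n))\<bar> / m"
          using m0 by (simp add: diff_divide_distrib[symmetric])
        also have "\<dots> \<le> \<bar>real c - real ?b\<bar> / m"
          using m0 by (intro divide_right_mono card_take_inter_diff) auto
        finally show "\<delta> / 4 \<le> \<bar>real (card (set (take c w) \<inter> V n)) / m - real c / real n\<bar>"
          using * c3 c4 \<delta> by linarith
      qed
      then have "real (card {w \<in> ?W. \<delta> \<le> \<bar>real (card (set (take ?b w) \<inter> V n)) / m - \<beta>\<bar>})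
        \<le> real (card {w \<in> ?W. \<delta> / 4 \<le> \<bar>real (card (set (take c w) \<inter> V n)) / m - real c / real n\<bar>})"
        by (intro of_nat_mono card_mono) auto
      also have "\<dots> \<le> 2 * real n * real (n + 1) * exp (- 2 * m * (\<delta>/4)\<^sup>2) * real (card ?W)"
        unfolding m_def
        by (rule desc_class_prefix_concentration[OF V(1) _ len(2) c]) (use m0 \<delta> in \<open>auto simp: m_def\<close>)
      also have "\<dots> \<le> g n * real (card ?W)"
      proof (rule mult_right_mono)
        have "- 2 * m * (\<delta>/4)\<^sup>2 \<le> - 2 * (\<alpha> * real n) * (\<delta>/4)\<^sup>2"
          using m0 by (intro mult_right_mono) auto
        then show "2 * real n * real (n + 1) * exp (- 2 * m * (\<delta>/4)\<^sup>2) \<le> g n"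
          unfolding g_def by (intro mult_left_mono) auto
      qed simp
      finally have "real (card {w \<in> ?W. \<delta> \<le> \<bar>real (card (set (take ?b w) \<inter> V n)) / m - \<beta>\<bar>})
         \<le> g n * real (card ?W)" .
      moreover have "0 < real (card ?W)"
        using card_desc_class_pos[of "{1..n}" "t n"] len(2) by simp
      ultimately have "?f n \<le> g n"
        unfolding m_def by (subst pos_divide_le_eq)
      then show ?case by simp
    qed
    then show ?thesis using g0 by (rule Lim_null_comparison)
  qed
qed

subsection \<open>Patterns determined by blocks\<close>

lemma sorted_wrt_map_pos:
  "(\<forall>p q. p < q \<and> q < length ys \<longrightarrow> f (ys ! p) < f (ys ! q)) \<longleftrightarrow> sorted_wrt (<) (map f ys)"
  for f :: "'a \<Rightarrow> 'b :: linorder"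
  by (auto simp: sorted_wrt_map sorted_wrt_iff_nth_less)

lemma ex1_perm_word_sorted:
  fixes key :: "nat \<Rightarrow> 'b :: linorder"
  assumes "inj_on key {1..k}"
  shows "\<exists>!w. perm_word k w \<and> (\<forall>p q. p < q \<and> q < k \<longrightarrow> key (w ! p) < key (w ! q))"
proof -
  have len: "length w = k" if "perm_word k w" for w
    using that distinct_card[of w] by (simp add: perm_word_def)
  define w0 where "w0 = sort_key key [1..<Suc k]"
  have w0: "perm_word k w0" by (auto simp: perm_word_def w0_def)
  have "sorted (map key w0)" by (simp add: w0_def)
  moreover have "distinct (map key w0)" using assms w0 by (simp add: perm_word_def distinct_map)
  ultimately have "sorted_wrt (<) (map key w0)" by (simp add: strict_sorted_iff)
  then have s0: "\<forall>p q. p < q \<and> q < k \<longrightarrow> key (w0 ! p) < key (w0 ! q)"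
    using sorted_wrt_map_pos[of w0 key] len[OF w0] by simp
  have uniq: "w = w0" if w: "perm_word k w" "\<forall>p q. p < q \<and> q < k \<longrightarrow> key (w ! p) < key (w ! q)" for w
  proof -
    have "sorted_wrt (<) (map key w)" using sorted_wrt_map_pos[of w key] len[OF w(1)] w(2) by simp
    moreover have "sorted_wrt (<) (map key w0)" using sorted_wrt_map_pos[of w0 key] len[OF w0] s0 by simp
    moreover have "set w = set w0" using w w0 by (simp add: perm_word_def)
    ultimately have "map key w = map key w0" by (intro strict_sorted_equal) auto
    then show ?thesis using assms w w0 by (intro map_inj_on[of key w w0]) (auto simp: perm_word_def)
  qed
  show ?thesis
    by (rule ex1I[of _ w0], rule conjI[OF w0 s0]) (rule uniq; erule conjunct1 conjunct2)
qed

lemma filter_eq_iff_pos: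
  fixes pos :: "'a \<Rightarrow> nat"
  assumes w: "distinct w" and pos: "\<And>i. i < length w \<Longrightarrow> pos (w ! i) = i"
    and ys: "set ys \<subseteq> set w"
  shows "filter (\<lambda>y. y \<in> set ys) w = ys \<longleftrightarrow>
    (\<forall>p q. p < q \<and> q < length ys \<longrightarrow> pos (ys ! p) < pos (ys ! q))"
proof -
  let ?F = "filter (\<lambda>y. y \<in> set ys) w"
  have "sorted_wrt (\<lambda>x y. pos x < pos y) w"
    using pos by (auto simp: sorted_wrt_iff_nth_less)
  then have F: "sorted_wrt (<) (map pos ?F)" by (simp add: sorted_wrt_map sorted_wrt_filter)
  have inj: "inj_on pos (set w)"
    using pos by (intro inj_onI) (metis in_set_conv_nth)
  have "?F = ys" if "sorted_wrt (<) (map pos ys)"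
  proof -
    have "set ?F = set ys" using ys by auto
    then have "map pos ?F = map pos ys" using F that by (intro strict_sorted_equal) auto
    then show ?thesis using inj ys by (intro map_inj_on[of pos]) (auto intro: inj_on_subset)
  qed
  then show ?thesis using F unfolding sorted_wrt_map_pos by metis
qed

text \<open>A block not flagged by \<open>dn\<close> counts as ascending. For blocks that are
  neither ascending nor descending this is an arbitrary convention; two points rarely share such a
  block.\<close>

definition blk_prec :: "(nat \<Rightarrow> bool) \<Rightarrow> (nat \<Rightarrow> nat) \<Rightarrow> nat \<Rightarrow> nat \<Rightarrow> bool" where
  "blk_prec dn j a b \<longleftrightarrow> j a < j b \<or> (j a = j b \<and> (if dn (j a) then b < a else a < b))"

definition blk_sorted :: "nat \<Rightarrow> (nat \<Rightarrow> bool) \<Rightarrow> nat list \<Rightarrow> (nat \<Rightarrow> nat) \<Rightarrow> bool" where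
  "blk_sorted k dn w j \<longleftrightarrow> (\<forall>p q. p < q \<and> q < k \<longrightarrow> blk_prec dn j (w ! p) (w ! q))"

lemma perm_word_nth:
  assumes "perm_word k w" "p < k"
  shows "w ! p \<in> {1..k}"
  using assms distinct_card[of w] nth_mem[of p w] by (auto simp: perm_word_def)

lemma perm_word_nth_neq:
  assumes "perm_word k w" "p < q" "q < k"
  shows "w ! p \<noteq> w ! q"
  using assms distinct_card[of w] by (auto simp: perm_word_def nth_eq_iff_index_eq)

lemma blk_sorted_cong:
  assumes "perm_word k w" "\<And>a b. a \<in> {1..k} \<Longrightarrow> b \<in> {1..k} \<Longrightarrow> a \<noteq> b \<Longrightarrow> R a b \<longleftrightarrow> blk_prec dn j a b"
  shows "(\<forall>p q. p < q \<and> q < k \<longrightarrow> R (w ! p) (w ! q)) \<longleftrightarrow> blk_sorted k dn w j"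
proof -
  have "R (w ! p) (w ! q) \<longleftrightarrow> blk_prec dn j (w ! p) (w ! q)" if "p < q" "q < k" for p q
    using that by (intro assms(2) perm_word_nth[OF assms(1)] perm_word_nth_neq[OF assms(1)]) auto
  then show ?thesis unfolding blk_sorted_def by blast
qed

lemma blk_sorted_restrict:
  assumes "perm_word k w"
  shows "blk_sorted k dn w (restrict j {1..k}) \<longleftrightarrow> blk_sorted k dn w j"
  using blk_sorted_cong[OF assms, of "blk_prec dn (restrict j {1..k})" dn j]
  by (simp add: blk_prec_def blk_sorted_def)

lemma ex1_blk_sorted: "\<exists>!w. perm_word k w \<and> blk_sorted k dn w j"
proof -
  \<comment> \<open>Blocks are spaced by 2 k + 1, which exceeds the difference of any two offsets a
    or - a with a in 1..k, so the block decides first.\<close>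
  define key :: "nat \<Rightarrow> int" where
    "key a = int (j a) * (2 * int k + 1) + (if dn (j a) then - int a else int a)" for a
  have less: "key a < key b" if "a \<in> {1..k}" "b \<in> {1..k}" "j a < j b" for a b
  proof -
    have "int (j a) + 1 \<le> int (j b)" using that by simp
    then have "(int (j a) + 1) * (2 * int k + 1) \<le> int (j b) * (2 * int k + 1)"
      by (intro mult_right_mono) auto
    then show ?thesis using that unfolding key_def distrib_right by (auto split: if_splits)
  qed
  have key: "key a < key b \<longleftrightarrow> blk_prec dn j a b" if ab: "a \<in> {1..k}" "b \<in> {1..k}" for a b
  proof -
    consider "j a < j b" | "j b < j a" | "j a = j b" by linarith
    then show ?thesis
      using less[OF ab] less[OF ab(2,1)] by cases (auto simp: blk_prec_def key_def)
  qed
  have "inj_on key {1..k}"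
  proof (rule inj_onI)
    fix a b assume ab: "a \<in> {1..k}" "b \<in> {1..k}" "key a = key b"
    then have "\<not> blk_prec dn j a b" "\<not> blk_prec dn j b a" using key by (metis less_irrefl)+
    then show "a = b" by (auto simp: blk_prec_def split: if_splits)
  qed
  then have "\<exists>!w. perm_word k w \<and> (\<forall>p q. p < q \<and> q < k \<longrightarrow> key (w ! p) < key (w ! q))"
    by (rule ex1_perm_word_sorted)
  moreover have "perm_word k w \<and> (\<forall>p q. p < q \<and> q < k \<longrightarrow> key (w ! p) < key (w ! q)) \<longleftrightarrow>
     perm_word k w \<and> blk_sorted k dn w j" for w
    using blk_sorted_cong[of k w "\<lambda>a b. key a < key b" dn j] key by blast
  ultimately show ?thesis by (simp only:)
qed

text \<open>Divide [0,1] into cells of length at most \<epsilon> and keep the lowest and the highest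
  point of C in each cell that meets C. A gap between neighbouring kept points that contains a point
  of C lies between the two extreme points of the cell of that point, hence within one cell.\<close>

lemma finite_breaks:
  fixes C :: "real set"
  assumes C: "closed C" "C \<subseteq> {0..1}" "0 \<in> C" "1 \<in> C" and \<epsilon>: "0 < \<epsilon>"
  obtains \<beta> :: "nat \<Rightarrow> real" and M where "\<beta> 0 = 0" "\<beta> M = 1" "\<And>i j. i < j \<Longrightarrow> j \<le> M \<Longrightarrow> \<beta> i < \<beta> j"
    "\<And>i. i \<le> M \<Longrightarrow> \<beta> i \<in> C"
    "\<And>i. i < M \<Longrightarrow> \<beta> (Suc i) - \<beta> i \<le> \<epsilon> \<or> C \<inter> {\<beta> i<..<\<beta> (Suc i)} = {}"
proof -
  define N where "N = nat \<lceil>1 / \<epsilon>\<rceil>"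
  have N: "0 < N" "1 / real N \<le> \<epsilon>"
  proof -
    have "0 < 1 / \<epsilon>" using \<epsilon> by simp
    then have "1 / \<epsilon> \<le> real N" "0 < N" unfolding N_def by linarith+
    then show "0 < N" "1 / real N \<le> \<epsilon>" using \<epsilon> by (auto simp: field_simps)
  qed
  define cell where "cell i = C \<inter> {real i / real N..real (Suc i) / real N}" for i
  define I where "I = {i. i < N \<and> cell i \<noteq> {}}"
  define B where "B = {0, 1} \<union> (\<lambda>i. Inf (cell i)) ` I \<union> (\<lambda>i. Sup (cell i)) ` I"
  have fB: "finite B" by (simp add: B_def I_def)
  have bdd: "bdd_below (cell i)" "bdd_above (cell i)" "closed (cell i)" for i
    using C by (auto simp: cell_def intro: bdd_belowI bdd_aboveI)
  have BC: "B \<subseteq> C"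
  proof -
    have "Inf (cell i) \<in> cell i" "Sup (cell i) \<in> cell i" if "i \<in> I" for i
      using that bdd by (auto simp: I_def intro: closed_contains_Inf closed_contains_Sup)
    then show ?thesis using C by (auto simp: B_def cell_def)
  qed
  have gap: "y - x \<le> \<epsilon> \<or> C \<inter> {x<..<y} = {}" if xy: "B \<inter> {x<..<y} = {}" for x y
  proof (rule ccontr)
    assume *: "\<not> ?thesis"
    then obtain z where z: "z \<in> C" "x < z" "z < y" by auto
    have z01: "0 \<le> z" "z \<le> 1" using z C by auto
    \<comment> \<open>The minimum assigns z = 1 to the last cell.\<close>
    define i where "i = min (N - 1) (nat \<lfloor>z * real N\<rfloor>)"
    have zi: "real i / real N \<le> z" "z \<le> real (Suc i) / real N" "i < N"
    proof -
      have zN: "0 \<le> z * real N" "z * real N \<le> real N" using z01 N by (auto intro: mult_left_le_one_le)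
      then have "real (nat \<lfloor>z * real N\<rfloor>) \<le> z * real N" "z * real N \<le> real (Suc (nat \<lfloor>z * real N\<rfloor>))"
        by linarith+
      moreover have "i \<le> nat \<lfloor>z * real N\<rfloor>" "i < N" "i = nat \<lfloor>z * real N\<rfloor> \<or> Suc i = N"
        using N(1) by (auto simp: i_def min_def)
      ultimately have "real i \<le> z * real N" "z * real N \<le> real (Suc i)" "i < N"
        using zN(2) by (auto simp: le_nat_floor)
      then show "real i / real N \<le> z" "z \<le> real (Suc i) / real N" "i < N"
        using N by (auto simp: pos_divide_le_eq pos_le_divide_eq)
    qed
    then have zc: "z \<in> cell i" using z by (auto simp: cell_def)
    then have iI: "i \<in> I" using zi by (auto simp: I_def)
    have "Inf (cell i) \<le> z" "z \<le> Sup (cell i)"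
      by (rule cInf_lower[OF zc bdd(1)], rule cSup_upper[OF zc bdd(2)])
    moreover have "Inf (cell i) \<in> B" "Sup (cell i) \<in> B" using iI by (auto simp: B_def)
    moreover have "b \<in> B \<Longrightarrow> b \<le> x \<or> y \<le> b" for b using xy by (metis IntI empty_iff greaterThanLessThan_iff not_le)
    ultimately have "Inf (cell i) \<le> x" "y \<le> Sup (cell i)" using z by (meson le_less_trans less_le_trans not_le)+
    moreover have "real i / real N \<le> Inf (cell i)" "Sup (cell i) \<le> real (Suc i) / real N"
    proof -
      have ne: "cell i \<noteq> {}" using zc by blast
      show "real i / real N \<le> Inf (cell i)" by (rule cInf_greatest[OF ne]) (simp add: cell_def)
      show "Sup (cell i) \<le> real (Suc i) / real N" by (rule cSup_least[OF ne]) (simp add: cell_def)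
    qed
    ultimately have "y - x \<le> real (Suc i) / real N - real i / real N" by linarith
    also have "\<dots> = 1 / real N" by (simp add: diff_divide_distrib[symmetric])
    finally show False using * N by linarith
  qed
  define bs where "bs = sorted_list_of_set B"
  have bs: "set bs = B" "sorted_wrt (<) bs" using fB by (auto simp: bs_def)
  define M where "M = length bs - 1"
  have lM: "length bs = Suc M" using bs(1) by (cases bs) (auto simp: M_def B_def)
  have mono: "bs ! i < bs ! j" if "i < j" "j \<le> M" for i j
    using bs(2) that lM by (auto simp: sorted_wrt_iff_nth_less)
  have inB: "bs ! i \<in> B" if "i \<le> M" for i using bs(1) that lM nth_mem[of i bs] by auto
  have B01: "x \<in> B \<Longrightarrow> 0 \<le> x \<and> x \<le> 1" for x using BC C(2) by fastforce
  obtain i0 where i0: "i0 \<le> M" "bs ! i0 = 0" using bs(1) lM by (metis B_def UnI1 in_set_conv_nth insertI1 less_Suc_eq_le)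
  obtain i1 where i1: "i1 \<le> M" "bs ! i1 = 1"
    using bs(1) lM by (metis B_def UnI1 in_set_conv_nth insertCI less_Suc_eq_le)
  have z: "bs ! 0 = 0" using mono[of 0 i0] i0 B01[OF inB[of 0]] by (cases "i0 = 0") auto
  have o: "bs ! M = 1" using mono[of i1 M] i1 B01[OF inB[of M]] by (cases "i1 = M") auto
  have "B \<inter> {bs ! i<..<bs ! Suc i} = {}" if "i < M" for i
  proof (rule equals0I)
    fix x assume x: "x \<in> B \<inter> {bs ! i<..<bs ! Suc i}"
    then obtain l where l: "l \<le> M" "x = bs ! l" using bs(1) lM by (metis IntD1 in_set_conv_nth less_Suc_eq_le)
    consider "l \<le> i" | "Suc i \<le> l" by linarith
    then show False
    proof cases
      case 1
      then have "bs ! l \<le> bs ! i" using mono[of l i] that by (cases "l = i") auto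
      then show ?thesis using x l by auto
    next
      case 2
      then have "bs ! Suc i \<le> bs ! l" using mono[of "Suc i" l] l by (cases "l = Suc i") auto
      then show ?thesis using x l by auto
    qed
  qed
  then have "bs ! Suc i - bs ! i \<le> \<epsilon> \<or> C \<inter> {bs ! i<..<bs ! Suc i} = {}" if "i < M" for i
    using gap that by blast
  then show ?thesis using that[of "(!) bs" M] z o mono inB BC by blast
qed

text \<open>The label F x a is the block of the a-th point, labels from m on meaning a discarded point;
  two points in one block flagged by sm leave the pattern undetermined.\<close>
lemma (in prob_space) block_estimate:
  fixes F :: "'a \<Rightarrow> nat \<Rightarrow> nat" and Q :: "nat \<Rightarrow> nat set \<Rightarrow> real" and l :: "nat \<Rightarrow> real"
  assumes meas: "\<And>A. {x \<in> space M. \<forall>a\<in>{1..k}. F x a \<in> A a} \<in> sets M"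
    and indep: "\<And>A. prob {x \<in> space M. \<forall>a\<in>{1..k}. F x a \<in> A a} = (\<Prod>a\<in>{1..k}. Q a (A a))"
    and Q1: "\<And>a. a \<in> {1..k} \<Longrightarrow> Q a UNIV = 1"
    and Q01: "\<And>a A. a \<in> {1..k} \<Longrightarrow> 0 \<le> Q a A \<and> Q a A \<le> 1"
    and Qsum: "\<And>a. a \<in> {1..k} \<Longrightarrow> (\<Sum>i<m. Q a {i}) \<le> 1"
    and Ql: "\<And>a i. a \<in> {1..k} \<Longrightarrow> i < m \<Longrightarrow> \<bar>Q a {i} - l i\<bar> \<le> \<eta>"
    and zone: "\<And>a. a \<in> {1..k} \<Longrightarrow> Q a {m..} \<le> \<zeta>"
    and l01: "\<And>i. i < m \<Longrightarrow> 0 \<le> l i \<and> l i \<le> 1"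
    and small: "\<And>i. i < m \<Longrightarrow> sm i \<Longrightarrow> l i \<le> \<epsilon>"
    and nn: "0 \<le> \<eta>" "0 \<le> \<epsilon>"
    and Ev: "E \<in> sets M"
    and EvG: "\<And>x. x \<in> space M \<Longrightarrow> \<forall>a\<in>{1..k}. F x a < m \<Longrightarrow>
       \<forall>a\<in>{1..k}. \<forall>b\<in>{1..k}. a \<noteq> b \<longrightarrow> F x a = F x b \<longrightarrow> \<not> sm (F x a) \<Longrightarrow> x \<in> E \<longleftrightarrow> G (restrict (F x) {1..k})"
  shows "\<bar>prob E - (\<Sum>j\<in>{j \<in> {1..k} \<rightarrow>\<^sub>E {..<m}. G j}. \<Prod>a\<in>{1..k}. l (j a))\<bar>
     \<le> real k * \<zeta> + real k ^ 2 * (\<epsilon> + \<eta>) + real m ^ k * (real k * \<eta>)"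
proof -
  let ?J = "{j \<in> {1..k} \<rightarrow>\<^sub>E {..<m}. G j}"
  let ?cyl = "\<lambda>A. {x \<in> space M. \<forall>a\<in>{1..k}. F x a \<in> A a}"
  have finP: "finite ({1..k} \<rightarrow>\<^sub>E {..<m})" by (rule finite_PiE) auto
  then have finJ: "finite ?J" by simp
  \<comment> \<open>The probability of Y is a sum of products. E can differ from Y only on Z, where
    some point is discarded, and on \<open>Bd\<close>, where two points share a block flagged by
    \<open>sm\<close>.\<close>
  define Y where "Y = (\<Union>j\<in>?J. ?cyl (\<lambda>a. {j a}))"
  have Ymeas: "Y \<in> sets M" unfolding Y_def by (intro sets.finite_UN finJ meas)
  have "prob Y = (\<Sum>j\<in>?J. prob (?cyl (\<lambda>a. {j a})))"
    unfolding Y_def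
  proof (rule finite_measure_finite_Union[OF finJ])
    show "(\<lambda>j. ?cyl (\<lambda>a. {j a})) ` ?J \<subseteq> sets M" by (intro image_subsetI meas)
    show "disjoint_family_on (\<lambda>j. ?cyl (\<lambda>a. {j a})) ?J"
      unfolding disjoint_family_on_def
    proof (intro ballI impI equals0I)
      fix i j x assume ij: "i \<in> ?J" "j \<in> ?J" "i \<noteq> j" and x: "x \<in> ?cyl (\<lambda>a. {i a}) \<inter> ?cyl (\<lambda>a. {j a})"
      have "i = j"
      proof (rule PiE_ext[of i "{1..k}" "\<lambda>_. {..<m}" j])
        show "i a = j a" if "a \<in> {1..k}" for a using x that by fastforce
      qed (use ij in auto)
      then show False using ij by simp
    qed
  qed
  also have "\<dots> = (\<Sum>j\<in>?J. \<Prod>a\<in>{1..k}. Q a {j a})" by (simp only: indep)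
  finally have PY: "prob Y = (\<Sum>j\<in>?J. \<Prod>a\<in>{1..k}. Q a {j a})" .
  define Z where "Z = (\<Union>a\<in>{1..k}. ?cyl (\<lambda>c. if c = a then {m..} else UNIV))"
  define Bd where "Bd = (\<Union>p\<in>{p \<in> {1..k} \<times> {1..k}. fst p \<noteq> snd p}. \<Union>i\<in>{i. i < m \<and> sm i}.
      ?cyl (\<lambda>c. if c = fst p \<or> c = snd p then {i} else UNIV))"
  have prod1: "(\<Prod>c\<in>{1..k}. Q c (if c = a then A else UNIV)) = Q a A" if "a \<in> {1..k}" for a A
  proof -
    have "(\<Prod>c\<in>{1..k}. Q c (if c = a then A else UNIV)) = (\<Prod>c\<in>{1..k}. if c = a then Q a A else 1)"
      using Q1 by (intro prod.cong) auto
    then show ?thesis using that by simp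
  qed
  have Zmeas: "Z \<in> sets M" unfolding Z_def by (intro sets.finite_UN finite_atLeastAtMost meas)
  let ?P = "{p \<in> {1..k} \<times> {1..k}. fst p \<noteq> snd p}"
  have fin: "finite ?P" "finite {i. i < m \<and> sm i}" by auto
  have Bmeas: "Bd \<in> sets M" unfolding Bd_def by (intro sets.finite_UN fin meas)
  have "prob Z \<le> (\<Sum>a\<in>{1..k}. prob (?cyl (\<lambda>c. if c = a then {m..} else UNIV)))"
    unfolding Z_def by (intro finite_measure_subadditive_finite finite_atLeastAtMost image_subsetI meas)
  also have "\<dots> = (\<Sum>a\<in>{1..k}. Q a {m..})"
    by (intro sum.cong refl) (simp only: indep prod1)
  also have "\<dots> \<le> (\<Sum>a\<in>{1..k}. \<zeta>)" by (intro sum_mono zone)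
  finally have PZ: "prob Z \<le> real k * \<zeta>" by simp
  have prod2: "(\<Prod>c\<in>{1..k}. Q c (if c = a \<or> c = b then A else UNIV)) = Q a A * Q b A"
    if "a \<in> {1..k}" "b \<in> {1..k}" "a \<noteq> b" for a b A
  proof -
    have "(\<Prod>c\<in>{1..k}. Q c (if c = a \<or> c = b then A else UNIV))
      = (\<Prod>c\<in>{1..k}. (if c = a then Q a A else 1) * (if c = b then Q b A else 1))"
      using Q1 that by (intro prod.cong) auto
    then show ?thesis using that by (simp add: prod.distrib)
  qed
  have pair: "prob (\<Union>i\<in>{i. i < m \<and> sm i}. ?cyl (\<lambda>c. if c = a \<or> c = b then {i} else UNIV)) \<le> \<epsilon> + \<eta>"
    if ab: "a \<in> {1..k}" "b \<in> {1..k}" "a \<noteq> b" for a b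
  proof -
    have "prob (\<Union>i\<in>{i. i < m \<and> sm i}. ?cyl (\<lambda>c. if c = a \<or> c = b then {i} else UNIV))
      \<le> (\<Sum>i\<in>{i. i < m \<and> sm i}. prob (?cyl (\<lambda>c. if c = a \<or> c = b then {i} else UNIV)))"
      by (intro finite_measure_subadditive_finite fin image_subsetI meas)
    also have "\<dots> = (\<Sum>i\<in>{i. i < m \<and> sm i}. Q a {i} * Q b {i})"
      by (intro sum.cong refl) (simp only: indep prod2[OF ab])
    \<comment> \<open>Only one factor is replaced by \<epsilon> + \<eta>. The other still sums to at
      most 1, so the bound does not grow with the number of blocks.\<close>
    also have "\<dots> \<le> (\<Sum>i\<in>{i. i < m \<and> sm i}. (\<epsilon> + \<eta>) * Q b {i})"
    proof (intro sum_mono mult_right_mono)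
      fix i assume "i \<in> {i. i < m \<and> sm i}"
      then show "Q a {i} \<le> \<epsilon> + \<eta>" using Ql[OF ab(1), of i] small[of i] by auto
    qed (use Q01 ab in auto)
    also have "\<dots> \<le> (\<Sum>i<m. (\<epsilon> + \<eta>) * Q b {i})"
      using Q01 ab nn by (intro sum_mono2) auto
    also have "\<dots> = (\<epsilon> + \<eta>) * (\<Sum>i<m. Q b {i})" by (simp add: sum_distrib_left)
    also have "\<dots> \<le> \<epsilon> + \<eta>" using Qsum[OF ab(2)] nn by (intro mult_left_le) auto
    finally show ?thesis .
  qed
  have "prob Bd \<le> (\<Sum>p\<in>{p \<in> {1..k} \<times> {1..k}. fst p \<noteq> snd p}.
      prob (\<Union>i\<in>{i. i < m \<and> sm i}. ?cyl (\<lambda>c. if c = fst p \<or> c = snd p then {i} else UNIV)))"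
    unfolding Bd_def by (intro finite_measure_subadditive_finite fin image_subsetI sets.finite_UN meas)
  also have "\<dots> \<le> (\<Sum>p\<in>{p \<in> {1..k} \<times> {1..k}. fst p \<noteq> snd p}. \<epsilon> + \<eta>)"
    by (rule sum_mono, rule pair) (auto simp del: atLeastAtMost_iff)
  also have "\<dots> \<le> (\<Sum>p\<in>{1..k} \<times> {1..k}. \<epsilon> + \<eta>)"
    using nn by (intro sum_mono2) auto
  also have "\<dots> = real k ^ 2 * (\<epsilon> + \<eta>)" by (simp add: power2_eq_square)
  finally have PB: "prob Bd \<le> real k ^ 2 * (\<epsilon> + \<eta>)" .
  have iff: "x \<in> E \<longleftrightarrow> x \<in> Y" if x: "x \<in> space M" "x \<notin> Z" "x \<notin> Bd" for x
  proof -
    have lt: "\<forall>a\<in>{1..k}. F x a < m" 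
    proof (rule ccontr)
      assume "\<not> (\<forall>a\<in>{1..k}. F x a < m)"
      then obtain a where "a \<in> {1..k}" "F x a \<in> {m..}" by fastforce
      then have "x \<in> Z" unfolding Z_def using x(1) by (intro UN_I[of a]) auto
      then show False using x by simp
    qed
    have nb: "\<forall>a\<in>{1..k}. \<forall>b\<in>{1..k}. a \<noteq> b \<longrightarrow> F x a = F x b \<longrightarrow> \<not> sm (F x a)"
    proof (intro ballI impI notI)
      fix a b assume ab: "a \<in> {1..k}" "b \<in> {1..k}" "a \<noteq> b" "F x a = F x b" "sm (F x a)"
      then have "x \<in> Bd" unfolding Bd_def using x(1) lt
        by (intro UN_I[of "(a, b)"] UN_I[of "F x a"]) auto
      then show False using x by simp
    qed
    have "x \<in> Y \<longleftrightarrow> G (restrict (F x) {1..k})"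
    proof
      assume "x \<in> Y"
      then obtain j where j: "j \<in> ?J" "\<forall>a\<in>{1..k}. F x a = j a" by (auto simp: Y_def)
      have "restrict (F x) {1..k} = j"
        using j by (intro extensionalityI[of _ "{1..k}"]) (auto simp: PiE_def)
      then show "G (restrict (F x) {1..k})" using j by simp
    next
      assume "G (restrict (F x) {1..k})"
      then have "restrict (F x) {1..k} \<in> ?J" using lt by auto
      then show "x \<in> Y" unfolding Y_def using x(1) by (intro UN_I[of "restrict (F x) {1..k}"]) auto
    qed
    then show ?thesis using EvG[OF x(1) lt nb] by simp
  qed
  have "prob E \<le> prob (Y \<union> (Z \<union> Bd))"
    using iff Ymeas Zmeas Bmeas sets.sets_into_space[OF Ev] by (intro finite_measure_mono) auto
  also have "\<dots> \<le> prob Y + prob (Z \<union> Bd)" using Ymeas Zmeas Bmeas by (intro measure_Un_le) auto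
  finally have 1: "prob E \<le> prob Y + prob (Z \<union> Bd)" .
  have "prob Y \<le> prob (E \<union> (Z \<union> Bd))"
    using iff Ev Zmeas Bmeas sets.sets_into_space[OF Ymeas] by (intro finite_measure_mono) auto
  also have "\<dots> \<le> prob E + prob (Z \<union> Bd)" using Ev Zmeas Bmeas by (intro measure_Un_le) auto
  finally have 2: "prob Y \<le> prob E + prob (Z \<union> Bd)" .
  have 3: "prob (Z \<union> Bd) \<le> real k * \<zeta> + real k ^ 2 * (\<epsilon> + \<eta>)"
    using measure_Un_le[OF Zmeas Bmeas] PZ PB by linarith
  have "\<bar>prob Y - (\<Sum>j\<in>?J. \<Prod>a\<in>{1..k}. l (j a))\<bar>
     = \<bar>\<Sum>j\<in>?J. (\<Prod>a\<in>{1..k}. Q a {j a}) - (\<Prod>a\<in>{1..k}. l (j a))\<bar>"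
    by (simp add: PY sum_subtractf)
  also have "\<dots> \<le> (\<Sum>j\<in>?J. \<bar>(\<Prod>a\<in>{1..k}. Q a {j a}) - (\<Prod>a\<in>{1..k}. l (j a))\<bar>)"
    by (rule sum_abs)
  also have "\<dots> \<le> (\<Sum>j\<in>?J. real k * \<eta>)"
  proof (rule sum_mono)
    fix j assume j: "j \<in> ?J"
    then have jm: "j a < m" if "a \<in> {1..k}" for a using that by (auto dest: PiE_mem)
    have "\<bar>(\<Prod>a\<in>{1..k}. Q a {j a}) - (\<Prod>a\<in>{1..k}. l (j a))\<bar> \<le> (\<Sum>a\<in>{1..k}. \<bar>Q a {j a} - l (j a)\<bar>)"
      using norm_prod_diff[of "{1..k}" "\<lambda>a. Q a {j a}" "\<lambda>a. l (j a)"] Q01 l01 jm by auto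
    also have "\<dots> \<le> (\<Sum>a\<in>{1..k}. \<eta>)" using Ql jm by (intro sum_mono) auto
    finally show "\<bar>(\<Prod>a\<in>{1..k}. Q a {j a}) - (\<Prod>a\<in>{1..k}. l (j a))\<bar> \<le> real k * \<eta>" by simp
  qed
  also have "\<dots> = real (card ?J) * (real k * \<eta>)" by simp
  \<comment> \<open>This crude count is affordable, since in the application the number of blocks is
    fixed before \<eta>.\<close>
  also have "\<dots> \<le> real m ^ k * (real k * \<eta>)"
  proof (rule mult_right_mono)
    have "card ?J \<le> card ({1..k} \<rightarrow>\<^sub>E {..<m})" using finP by (intro card_mono) auto
    also have "\<dots> = m ^ k" by (simp add: card_PiE)
    finally show "real (card ?J) \<le> real m ^ k" by (metis of_nat_le_iff of_nat_power)
  qed (use nn in simp)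
  finally show ?thesis using 1 2 3 by linarith
qed

subsection \<open>The paintbox side\<close>

lemma connected_component_between:
  fixes y z c :: real
  assumes "connected_component A y z" "y < c \<and> c < z \<or> z < c \<and> c < y"
  shows "c \<in> A"
proof -
  obtain T where T: "connected T" "T \<subseteq> A" "y \<in> T" "z \<in> T"
    using assms(1) by (auto simp: connected_component_def)
  then have "c \<in> T"
    using assms(2) connected_contains_Icc[of T y z] connected_contains_Icc[of T z y] by fastforce
  then show ?thesis using T by blast
qed

text \<open>Component times component is an open neighbourhood of a related pair. Openness in the
  plane is what makes the paintbox relation measurable.\<close>

lemma open_connected_component_rel:
  fixes A :: "real set"
  assumes "open A"
  shows "open {p. connected_component A (fst p) (snd p)}"
proof (subst open_prod_def, clarsimp)
  fix y z assume yz: "connected_component A y z"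
  let ?C = "connected_component_set A y"
  have "open ?C" using assms by (rule open_connected_component)
  moreover have "y \<in> ?C" "z \<in> ?C" using yz connected_component_in connected_component_refl by auto
  moreover have "connected_component A u v" if "u \<in> ?C" "v \<in> ?C" for u v
    using that connected_component_sym connected_component_trans by (metis mem_Collect_eq)
  ultimately show "\<exists>S. open S \<and> (\<exists>T. open T \<and> y \<in> S \<and> z \<in> T \<and> S \<times> T \<subseteq> {p. connected_component A (fst p) (snd p)})"
    by (intro exI[of _ ?C] conjI) auto
qed

lemma sets_unif_cube: "sets (unif_cube k) = sets (PiM {1..k} (\<lambda>_. borel))"
  unfolding unif_cube_def by (rule sets_PiM_cong) auto

lemma measurable_pb_prec:
  assumes U: "U \<in> U2" and ij: "i \<in> {1..k}" "j \<in> {1..k}"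
  shows "{x \<in> space (unif_cube k). pb_prec U x i j} \<in> sets (unif_cube k)"
proof -
  have sp: "space (unif_cube k) = space (PiM {1..k} (\<lambda>_. borel))"
    using sets_unif_cube by (rule sets_eq_imp_space_eq)
  have [measurable]: "(\<lambda>x. x i) \<in> borel_measurable (PiM {1..k} (\<lambda>_. borel :: real measure))"
    "(\<lambda>x. x j) \<in> borel_measurable (PiM {1..k} (\<lambda>_. borel :: real measure))"
    using ij by (auto intro: measurable_component_singleton)
  have cc: "Measurable.pred (PiM {1..k} (\<lambda>_. borel :: real measure)) (\<lambda>x. connected_component A (x i) (x j))"
    if "open A" for A
  proof -
    have pm: "(\<lambda>x. (x i, x j)) \<in> measurable (PiM {1..k} (\<lambda>_. borel :: real measure)) (borel :: (real \<times> real) measure)"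
      unfolding borel_prod[symmetric] by measurable
    have "(\<lambda>x. (x i, x j)) -` {p. connected_component A (fst p) (snd p)} \<inter> space (PiM {1..k} (\<lambda>_. borel))
       \<in> sets (PiM {1..k} (\<lambda>_. borel :: real measure))"
      by (intro measurable_sets[OF pm] borel_open open_connected_component_rel that)
    also have "(\<lambda>x. (x i, x j)) -` {p. connected_component A (fst p) (snd p)} \<inter> space (PiM {1..k} (\<lambda>_. borel :: real measure))
      = {x \<in> space (PiM {1..k} (\<lambda>_. borel)). connected_component A (x i) (x j)}" by auto
    finally show ?thesis by (simp add: pred_def)
  qed
  have [measurable]: "Measurable.pred (PiM {1..k} (\<lambda>_. borel :: real measure)) (\<lambda>x. connected_component (fst U) (x i) (x j))"
    "Measurable.pred (PiM {1..k} (\<lambda>_. borel :: real measure)) (\<lambda>x. connected_component (snd U) (x i) (x j))"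
    by (rule cc, use U in \<open>force simp: U2_def\<close>)+
  show ?thesis unfolding sets_unif_cube sp pb_prec_def by measurable
qed

text \<open>The word depends on x only through the finite set of related pairs of indices, so the
  event is a finite union of measurable ones. This includes points, such as ties, at which the
  description has no unique solution: the value there is the same function of that set.\<close>

lemma measurable_paintbox:
  assumes U: "U \<in> U2"
  shows "{x \<in> space (unif_cube k). paintbox U k x = w} \<in> sets (unif_cube k)"
proof -
  let ?I = "{1..k} \<times> {1..k}"
  define R where "R x = {p \<in> ?I. pb_prec U x (fst p) (snd p)}" for x
  define g where "g r = (THE w. perm_word k w \<and> (\<forall>p q. p < q \<and> q < k \<longrightarrow> (w ! p, w ! q) \<in> r))" for r
  have pb: "paintbox U k x = g (R x)" for x
  proof -
    have "(perm_word k w \<and> (\<forall>p q. p < q \<and> q < k \<longrightarrow> pb_prec U x (w ! p) (w ! q))) \<longleftrightarrow>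
      (perm_word k w \<and> (\<forall>p q. p < q \<and> q < k \<longrightarrow> (w ! p, w ! q) \<in> R x))" for w
      using perm_word_nth[of k w] unfolding R_def by (auto simp del: atLeastAtMost_iff dest: less_trans)
    then show ?thesis unfolding paintbox_def g_def by simp
  qed
  have Rm: "{x \<in> space (unif_cube k). R x = r} \<in> sets (unif_cube k)" if "r \<subseteq> ?I" for r
  proof -
    have "R x = r \<longleftrightarrow> (\<forall>p\<in>?I. (p \<in> r) = pb_prec U x (fst p) (snd p))" for x
      using that unfolding R_def by blast
    then have "{x \<in> space (unif_cube k). R x = r} =
      {x \<in> space (unif_cube k). \<forall>p\<in>?I. (p \<in> r) = pb_prec U x (fst p) (snd p)}" by simp
    also have "\<dots> \<in> sets (unif_cube k)"
    proof (rule sets.sets_Collect_finite_All)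
      show "{x \<in> space (unif_cube k). (p \<in> r) = pb_prec U x (fst p) (snd p)} \<in> sets (unif_cube k)" if "p \<in> ?I" for p
      proof -
        have m: "{x \<in> space (unif_cube k). pb_prec U x (fst p) (snd p)} \<in> sets (unif_cube k)"
          using that by (intro measurable_pb_prec[OF U]) auto
        show ?thesis
        proof (cases "p \<in> r")
          case True
          then show ?thesis using m by simp
        next
          case False
          then show ?thesis using sets.sets_Collect_neg[OF m] by simp
        qed
      qed
    qed (auto)
    finally show ?thesis .
  qed
  have "{x \<in> space (unif_cube k). paintbox U k x = w} =
     (\<Union>r\<in>{r \<in> Pow ?I. g r = w}. {x \<in> space (unif_cube k). R x = r})"
    unfolding pb by (auto simp: R_def)
  also have "\<dots> \<in> sets (unif_cube k)" using Rm by (intro sets.finite_UN) auto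
  finally show ?thesis .
qed

text \<open>One finite set of breaks serves both sides, so that paintbox and permutation are
  compared with the same number \<open>target\<close>.\<close>

locale breaks =
  fixes U :: "real set \<times> real set" and \<beta> :: "nat \<Rightarrow> real" and M :: nat and \<epsilon> :: real
  assumes U: "U \<in> U2" and b0: "\<beta> 0 = 0" and bM: "\<beta> M = 1"
    and b_mono: "\<And>i j. i < j \<Longrightarrow> j \<le> M \<Longrightarrow> \<beta> i < \<beta> j"
    and b_out: "\<And>i. i \<le> M \<Longrightarrow> \<beta> i \<notin> fst U \<and> \<beta> i \<notin> snd U"
    and gaps: "\<And>i. i < M \<Longrightarrow> \<beta> (Suc i) - \<beta> i \<le> \<epsilon> \<or> {\<beta> i<..<\<beta> (Suc i)} \<subseteq> fst U \<or> {\<beta> i<..<\<beta> (Suc i)} \<subseteq> snd U"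
    and eps: "0 \<le> \<epsilon>"
begin

definition up :: "nat \<Rightarrow> bool" where "up i \<longleftrightarrow> {\<beta> i<..<\<beta> (Suc i)} \<subseteq> fst U"
definition dn :: "nat \<Rightarrow> bool" where "dn i \<longleftrightarrow> {\<beta> i<..<\<beta> (Suc i)} \<subseteq> snd U"
definition len :: "nat \<Rightarrow> real" where "len i = \<beta> (Suc i) - \<beta> i"
text \<open>The probability that k independent labels, each equal to i with probability
  \<open>len i\<close>, are put into the order w by \<open>blk_prec\<close>.\<close>

definition target :: "nat \<Rightarrow> nat list \<Rightarrow> real" where
  "target k w = (\<Sum>j\<in>{j \<in> {1..k} \<rightarrow>\<^sub>E {..<M}. blk_sorted k dn w j}. \<Prod>a\<in>{1..k}. len (j a))"

lemma b_mono_le: "i \<le> j \<Longrightarrow> j \<le> M \<Longrightarrow> \<beta> i \<le> \<beta> j"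
  using b_mono[of i j] by (cases "i = j") auto

lemma b01: "i \<le> M \<Longrightarrow> 0 \<le> \<beta> i \<and> \<beta> i \<le> 1"
  using b_mono_le[of 0 i] b_mono_le[of i M] b0 bM by auto

lemma len01: "i < M \<Longrightarrow> 0 < len i \<and> len i \<le> 1"
  using b_mono[of i "Suc i"] b01[of i] b01[of "Suc i"] by (auto simp: len_def)

lemma sum_len: "(\<Sum>i<M. len i) = 1"
  unfolding len_def using sum_lessThan_telescope[of \<beta> M] b0 bM by simp

lemma up_dn: "i < M \<Longrightarrow> up i \<Longrightarrow> \<not> dn i"
proof
  assume i: "i < M" "up i" "dn i"
  obtain y where "\<beta> i < y" "y < \<beta> (Suc i)" using dense[OF b_mono[of i "Suc i"]] i by auto
  then have "y \<in> fst U" "y \<in> snd U" using i by (auto simp: up_def dn_def)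
  then show False using U by (auto simp: U2_def)
qed

text \<open>The value M means that the point is in no open block.\<close>
definition blk :: "real \<Rightarrow> nat" where "blk y = (LEAST i. i = M \<or> (\<beta> i < y \<and> y < \<beta> (Suc i)))"

lemma blk_le: "blk y \<le> M" unfolding blk_def by (rule Least_le) simp

lemma blk_iff: assumes "i < M" shows "blk y = i \<longleftrightarrow> \<beta> i < y \<and> y < \<beta> (Suc i)"
proof -
  have P: "blk y = M \<or> (\<beta> (blk y) < y \<and> y < \<beta> (Suc (blk y)))"
    unfolding blk_def by (rule LeastI[of _ M]) simp
  show ?thesis
  proof
    assume "blk y = i" then show "\<beta> i < y \<and> y < \<beta> (Suc i)" using P assms by auto
  next
    assume y: "\<beta> i < y \<and> y < \<beta> (Suc i)"
    have le: "blk y \<le> i" unfolding blk_def using y by (intro Least_le) simp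
    then have b: "y < \<beta> (Suc (blk y))" using P assms by auto
    show "blk y = i"
    proof (rule ccontr)
      assume "blk y \<noteq> i"
      then have "\<beta> (Suc (blk y)) \<le> \<beta> i" using le assms by (intro b_mono_le) auto
      then show False using b y by linarith
    qed
  qed
qed

lemma blk_measurable: "{y. blk y \<in> A} \<in> sets borel"
proof -
  have 1: "{y. blk y = i} \<in> sets borel" if "i < M" for i
    using blk_iff[OF that] by (simp add: greaterThanLessThan_def greaterThan_def lessThan_def flip: Collect_conj_eq)
  have "{y. blk y = M} = UNIV - (\<Union>i<M. {y. blk y = i})"
    using blk_le by (auto simp: le_less)
  also have "\<dots> \<in> sets borel" using 1 by (intro sets.Diff sets.finite_UN) auto
  finally have "{y. blk y = i} \<in> sets borel" if "i \<le> M" for i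
    using that 1 by (cases "i = M") auto
  moreover have "{y. blk y \<in> A} = (\<Union>i\<in>A \<inter> {..M}. {y. blk y = i})" using blk_le by auto
  ultimately show ?thesis by (auto intro!: sets.finite_UN)
qed

text \<open>Points of different blocks are separated by a break, which lies in no component. Points
  of one block are connected through it as soon as it is contained in one of the two open
  sets.\<close>

lemma pb_prec_blk:
  assumes ab: "blk (x a) < M" "blk (x b) < M"
    and nb: "blk (x a) = blk (x b) \<Longrightarrow> up (blk (x a)) \<or> dn (blk (x a))"
  shows "pb_prec U x a b \<longleftrightarrow> blk_prec dn (\<lambda>c. blk (x c)) a b"
proof -
  let ?i = "blk (x a)" and ?j = "blk (x b)"
  have xa: "\<beta> ?i < x a" "x a < \<beta> (Suc ?i)" using blk_iff[OF ab(1)] by auto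
  have xb: "\<beta> ?j < x b" "x b < \<beta> (Suc ?j)" using blk_iff[OF ab(2)] by auto
  have sep: "x c < x d \<and> \<not> connected_component (fst U) (x c) (x d) \<and> \<not> connected_component (snd U) (x c) (x d)
    \<and> \<not> connected_component (fst U) (x d) (x c) \<and> \<not> connected_component (snd U) (x d) (x c)"
    if "blk (x c) < blk (x d)" "blk (x d) < M" for c d
  proof -
    have c: "\<beta> (blk (x c)) < x c \<and> x c < \<beta> (Suc (blk (x c)))" using blk_iff[of "blk (x c)" "x c"] that by auto
    have d: "\<beta> (blk (x d)) < x d \<and> x d < \<beta> (Suc (blk (x d)))" using blk_iff[of "blk (x d)" "x d"] that by auto
    let ?m = "\<beta> (blk (x d))"
    have m: "x c < ?m" "?m < x d" using c d b_mono_le[of "Suc (blk (x c))" "blk (x d)"] that by auto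
    have "?m \<notin> fst U" "?m \<notin> snd U" using b_out[of "blk (x d)"] that by auto
    then show ?thesis using m connected_component_between by (metis less_trans)
  qed
  consider "?i < ?j" | "?j < ?i" | "?i = ?j" by linarith
  then show ?thesis
  proof cases
    case 1
    then show ?thesis using sep[of a b] ab by (auto simp: pb_prec_def blk_prec_def)
  next
    case 2
    then show ?thesis using sep[of b a] ab by (auto simp: pb_prec_def blk_prec_def)
  next
    case 3
    have conn: "connected_component S (x a) (x b)" if "{\<beta> ?i<..<\<beta> (Suc ?i)} \<subseteq> S" for S
      unfolding connected_component_def using that xa xb 3
      by (intro exI[of _ "{\<beta> ?i<..<\<beta> (Suc ?i)}"]) auto
    have disj: "fst U \<inter> snd U = {}" using U by (auto simp: U2_def)
    from nb[OF 3] show ?thesis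
    proof
      assume u: "up ?i"
      then have "x a \<in> fst U" using xa by (auto simp: up_def)
      then have "\<not> connected_component (snd U) (x a) (x b)" using disj connected_component_in by blast
      then show ?thesis using conn[of "fst U"] u up_dn[OF ab(1) u] 3 by (auto simp: up_def pb_prec_def blk_prec_def)
    next
      assume d: "dn ?i"
      then have "x a \<in> snd U" using xa by (auto simp: dn_def)
      then have "\<not> connected_component (fst U) (x a) (x b)" using disj connected_component_in by blast
      then show ?thesis using conn[of "snd U"] d 3 by (auto simp: dn_def pb_prec_def blk_prec_def)
    qed
  qed
qed

text \<open>Here the block probabilities are exactly \<open>len i\<close> and the breaks have
  measure 0, so only the collision term of \<open>block_estimate\<close> survives.\<close>

lemma paintbox_estimate:
  assumes w: "perm_word k w"
  shows "\<bar>paintbox_prob U w - target k w\<bar> \<le> real k ^ 2 * \<epsilon>"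
proof -
  define \<mu> where "\<mu> = uniform_measure lborel {0..1::real}"
  have sets\<mu>: "sets \<mu> = sets borel" "space \<mu> = UNIV" by (auto simp: \<mu>_def)
  interpret m: prob_space \<mu> unfolding \<mu>_def by (rule prob_space_uniform_measure) auto
  interpret P: finite_product_prob_space "\<lambda>_. \<mu>" "{1..k}" by standard auto
  have cube: "unif_cube k = PiM {1..k} (\<lambda>_. \<mu>)" by (simp add: unif_cube_def \<mu>_def)
  have bm: "{y. blk y \<in> A} \<in> sets \<mu>" for A using blk_measurable sets\<mu> by simp
  have cyl: "{x \<in> space (unif_cube k). \<forall>a\<in>{1..k}. blk (x a) \<in> A a} = (\<Pi>\<^sub>E a\<in>{1..k}. {y. blk y \<in> A a})" for A
    by (auto simp: cube space_PiM sets\<mu> PiE_def extensional_def)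
  have Qi: "m.prob {y. blk y \<in> {i}} = len i" if "i < M" for i
  proof -
    have e: "{0..1} \<inter> {y. blk y \<in> {i}} = {\<beta> i<..<\<beta> (Suc i)}"
      using b01[of i] b01[of "Suc i"] that by (auto simp: blk_iff[OF that])
    have "m.prob {y. blk y \<in> {i}} = measure lborel ({0..1} \<inter> {y. blk y \<in> {i}}) / measure lborel {0..1::real}"
      unfolding \<mu>_def using blk_measurable[of "{i}"] by (intro measure_uniform_measure) auto
    also have "\<dots> = len i" unfolding e using b_mono[of i "Suc i"] that by (simp add: len_def)
    finally show ?thesis .
  qed
  have Qlt: "m.prob {y. blk y \<in> {..<M}} = 1"
  proof -
    have "{y. blk y \<in> {..<M}} = (\<Union>i<M. {y. blk y \<in> {i}})" by auto
    also have "m.prob \<dots> = (\<Sum>i<M. m.prob {y. blk y \<in> {i}})"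
      by (rule m.finite_measure_finite_Union, simp, intro image_subsetI bm)
         (auto simp: disjoint_family_on_def)
    also have "\<dots> = 1" using Qi sum_len by simp
    finally show ?thesis .
  qed
  have QM: "m.prob {y. blk y \<in> {M..}} = 0"
  proof -
    have "{y. blk y \<in> {M..}} = space \<mu> - {y. blk y \<in> {..<M}}" by (auto simp: sets\<mu>)
    then show ?thesis using m.prob_compl[OF bm[of "{..<M}"]] Qlt by simp
  qed
  have EvG: "x \<in> {x \<in> space (unif_cube k). paintbox U k x = w} \<longleftrightarrow> blk_sorted k dn w (restrict (\<lambda>a. blk (x a)) {1..k})"
    if x: "x \<in> space (unif_cube k)" "\<forall>a\<in>{1..k}. blk (x a) < M"
      "\<forall>a\<in>{1..k}. \<forall>b\<in>{1..k}. a \<noteq> b \<longrightarrow> blk (x a) = blk (x b) \<longrightarrow> \<not> (\<not> up (blk (x a)) \<and> \<not> dn (blk (x a)))" for x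
  proof -
    let ?F = "\<lambda>a. blk (x a)"
    have R: "pb_prec U x a b \<longleftrightarrow> blk_prec dn ?F a b" if "a \<in> {1..k}" "b \<in> {1..k}" "a \<noteq> b" for a b
      using x(2,3) that by (intro pb_prec_blk) blast+
    have eq: "perm_word k v \<and> (\<forall>p q. p < q \<and> q < k \<longrightarrow> pb_prec U x (v ! p) (v ! q)) \<longleftrightarrow>
       perm_word k v \<and> blk_sorted k dn v ?F" for v
      using blk_sorted_cong[of k v "pb_prec U x" dn ?F] R by blast
    have "paintbox U k x = (THE v. perm_word k v \<and> blk_sorted k dn v ?F)"
      unfolding paintbox_def by (simp only: eq)
    then have "paintbox U k x = w \<longleftrightarrow> blk_sorted k dn w ?F"
      using theI'[OF ex1_blk_sorted[of k dn ?F]] the1_equality[OF ex1_blk_sorted[of k dn ?F], of w] w by metis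
    then show ?thesis using x(1) blk_sorted_restrict[OF w] by simp
  qed
  have ps: "prob_space (unif_cube k)"
    unfolding cube by (rule prob_space_PiM) (rule m.prob_space_axioms)
  have "\<bar>measure (unif_cube k) {x \<in> space (unif_cube k). paintbox U k x = w} -
      (\<Sum>j\<in>{j \<in> {1..k} \<rightarrow>\<^sub>E {..<M}. blk_sorted k dn w j}. \<Prod>a\<in>{1..k}. len (j a))\<bar>
     \<le> real k * 0 + real k ^ 2 * (\<epsilon> + 0) + real M ^ k * (real k * 0)"
  proof (rule prob_space.block_estimate[OF ps, where F = "\<lambda>x a. blk (x a)" and Q = "\<lambda>a A. m.prob {y. blk y \<in> A}"
        and sm = "\<lambda>i. \<not> up i \<and> \<not> dn i"])
    fix A :: "nat \<Rightarrow> nat set"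
    show "{x \<in> space (unif_cube k). \<forall>a\<in>{1..k}. blk (x a) \<in> A a} \<in> sets (unif_cube k)"
      unfolding cyl unfolding cube using bm by (intro sets_PiM_I_finite) auto
    show "measure (unif_cube k) {x \<in> space (unif_cube k). \<forall>a\<in>{1..k}. blk (x a) \<in> A a} = (\<Prod>a\<in>{1..k}. m.prob {y. blk y \<in> A a})"
      unfolding cyl unfolding cube using bm by (intro P.prob_times) auto
  next
    fix i assume i: "i < M" "\<not> up i \<and> \<not> dn i"
    then show "len i \<le> \<epsilon>" using gaps[OF i(1)] by (auto simp: len_def up_def dn_def)
  next
    show "{x \<in> space (unif_cube k). paintbox U k x = w} \<in> sets (unif_cube k)"
      by (rule measurable_paintbox[OF U])
  qed (use Qi QM sum_len len01 eps EvG m.prob_space sets\<mu> in \<open>auto simp: less_imp_le\<close>)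
  moreover have "paintbox_prob U w = measure (unif_cube k) {x \<in> space (unif_cube k). paintbox U k x = w}"
    using w distinct_card[of w] by (auto simp: paintbox_prob_def Let_def perm_word_def)
  ultimately show ?thesis by (simp add: target_def)
qed

end

subsection \<open>The permutation side\<close>

lemma run_strict_mono:
  assumes w: "distinct w" "dword w = t" and pq: "p < q" "q < length w"
  shows "(\<And>r. p \<le> r \<Longrightarrow> r < q \<Longrightarrow> \<not> t ! r) \<Longrightarrow> w ! p < w ! q"
    and "(\<And>r. p \<le> r \<Longrightarrow> r < q \<Longrightarrow> t ! r) \<Longrightarrow> w ! q < w ! p"
proof -
  have adj: "if t ! r then w ! Suc r < w ! r else w ! r < w ! Suc r" if "Suc r < length w" for r
    using nth_dword[OF that] w that nth_eq_iff_index_eq[of w r "Suc r"] by (auto simp: not_less le_less)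
  show "w ! p < w ! q" if a: "\<And>r. p \<le> r \<Longrightarrow> r < q \<Longrightarrow> \<not> t ! r"
    using Suc_leI[OF pq(1)] pq(2) a
  proof (induction q rule: dec_induct)
    case base
    then show ?case using adj[of p] by simp
  next
    case (step q)
    then have "w ! p < w ! q" by simp
    also have "\<dots> < w ! Suc q" using step adj[of q] by simp
    finally show ?case .
  qed
  show "w ! q < w ! p" if a: "\<And>r. p \<le> r \<Longrightarrow> r < q \<Longrightarrow> t ! r"
    using Suc_leI[OF pq(1)] pq(2) a
  proof (induction q rule: dec_induct)
    case base
    then show ?case using adj[of p] by simp
  next
    case (step q)
    have "w ! Suc q < w ! q" using step adj[of q] by simp
    also have "\<dots> < w ! p" using step by simp
    finally show ?case .
  qed
qed

lemma card_nat_near_le: "0 \<le> r \<Longrightarrow> real (card {p :: nat. \<bar>real p - x\<bar> \<le> r}) \<le> 2 * r + 1"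
proof -
  assume r: "0 \<le> r"
  have "int ` {p :: nat. \<bar>real p - x\<bar> \<le> r} \<subseteq> {\<lceil>x - r\<rceil>..\<lfloor>x + r\<rfloor>}"
    by (auto simp: ceiling_le_iff le_floor_iff)
  then have "card (int ` {p :: nat. \<bar>real p - x\<bar> \<le> r}) \<le> card {\<lceil>x - r\<rceil>..\<lfloor>x + r\<rfloor>}"
    by (rule card_mono[rotated]) simp
  then have "card {p :: nat. \<bar>real p - x\<bar> \<le> r} \<le> nat (\<lfloor>x + r\<rfloor> - \<lceil>x - r\<rceil> + 1)"
    by (simp add: card_image)
  then have "real (card {p :: nat. \<bar>real p - x\<bar> \<le> r}) \<le> real (nat (\<lfloor>x + r\<rfloor> - \<lceil>x - r\<rceil> + 1))"
    by (rule of_nat_mono)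
  also have "\<dots> \<le> 2 * r + 1" using r by linarith
  finally show ?thesis .
qed

lemma finite_nat_near: "finite {p :: nat. \<bar>real p - x\<bar> \<le> r}"
proof (rule finite_subset)
  show "{p :: nat. \<bar>real p - x\<bar> \<le> r} \<subseteq> {..nat \<lceil>x + r\<rceil>}" by auto linarith
qed simp

lemma (in breaks) blk_eq_M:
  assumes "0 \<le> y" "y \<le> 1" "blk y = M"
  shows "\<exists>i\<le>M. y = \<beta> i"
proof (rule ccontr)
  assume *: "\<not> ?thesis"
  have "\<beta> i < y" if "i \<le> M" for i
    using that
  proof (induction i)
    case 0
    then show ?case using * b0 assms by (metis le_less)
  next
    case (Suc i)
    then have "blk y \<noteq> i" using assms by simp
    then have "\<not> y < \<beta> (Suc i)" using blk_iff[of i y] Suc by simp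
    moreover have "y \<noteq> \<beta> (Suc i)" using * Suc.prems by blast
    ultimately show ?case by simp
  qed
  then show False using assms bM by fastforce
qed

text \<open>The permutation is fixed; random is only the choice of one value from each V a,
  uniformly and independently. A block probability is a difference of two prefix proportions, each
  known up to \<delta>, and excluded positions cost \<zeta>, hence 2 \<delta> + \<zeta>. Inside a
  monotone block positions follow or reverse the sizes of the values, and sizes follow the labels
  because V a lies below V b for a < b.\<close>

lemma (in breaks) word_estimate:
  assumes n: "2 \<le> n" "length t = n - 1" and \<sigma>: "\<sigma> \<in> desc_class {1..n} t"
    and V: "\<And>a. a \<in> {1..k} \<Longrightarrow> V a \<subseteq> {1..n}" "\<And>a. a \<in> {1..k} \<Longrightarrow> card (V a) = m" "0 < m"
      "\<And>a b u v. a \<in> {1..k} \<Longrightarrow> b \<in> {1..k} \<Longrightarrow> a < b \<Longrightarrow> u \<in> V a \<Longrightarrow> v \<in> V b \<Longrightarrow> u < v"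
    and H: "U2_dist (U_of_comp (comp_of_word t)) U < \<theta>" and \<theta>: "0 < \<theta>"
    and good: "\<And>a i. a \<in> {1..k} \<Longrightarrow> i \<le> M \<Longrightarrow>
        \<bar>real (card (set (take (nat \<lfloor>\<beta> i * real n\<rfloor>) \<sigma>) \<inter> V a)) / real m - \<beta> i\<bar> \<le> \<delta>"
    and \<delta>: "0 \<le> \<delta>" and \<zeta>: "real (M + 1) * (2 * \<theta> * real n + 5) \<le> \<zeta> * real m"
    and w: "perm_word k w"
  shows "\<bar>real (card {s \<in> PiE {1..k} V. filter (\<lambda>y. y \<in> set (map s w)) \<sigma> = map s w}) / real m ^ k - target k w\<bar>
     \<le> real k * \<zeta> + real k ^ 2 * (\<epsilon> + (2 * \<delta> + \<zeta>)) + real M ^ k * (real k * (2 * \<delta> + \<zeta>))"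
proof -
  have len\<sigma>: "length \<sigma> = n" and d\<sigma>: "distinct \<sigma>" "set \<sigma> = {1..n}" "dword \<sigma> = t"
    using \<sigma> distinct_card[of \<sigma>] by (auto simp: desc_class_def)
  have t: "t \<noteq> []" "real (length t) = real n - 1" using n by (auto simp: of_nat_diff)
  have n0: "0 < real n" using n by simp
  define pos where "pos = the_inv_into {..<n} ((!) \<sigma>)"
  have injn: "inj_on ((!) \<sigma>) {..<n}" using d\<sigma>(1) len\<sigma> by (simp add: inj_on_nth)
  have pos_nth: "pos (\<sigma> ! i) = i" if "i < n" for i
    unfolding pos_def using the_inv_into_f_f[OF injn] that by simp
  have pos: "pos u < n" "\<sigma> ! pos u = u" if "u \<in> {1..n}" for u
  proof -
    have "u \<in> set \<sigma>" unfolding d\<sigma>(2) by (rule that)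
    then obtain i where "i < n" "u = \<sigma> ! i" unfolding in_set_conv_nth len\<sigma> by blast
    then show "pos u < n" "\<sigma> ! pos u = u" using pos_nth[of i] by simp_all
  qed
  have mem_take: "u \<in> set (take c \<sigma>) \<longleftrightarrow> pos u < c" if "u \<in> {1..n}" for u c
  proof
    assume "u \<in> set (take c \<sigma>)"
    then obtain i where "i < length (take c \<sigma>)" "u = take c \<sigma> ! i" unfolding in_set_conv_nth by blast
    then show "pos u < c" using pos_nth[of i] len\<sigma> by simp
  next
    assume "pos u < c"
    then show "u \<in> set (take c \<sigma>)"
      using pos[OF that] len\<sigma> nth_mem[of "pos u" "take c \<sigma>"] by simp
  qed
  \<comment> \<open>Near a break the letters of the word are not controlled; such positions are too few to matter,
    as every V a contains a fixed proportion of all values.\<close>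
  define zone where "zone p \<longleftrightarrow> (\<exists>l\<le>M. \<bar>real p - \<beta> l * real n\<bar> \<le> \<theta> * real n + 2)" for p :: nat
  define fblk where "fblk u = (if zone (pos u) then M else blk (real (pos u) / real n))" for u
  have fblk: "\<not> zone (pos u)" "\<beta> i * real n + \<theta> * real n + 2 < real (pos u)"
      "real (pos u) < \<beta> (Suc i) * real n - \<theta> * real n - 2" if "fblk u = i" "i < M" for u i
  proof -
    show z: "\<not> zone (pos u)" using that by (auto simp: fblk_def)
    then have "blk (real (pos u) / real n) = i" using that by (simp add: fblk_def)
    then have b: "\<beta> i * real n < real (pos u)" "real (pos u) < \<beta> (Suc i) * real n"
      using blk_iff[OF that(2)] n0 by (auto simp: pos_less_divide_eq pos_divide_less_eq)
    have "\<not> \<bar>real (pos u) - \<beta> i * real n\<bar> \<le> \<theta> * real n + 2"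
      "\<not> \<bar>real (pos u) - \<beta> (Suc i) * real n\<bar> \<le> \<theta> * real n + 2"
      using z that(2) by (auto simp: zone_def)
    then show "\<beta> i * real n + \<theta> * real n + 2 < real (pos u)"
      "real (pos u) < \<beta> (Suc i) * real n - \<theta> * real n - 2" using b by linarith+
  qed
  have fblkI: "fblk u = i" if "i < M" "\<not> zone (pos u)" "\<beta> i * real n < real (pos u)" "real (pos u) < \<beta> (Suc i) * real n" for u i
    using that blk_iff[OF that(1)] n0 by (simp add: fblk_def pos_less_divide_eq pos_divide_less_eq)
  have fblk_zone: "zone (pos u)" if "M \<le> fblk u" "u \<in> {1..n}" for u
  proof (rule ccontr)
    assume z: "\<not> zone (pos u)"
    then have "blk (real (pos u) / real n) = M" using that blk_le by (simp add: fblk_def antisym)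
    moreover have "real (pos u) / real n \<le> 1" using pos(1)[OF that(2)] by simp
    ultimately obtain l where "l \<le> M" "real (pos u) / real n = \<beta> l" using blk_eq_M[of "real (pos u) / real n"] by auto
    then have "real (pos u) = \<beta> l * real n" using n0 by (simp add: field_simps)
    then show False using z \<open>l \<le> M\<close> \<theta> n0 by (auto simp: zone_def)
  qed
  define Z where "Z = {u \<in> {1..n}. zone (pos u)}"
  have "finite {p. zone p}"
  proof -
    have "{p. zone p} = (\<Union>l\<in>{..M}. {p. \<bar>real p - \<beta> l * real n\<bar> \<le> \<theta> * real n + 2})"
      by (auto simp: zone_def)
    then show ?thesis using finite_nat_near by simp
  qed
  moreover have "inj_on pos Z" unfolding Z_def using pos(2) by (intro inj_onI) (metis (no_types, lifting) mem_Collect_eq)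
  ultimately have "card Z \<le> card {p. zone p}"
    by (intro card_inj_on_le[of pos]) (auto simp: Z_def)
  also have "{p. zone p} = (\<Union>l\<in>{..M}. {p. \<bar>real p - \<beta> l * real n\<bar> \<le> \<theta> * real n + 2})"
    by (auto simp: zone_def)
  also have "card \<dots> \<le> (\<Sum>l\<in>{..M}. card {p. \<bar>real p - \<beta> l * real n\<bar> \<le> \<theta> * real n + 2})"
    by (rule card_UN_le) simp
  finally have "real (card Z) \<le> (\<Sum>l\<in>{..M}. real (card {p. \<bar>real p - \<beta> l * real n\<bar> \<le> \<theta> * real n + 2}))"
    by (simp only: of_nat_sum[symmetric] of_nat_le_iff)
  \<comment> \<open>An interval of radius r holds at most 2 r + 1 integers; r = \<theta> n + 2 is
    the origin of the constant 5.\<close>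
  also have "\<dots> \<le> (\<Sum>l\<in>{..M}. 2 * (\<theta> * real n + 2) + 1)"
    using \<theta> by (intro sum_mono card_nat_near_le) simp
  also have "\<dots> = real (M + 1) * (2 * \<theta> * real n + 5)" by (simp add: algebra_simps)
  finally have cZ: "real (card Z) \<le> \<zeta> * real m" using \<zeta> by linarith
  have fZ: "finite Z" by (simp add: Z_def)
  have fV: "finite (V a)" if "a \<in> {1..k}" for a using V(1)[OF that] finite_subset by blast
  have m0: "0 < real m" using V(3) by simp
  have \<zeta>0: "0 \<le> \<zeta>"
  proof -
    have "0 \<le> real (card Z)" by simp
    then have "0 \<le> \<zeta> * real m" using cZ by linarith
    then show ?thesis using m0 by (simp add: zero_le_mult_iff)
  qed
  define Q where "Q a A = real (card {u \<in> V a. fblk u \<in> A}) / real m" for a A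
  have Ql: "\<bar>Q a {i} - len i\<bar> \<le> 2 * \<delta> + \<zeta>" if a: "a \<in> {1..k}" and i: "i < M" for a i
  proof -
    define c c' where "c = nat \<lfloor>\<beta> i * real n\<rfloor>" and "c' = nat \<lfloor>\<beta> (Suc i) * real n\<rfloor>"
    \<comment> \<open>B - A consists of the values of V a at positions between the two cuts. It
      contains X, and what it has beyond X lies in Z.\<close>
    define A B X where "A = set (take c \<sigma>) \<inter> V a" and "B = set (take c' \<sigma>) \<inter> V a"
      and "X = {u \<in> V a. fblk u \<in> {i}}"
    have bi: "0 \<le> \<beta> i * real n" "\<beta> i * real n \<le> \<beta> (Suc i) * real n"
      using b01[of i] b_mono[of i "Suc i"] i n0 by (auto intro: mult_right_mono)
    have c: "real c \<le> \<beta> i * real n" "\<beta> i * real n < real c + 1"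
      "real c' \<le> \<beta> (Suc i) * real n" "\<beta> (Suc i) * real n < real c' + 1" "c \<le> c'"
      using bi unfolding c_def c'_def by (auto intro!: nat_mono floor_mono)
    have \<theta>n: "0 \<le> \<theta> * real n" using \<theta> n0 by simp
    have XB: "X \<subseteq> B - A"
    proof
      fix u assume "u \<in> X"
      then have u: "u \<in> V a" "fblk u = i" "u \<in> {1..n}" using V(1)[OF a] by (auto simp: X_def)
      have "real c < real (pos u)" "real (pos u) < real c'" using fblk(2,3)[OF u(2) i] c \<theta>n by linarith+
      then show "u \<in> B - A" using u(1) by (auto simp: A_def B_def mem_take[OF u(3)])
    qed
    have BX: "B - A \<subseteq> X \<union> Z"
    proof
      fix u assume u: "u \<in> B - A"
      then have uV: "u \<in> V a" "u \<in> {1..n}" using V(1)[OF a] by (auto simp: B_def)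
      then have p: "c \<le> pos u" "pos u < c'" using u by (auto simp: A_def B_def mem_take[OF uV(2)])
      show "u \<in> X \<union> Z"
      proof (cases "zone (pos u)")
        case True
        then show ?thesis using uV by (simp add: Z_def)
      next
        case False
        then have "\<not> \<bar>real (pos u) - \<beta> i * real n\<bar> \<le> \<theta> * real n + 2" using i by (auto simp: zone_def)
        moreover have "\<beta> i * real n - 1 < real (pos u)" using c(2) p(1) by linarith
        ultimately have "\<beta> i * real n < real (pos u)" using \<theta>n by linarith
        moreover have "real (pos u) < \<beta> (Suc i) * real n" using p(2) c(3) by linarith
        ultimately have "fblk u = i" using fblkI[OF i False] by simp
        then show ?thesis using uV by (simp add: X_def)
      qed
    qed
    have AB: "A \<subseteq> B" using c(5) set_take_subset_set_take[of c c' \<sigma>] by (auto simp: A_def B_def)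
    have fB: "finite B" by (simp add: B_def)
    have cBA: "real (card (B - A)) = real (card B) - real (card A)"
      using AB fB by (simp add: card_Diff_subset finite_subset card_mono of_nat_diff)
    have "card X \<le> card (B - A)" using XB fB by (intro card_mono) auto
    then have 1: "real (card X) \<le> real (card B) - real (card A)" using cBA by linarith
    have "card (B - A) \<le> card (X \<union> Z)" using BX fZ fV[OF a] by (intro card_mono) (auto simp: X_def)
    also have "\<dots> \<le> card X + card Z" by (rule card_Un_le)
    finally have 2: "real (card B) - real (card A) \<le> real (card X) + \<zeta> * real m" using cBA cZ by linarith
    have 3: "real (card X) / real m \<le> real (card B) / real m - real (card A) / real m"
      using 1 m0 by (simp add: diff_divide_distrib[symmetric] divide_right_mono)
    have "(real (card B) - real (card A)) / real m \<le> (real (card X) + \<zeta> * real m) / real m"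
      using 2 m0 by (intro divide_right_mono) auto
    then have 4: "real (card B) / real m - real (card A) / real m \<le> real (card X) / real m + \<zeta>"
      using m0 by (simp add: diff_divide_distrib add_divide_distrib)
    have "\<bar>real (card A) / real m - \<beta> i\<bar> \<le> \<delta>" "\<bar>real (card B) / real m - \<beta> (Suc i)\<bar> \<le> \<delta>"
      using good[OF a, of i] good[OF a, of "Suc i"] i by (auto simp: A_def B_def c_def c'_def)
    then have "\<bar>real (card X) / real m - len i\<bar> \<le> 2 * \<delta> + \<zeta>"
      using 3 4 \<zeta>0 unfolding len_def by linarith
    then show ?thesis by (simp add: Q_def X_def)
  qed
  \<comment> \<open>The additional 2 in \<open>zone\<close> pays for passing from n to n - 1, the
    length of t, and for the half step to the midpoint of a cell.\<close>
  have inside: "(\<beta> i + \<theta>) * real (length t) \<le> real r + 1/2"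
      "real r + 1/2 \<le> (\<beta> (Suc i) - \<theta>) * real (length t)" "r < length t"
    if "i < M" "q < n" "\<beta> i * real n + \<theta> * real n + 2 < real p" "real q < \<beta> (Suc i) * real n - \<theta> * real n - 2"
      "p \<le> r" "r < q" for i p q r
  proof -
    have b: "0 \<le> \<beta> i" "\<beta> (Suc i) \<le> 1" using b01[of i] b01[of "Suc i"] that by auto
    have "real p \<le> real r" "real r + 1 \<le> real q" using that by auto
    then show "(\<beta> i + \<theta>) * real (length t) \<le> real r + 1/2" "real r + 1/2 \<le> (\<beta> (Suc i) - \<theta>) * real (length t)"
      unfolding t(2) using that b \<theta> by (simp_all add: algebra_simps)
    show "r < length t" using that n by simp
  qed
  have mono_up: "\<sigma> ! p < \<sigma> ! q" if a: "up i" "i < M" "p < q" "q < n"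
    "\<beta> i * real n + \<theta> * real n + 2 < real p" "real q < \<beta> (Suc i) * real n - \<theta> * real n - 2" for p q i
  proof (rule run_strict_mono(1)[OF d\<sigma>(1,3) a(3)])
    fix r assume r: "p \<le> r" "r < q"
    note y = inside[OF a(2,4,5,6) r]
    show "\<not> t ! r" by (rule monotone_inside(1)[OF U t(1) H y(3,1,2)]) (use a(1) in \<open>simp add: up_def\<close>)
  qed (use a len\<sigma> in simp)
  have mono_dn: "\<sigma> ! q < \<sigma> ! p" if a: "dn i" "i < M" "p < q" "q < n"
    "\<beta> i * real n + \<theta> * real n + 2 < real p" "real q < \<beta> (Suc i) * real n - \<theta> * real n - 2" for p q i
  proof (rule run_strict_mono(2)[OF d\<sigma>(1,3) a(3)])
    fix r assume r: "p \<le> r" "r < q"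
    note y = inside[OF a(2,4,5,6) r]
    show "t ! r" by (rule monotone_inside(2)[OF U t(1) H y(3,1,2)]) (use a(1) in \<open>simp add: dn_def\<close>)
  qed (use a len\<sigma> in simp)
  define \<Omega> where "\<Omega> = PiE {1..k} V"
  have f\<Omega>: "finite \<Omega>" unfolding \<Omega>_def using fV by (intro finite_PiE) auto
  have c\<Omega>: "card \<Omega> = m ^ k" unfolding \<Omega>_def using V(2) by (simp add: card_PiE)
  have ne\<Omega>: "\<Omega> \<noteq> {}" using c\<Omega> V(3) by auto
  have \<Omega>V: "s a \<in> V a" "s a \<in> {1..n}" if "s \<in> \<Omega>" "a \<in> {1..k}" for s a
  proof -
    show "s a \<in> V a" using that unfolding \<Omega>_def by (rule PiE_mem)
    then show "s a \<in> {1..n}" using V(1)[OF that(2)] by blast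
  qed
  define E where "E = {s \<in> \<Omega>. filter (\<lambda>y. y \<in> set (map s w)) \<sigma> = map s w}"
  have lw: "length w = k" "set w = {1..k}" using w distinct_card[of w] by (auto simp: perm_word_def)
  have EvG: "s \<in> E \<longleftrightarrow> blk_sorted k dn w (restrict (\<lambda>a. fblk (s a)) {1..k})"
    if s: "s \<in> \<Omega>" "\<forall>a\<in>{1..k}. fblk (s a) < M"
      "\<forall>a\<in>{1..k}. \<forall>b\<in>{1..k}. a \<noteq> b \<longrightarrow> fblk (s a) = fblk (s b) \<longrightarrow> \<not> (\<not> up (fblk (s a)) \<and> \<not> dn (fblk (s a)))" for s
  proof -
    let ?F = "\<lambda>a. fblk (s a)"
    have R: "pos (s a) < pos (s b) \<longleftrightarrow> blk_prec dn ?F a b" if ab: "a \<in> {1..k}" "b \<in> {1..k}" "a \<noteq> b" for a b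
    proof -
      note sa = \<Omega>V[OF s(1) ab(1)] and sb = \<Omega>V[OF s(1) ab(2)]
      have iM: "?F a < M" "?F b < M" using s(2) ab by auto
      note fa = fblk[OF refl iM(1)] and fb = fblk[OF refl iM(2)]
      have \<theta>n: "0 \<le> \<theta> * real n" using \<theta> n0 by simp
      have sep: "real (pos u) < real (pos v)" if "fblk u < fblk v" "fblk v < M" for u v
      proof -
        have "fblk u < M" using that by simp
        from fblk(3)[OF refl this] fblk(2)[OF refl that(2)]
        have "real (pos u) < \<beta> (Suc (fblk u)) * real n" "\<beta> (fblk v) * real n < real (pos v)" using \<theta>n by linarith+
        moreover have "\<beta> (Suc (fblk u)) * real n \<le> \<beta> (fblk v) * real n"
          using that by (intro mult_right_mono b_mono_le) auto
        ultimately show ?thesis by linarith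
      qed
      consider "?F a < ?F b" | "?F b < ?F a" | "?F a = ?F b" by linarith
      then show ?thesis
      proof cases
        case 1
        then show ?thesis using sep[of "s a" "s b"] iM by (simp add: blk_prec_def)
      next
        case 2
        then show ?thesis using sep[of "s b" "s a"] iM by (simp add: blk_prec_def)
      next
        case 3
        have lt: "s a < s b \<longleftrightarrow> a < b"
          using V(4)[OF ab(1,2) _ sa(1) sb(1)] V(4)[OF ab(2,1) _ sb(1) sa(1)] ab(3) by (meson less_asym nat_neq_iff)
        have neq: "s a \<noteq> s b" using V(4)[OF ab(1,2) _ sa(1) sb(1)] V(4)[OF ab(2,1) _ sb(1) sa(1)] ab(3)
          by (metis less_irrefl nat_neq_iff)
        have pneq: "pos (s a) \<noteq> pos (s b)" using neq pos(2)[OF sa(2)] pos(2)[OF sb(2)] by metis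
        note fb' = fb[folded 3]
        have "up (?F a) \<or> dn (?F a)" using s(3) ab 3 by blast
        then show ?thesis
        proof
          assume u: "up (?F a)"
          have "pos (s a) < pos (s b) \<longleftrightarrow> s a < s b"
            using mono_up[OF u iM(1) _ _ fa(2) fb'(3)] mono_up[OF u iM(1) _ _ fb'(2) fa(3)]
              pos[OF sa(2)] pos[OF sb(2)] pneq by (metis less_asym nat_neq_iff)
          then show ?thesis using lt 3 up_dn[OF iM(1) u] by (simp add: blk_prec_def)
        next
          assume d: "dn (?F a)"
          have "pos (s a) < pos (s b) \<longleftrightarrow> s b < s a"
            using mono_dn[OF d iM(1) _ _ fa(2) fb'(3)] mono_dn[OF d iM(1) _ _ fb'(2) fa(3)]
              pos[OF sa(2)] pos[OF sb(2)] pneq by (metis less_asym nat_neq_iff)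
          moreover have "s b < s a \<longleftrightarrow> b < a" using lt neq ab(3) by (metis less_asym nat_neq_iff)
          ultimately show ?thesis using d 3 by (simp add: blk_prec_def)
        qed
      qed
    qed
    have sub: "set (map s w) \<subseteq> set \<sigma>" unfolding d\<sigma>(2) using \<Omega>V(2)[OF s(1)] lw by (auto simp del: atLeastAtMost_iff)
    have "s \<in> E \<longleftrightarrow> filter (\<lambda>y. y \<in> set (map s w)) \<sigma> = map s w" using s(1) unfolding E_def by blast
    also have "\<dots> \<longleftrightarrow> (\<forall>p q. p < q \<and> q < length (map s w) \<longrightarrow> pos (map s w ! p) < pos (map s w ! q))"
      by (rule filter_eq_iff_pos[OF d\<sigma>(1) _ sub]) (use pos_nth len\<sigma> in simp)
    also have "\<dots> \<longleftrightarrow> (\<forall>p q. p < q \<and> q < k \<longrightarrow> pos (s (w ! p)) < pos (s (w ! q)))"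
      using lw by auto
    also have "\<dots> \<longleftrightarrow> blk_sorted k dn w ?F"
      using blk_sorted_cong[OF w, of "\<lambda>a b. pos (s a) < pos (s b)" dn ?F] R by blast
    finally show ?thesis using blk_sorted_restrict[OF w] by simp
  qed
  have ms: "measure (uniform_count_measure \<Omega>) X = real (card X) / real m ^ k" if "X \<subseteq> \<Omega>" for X
    using that f\<Omega> c\<Omega> by (simp add: measure_uniform_count_measure)
  have "\<bar>measure (uniform_count_measure \<Omega>) E - (\<Sum>j\<in>{j \<in> {1..k} \<rightarrow>\<^sub>E {..<M}. blk_sorted k dn w j}. \<Prod>a\<in>{1..k}. len (j a))\<bar>
     \<le> real k * \<zeta> + real k ^ 2 * (\<epsilon> + (2 * \<delta> + \<zeta>)) + real M ^ k * (real k * (2 * \<delta> + \<zeta>))"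
  proof (rule prob_space.block_estimate[OF prob_space_uniform_count_measure[OF f\<Omega> ne\<Omega>],
        where F = "\<lambda>s a. fblk (s a)" and Q = Q and sm = "\<lambda>i. \<not> up i \<and> \<not> dn i"])
    fix A :: "nat \<Rightarrow> nat set"
    show "{s \<in> space (uniform_count_measure \<Omega>). \<forall>a\<in>{1..k}. fblk (s a) \<in> A a} \<in> sets (uniform_count_measure \<Omega>)"
      by (auto simp: space_uniform_count_measure sets_uniform_count_measure)
    have "{s \<in> \<Omega>. \<forall>a\<in>{1..k}. fblk (s a) \<in> A a} = PiE {1..k} (\<lambda>a. {u \<in> V a. fblk u \<in> A a})"
      by (auto simp: \<Omega>_def PiE_def Pi_def)
    then have "card {s \<in> \<Omega>. \<forall>a\<in>{1..k}. fblk (s a) \<in> A a} = (\<Prod>a\<in>{1..k}. card {u \<in> V a. fblk u \<in> A a})"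
      by (simp add: card_PiE)
    moreover have "(\<Prod>a\<in>{1..k}. Q a (A a)) = (\<Prod>a\<in>{1..k}. real (card {u \<in> V a. fblk u \<in> A a})) / real m ^ k"
      by (simp add: Q_def prod_dividef)
    ultimately show "measure (uniform_count_measure \<Omega>) {s \<in> space (uniform_count_measure \<Omega>). \<forall>a\<in>{1..k}. fblk (s a) \<in> A a}
        = (\<Prod>a\<in>{1..k}. Q a (A a))"
      by (subst ms) (auto simp: space_uniform_count_measure)
  next
    fix a assume a: "a \<in> {1..k}"
    show "Q a UNIV = 1" using V(2)[OF a] V(3) by (simp add: Q_def)
    show "Q a {M..} \<le> \<zeta>"
    proof -
      have "{u \<in> V a. fblk u \<in> {M..}} \<subseteq> Z" using fblk_zone V(1)[OF a] by (auto simp: Z_def)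
      then have "real (card {u \<in> V a. fblk u \<in> {M..}}) \<le> real (card Z)" using fZ by (intro of_nat_mono card_mono)
      then have "real (card {u \<in> V a. fblk u \<in> {M..}}) \<le> \<zeta> * real m" using cZ by linarith
      then show ?thesis unfolding Q_def using m0 by (simp add: pos_divide_le_eq)
    qed
    show "(\<Sum>i<M. Q a {i}) \<le> 1"
    proof -
      have "(\<Sum>i<M. card {u \<in> V a. fblk u \<in> {i}}) = card (\<Union>i<M. {u \<in> V a. fblk u \<in> {i}})"
        using fV[OF a] by (intro card_UN_disjoint[symmetric]) auto
      also have "\<dots> \<le> card (V a)" using fV[OF a] by (intro card_mono) auto
      finally have "(\<Sum>i<M. real (card {u \<in> V a. fblk u \<in> {i}})) \<le> real m"
        unfolding V(2)[OF a] by (simp only: of_nat_sum[symmetric] of_nat_le_iff)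
      then show ?thesis unfolding Q_def sum_divide_distrib[symmetric] using m0 by (simp add: pos_divide_le_eq)
    qed
    fix A :: "nat set"
    have "card {u \<in> V a. fblk u \<in> A} \<le> m" using card_mono[OF fV[OF a], of "{u \<in> V a. fblk u \<in> A}"] V(2)[OF a] by auto
    then show "0 \<le> Q a A \<and> Q a A \<le> 1" unfolding Q_def using m0 by (simp add: pos_divide_le_eq)
  next
    fix i assume i: "i < M" "\<not> up i \<and> \<not> dn i"
    then show "len i \<le> \<epsilon>" using gaps[OF i(1)] by (auto simp: len_def up_def dn_def)
  next
    fix i assume "i < M" then show "0 \<le> len i \<and> len i \<le> 1" using len01[of i] by simp
  next
    show "E \<in> sets (uniform_count_measure \<Omega>)" by (auto simp: sets_uniform_count_measure E_def)
  next
    fix s assume "s \<in> space (uniform_count_measure \<Omega>)" "\<forall>a\<in>{1..k}. fblk (s a) < M"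
       "\<forall>a\<in>{1..k}. \<forall>b\<in>{1..k}. a \<noteq> b \<longrightarrow> fblk (s a) = fblk (s b) \<longrightarrow> \<not> (\<not> up (fblk (s a)) \<and> \<not> dn (fblk (s a)))"
    then show "s \<in> E \<longleftrightarrow> blk_sorted k dn w (restrict (\<lambda>a. fblk (s a)) {1..k})"
      by (intro EvG) (auto simp: space_uniform_count_measure)
  next
    fix a i assume "a \<in> {1..k}" "i < M"
    then show "\<bar>Q a {i} - len i\<bar> \<le> 2 * \<delta> + \<zeta>" by (rule Ql)
  next
    show "0 \<le> 2 * \<delta> + \<zeta>" using \<delta> \<zeta>0 by simp
    show "0 \<le> \<epsilon>" by (rule eps)
  qed
  moreover have "measure (uniform_count_measure \<Omega>) E = real (card E) / real m ^ k"
    by (rule ms) (auto simp: E_def)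
  ultimately show ?thesis by (simp add: target_def E_def \<Omega>_def)
qed

section \<open>Patterns on chosen values and the limit of the Martin kernel\<close>

lemma dword_map_strict_mono:
  assumes "\<And>a b. a \<in> set w \<Longrightarrow> b \<in> set w \<Longrightarrow> s a < s b \<longleftrightarrow> a < b"
  shows "dword (map s w) = dword w"
proof (rule nth_equalityI)
  fix i assume "i < length (dword (map s w))"
  then have "Suc i < length w" by simp
  then show "dword (map s w) ! i = dword w ! i" by (simp add: nth_dword assms)
qed simp

text \<open>An increasing relabelling keeps the descents, so all choices s of values give the same
  count. The empty composition is treated apart: it has no descent word, and every word shows the
  empty pattern.\<close>

lemma card_pattern:
  assumes mu: "is_comp mu" "perm_word (sum_list mu) w" "des w = descent_set mu"
    and T: "finite T" "card T = Suc (length t)"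
    and s: "\<And>a. a \<in> {1..sum_list mu} \<Longrightarrow> s a \<in> T"
      "\<And>a b. a \<in> {1..sum_list mu} \<Longrightarrow> b \<in> {1..sum_list mu} \<Longrightarrow> s a < s b \<longleftrightarrow> a < b"
  shows "card {\<sigma> \<in> desc_class T t. filter (\<lambda>y. y \<in> set (map s w)) \<sigma> = map s w} = d_Z mu (comp_of_word t)"
proof (cases "mu = []")
  case True
  then have "w = []" using mu(2) by (simp add: perm_word_def)
  then show ?thesis using True card_desc_class[OF T] by simp
next
  case False
  have sw: "set w = {1..sum_list mu}" "distinct w" "length w = sum_list mu"
    using mu(2) distinct_card[of w] by (auto simp: perm_word_def)
  have "w \<noteq> []"
  proof
    assume "w = []"
    then have "sum_list mu = 0" using sw by simp
    then show False using False mu(1) by (cases mu) (auto simp: is_comp_def)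
  qed
  moreover have "inj_on s (set w)"
    unfolding sw(1) using s(2) by (intro inj_onI) (metis less_irrefl nat_neq_iff)
  ultimately have "card {\<sigma> \<in> desc_class T t. filter (\<lambda>y. y \<in> set (map s w)) \<sigma> = map s w}
      = d_Z (comp_of_word (dword (map s w))) (comp_of_word t)"
    using s(1) sw by (intro card_desc_class_restrict T) (auto simp: distinct_map simp del: atLeastAtMost_iff)
  also have "dword (map s w) = dword w"
    by (rule dword_map_strict_mono) (use s(2) sw(1) in blast)
  also have "comp_of_word (dword w) = mu"
    using comp_of_word_dword_eq[OF mu(1) False sw(3) mu(3)] .
  finally show ?thesis .
qed

text \<open>The + 1 in the denominator covers x = 0.\<close>

lemma mult_divide_le_eighth:
  fixes x e :: real
  assumes "0 \<le> x" "0 < e"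
  shows "x * (e / (8 * (x + 1))) \<le> e / 8"
proof -
  have "x * e \<le> e / 8 * (8 * (x + 1))" using assms by (simp add: algebra_simps)
  then have "x * e / (8 * (x + 1)) \<le> e / 8" using assms by (subst pos_divide_le_eq) auto
  then show ?thesis by simp
qed

theorem theorem8:
  fixes lam :: "nat \<Rightarrow> nat list" and U :: "real set \<times> real set"
  assumes "\<And>n. n \<ge> 2 \<Longrightarrow> comp_of n (lam n)"
    and "U \<in> U2"
    and "(\<lambda>n. U2_dist (U_of_comp (lam n)) U) \<longlonglongrightarrow> 0"
  shows "\<forall>mu. is_comp mu \<longrightarrow> (\<lambda>n. martin_kernel mu (lam n)) \<longlonglongrightarrow> p_U U mu"
proof (intro allI impI)
  fix mu assume mu: "is_comp mu"
  define k where "k = sum_list mu"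
  define w where "w = (SOME w. perm_word (sum_list mu) w \<and> des w = descent_set mu)"
  have w: "perm_word k w" "des w = descent_set mu"
    using someI_ex[OF exists_word_des[OF mu]] unfolding w_def k_def by auto
  have pU: "p_U U mu = paintbox_prob U w" by (simp add: p_U_def w_def)
  have p01: "0 \<le> paintbox_prob U w" "paintbox_prob U w \<le> 1"
  proof -
    have "prob_space (unif_cube (length w))"
      unfolding unif_cube_def by (intro prob_space_PiM prob_space_uniform_measure) auto
    then show "0 \<le> paintbox_prob U w" "paintbox_prob U w \<le> 1"
      unfolding paintbox_prob_def Let_def by (auto intro: prob_space.prob_le_1)
  qed
  define t where "t n = (SOME s. lam n = comp_of_word s)" for n
  have t: "lam n = comp_of_word (t n)" "length (t n) = n - 1" if "2 \<le> n" for n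
  proof -
    have "is_comp (lam n)" "sum_list (lam n) = n" using assms(1)[OF that] by (auto simp: comp_of_def)
    moreover then have "lam n \<noteq> []" using that by auto
    ultimately obtain s where "lam n = comp_of_word s" using comp_of_word_surj by blast
    then show e: "lam n = comp_of_word (t n)" unfolding t_def by (rule someI)
    have "sum_list (lam n) = Suc (length (t n))" by (simp add: e)
    then show "length (t n) = n - 1" using \<open>sum_list (lam n) = n\<close> by simp
  qed
  have H: "(\<lambda>n. U2_dist (U_of_comp (comp_of_word (t n))) U) \<longlonglongrightarrow> 0"
  proof (rule Lim_transform_eventually[OF assms(3)])
    show "eventually (\<lambda>n. U2_dist (U_of_comp (lam n)) U = U2_dist (U_of_comp (comp_of_word (t n))) U) sequentially"
      using eventually_ge_at_top[of 2] by eventually_elim (simp add: t)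
  qed
  \<comment> \<open>Dividing by k + 1 avoids a division by 0 for the empty composition. The k
    intervals still have lengths proportional to n, and \<alpha> below is a lower bound for the
    proportion.\<close>
  define m where "m n = n div Suc k" for n
  define V where "V n a = {(a - 1) * m n + 1..a * m n}" for n a :: nat
  have V1: "V n a \<subseteq> {1..n}" if "a \<in> {1..k}" for n a
  proof -
    have "a * m n \<le> Suc k * m n" using that by (intro mult_right_mono) auto
    also have "\<dots> \<le> n" unfolding m_def by (rule times_div_less_eq_dividend)
    finally show ?thesis by (auto simp: V_def)
  qed
  have V2: "card (V n a) = m n" if "a \<in> {1..k}" for n a
    using that by (cases a) (auto simp: V_def)
  have V4: "u < v" if "a \<in> {1..k}" "b \<in> {1..k}" "a < b" "u \<in> V n a" "v \<in> V n b" for n a b u v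
  proof -
    have "a * m n \<le> (b - 1) * m n" using that by (intro mult_right_mono) auto
    moreover have "u \<le> a * m n" "(b - 1) * m n + 1 \<le> v" using that(4,5) unfolding V_def by simp_all
    ultimately show ?thesis by linarith
  qed
  define \<alpha> where "\<alpha> = 1 / (2 * (real k + 1))"
  have \<alpha>: "0 < \<alpha>" by (simp add: \<alpha>_def)
  have m\<alpha>: "\<alpha> * real n \<le> real (m n)" "0 < m n" if "Suc k \<le> n" for n
  proof -
    show m: "0 < m n" using that by (simp add: m_def div_greater_zero_iff)
    have "n < Suc k * m n + Suc k" using mult_div_mod_eq[of "Suc k" n] mod_less_divisor[of "Suc k" n]
      unfolding m_def by linarith
    also have "\<dots> \<le> 2 * (Suc k * m n)"
    proof -
      have "Suc k * 1 \<le> Suc k * m n" using m by (intro mult_le_mono2) simp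
      then show ?thesis by (simp only: mult_2 mult_1_right add_le_cancel_left)
    qed
    finally have "real n \<le> real (2 * (Suc k * m n))" by (simp only: of_nat_le_iff less_imp_le)
    then show "\<alpha> * real n \<le> real (m n)" by (simp add: \<alpha>_def field_simps)
  qed
  have m\<alpha>ev: "eventually (\<lambda>n. \<alpha> * real n \<le> real (m n)) sequentially"
    using eventually_ge_at_top[of "Suc k"] by eventually_elim (rule m\<alpha>)
  show "(\<lambda>n. martin_kernel mu (lam n)) \<longlonglongrightarrow> p_U U mu"
  proof (rule LIMSEQ_I)
    fix e :: real assume e: "0 < e"
    \<comment> \<open>\<epsilon> depends on e and k only, so M is determined before \<rho>, \<delta>
      and \<theta> are chosen.\<close>
    define \<epsilon> where "\<epsilon> = e / (8 * (real k ^ 2 + 1))"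
    have \<epsilon>: "0 < \<epsilon>" using e by (simp add: \<epsilon>_def add_nonneg_pos)
    have k\<epsilon>: "real k ^ 2 * \<epsilon> \<le> e / 8"
      unfolding \<epsilon>_def by (rule mult_divide_le_eighth) (use e in auto)
    define C where "C = {0..1} - fst U - snd U"
    have Uo: "open (fst U)" "open (snd U)" "fst U \<subseteq> {0<..<1}" "snd U \<subseteq> {0<..<1}" "fst U \<inter> snd U = {}"
      using assms(2) by (auto simp: U2_def)
    have C: "closed C" "C \<subseteq> {0..1}" "0 \<in> C" "1 \<in> C"
      using Uo by (auto simp: C_def intro!: closed_Diff)
    obtain \<beta> M where B: "\<beta> 0 = 0" "\<beta> M = 1" "\<And>i j. i < j \<Longrightarrow> j \<le> M \<Longrightarrow> \<beta> i < \<beta> j"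
      "\<And>i. i \<le> M \<Longrightarrow> \<beta> i \<in> C"
      "\<And>i. i < M \<Longrightarrow> \<beta> (Suc i) - \<beta> i \<le> \<epsilon> \<or> C \<inter> {\<beta> i<..<\<beta> (Suc i)} = {}"
      using finite_breaks[OF C \<epsilon>] by blast
    interpret breaks U \<beta> M \<epsilon>
    proof
      fix i assume i: "i < M"
      show "\<beta> (Suc i) - \<beta> i \<le> \<epsilon> \<or> {\<beta> i<..<\<beta> (Suc i)} \<subseteq> fst U \<or> {\<beta> i<..<\<beta> (Suc i)} \<subseteq> snd U"
      proof (cases "\<beta> (Suc i) - \<beta> i \<le> \<epsilon>")
        case False
        then have "C \<inter> {\<beta> i<..<\<beta> (Suc i)} = {}" using B(5)[OF i] by blast
        moreover have "{\<beta> i<..<\<beta> (Suc i)} \<subseteq> {0..1}"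
          using B(4)[of i] B(4)[of "Suc i"] i C(2) by fastforce
        ultimately have sub: "{\<beta> i<..<\<beta> (Suc i)} \<subseteq> fst U \<union> snd U" by (auto simp: C_def)
        have "fst U \<inter> {\<beta> i<..<\<beta> (Suc i)} = {} \<or> snd U \<inter> {\<beta> i<..<\<beta> (Suc i)} = {}"
          by (rule connectedD[OF connected_Ioo Uo(1,2) _ sub]) (use Uo(5) in blast)
        then show ?thesis using sub by blast
      qed simp
    qed (use assms(2) B \<epsilon> in \<open>auto simp: C_def\<close>)
    \<comment> \<open>In \<open>word_estimate\<close> the choice \<delta> = \<rho> / 4 and \<zeta> =
      \<rho> / 2 gives 2 \<delta> + \<zeta> = \<rho>; D bounds the total coefficient of
      \<rho>.\<close>
    define D where "D = real k + real k ^ 2 + real M ^ k * real k"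
    have D: "0 \<le> D" by (simp add: D_def)
    define \<rho> where "\<rho> = e / (8 * (D + 1))"
    have \<rho>: "0 < \<rho>" using e D by (simp add: \<rho>_def)
    have D\<rho>: "D * \<rho> \<le> e / 8"
      unfolding \<rho>_def by (rule mult_divide_le_eighth[OF D e])
    define \<delta> where "\<delta> = \<rho> / 4"
    \<comment> \<open>As soon as 5 <= \<theta> n, there are at most 3 (M + 1) \<theta> n = \<alpha>
      \<rho> n / 2 excluded positions, which is at most the fraction \<rho> / 2 of
      \<open>m n\<close>.\<close>
    define \<theta> where "\<theta> = \<alpha> * \<rho> / (6 * real (M + 1))"
    have \<delta>: "0 < \<delta>" and \<theta>: "0 < \<theta>" using \<rho> \<alpha> by (auto simp: \<delta>_def \<theta>_def)
    define bad where "bad n a i = {\<sigma> \<in> desc_class {1..n} (t n).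
        \<delta> \<le> \<bar>real (card (set (take (nat \<lfloor>\<beta> i * real n\<rfloor>) \<sigma>) \<inter> V n a)) / real (card (V n a)) - \<beta> i\<bar>}" for n a i
    have "(\<lambda>n. real (card (bad n a i)) / real (card (desc_class {1..n} (t n)))) \<longlonglongrightarrow> 0"
      if "a \<in> {1..k}" "i \<le> M" for a i
      unfolding bad_def
    proof (rule desc_class_break_concentration[OF assms(2) t(2) H _ _ _ V1[OF that(1)] \<alpha> _ \<delta>])
      show "\<beta> i \<in> {0..1}" "\<beta> i \<notin> fst U" "\<beta> i \<notin> snd U" using B(4)[OF that(2)] by (auto simp: C_def)
      show "eventually (\<lambda>n. \<alpha> * real n \<le> real (card (V n a))) sequentially"
        using m\<alpha>ev by (simp add: V2[OF that(1)])
    qed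
    then have "(\<lambda>n. \<Sum>p\<in>{1..k} \<times> {..M}. real (card (bad n (fst p) (snd p))) / real (card (desc_class {1..n} (t n)))) \<longlonglongrightarrow> 0"
      by (intro tendsto_null_sum) auto
    from order_tendstoD(2)[OF this, of "e / 4"] e
    have ev1: "eventually (\<lambda>n. (\<Sum>p\<in>{1..k} \<times> {..M}. real (card (bad n (fst p) (snd p))) / real (card (desc_class {1..n} (t n)))) < e / 4) sequentially"
      by simp
    have ev2: "eventually (\<lambda>n. U2_dist (U_of_comp (comp_of_word (t n))) U < \<theta>) sequentially"
      using order_tendstoD(2)[OF H \<theta>] .
    have ev3: "eventually (\<lambda>n. 5 \<le> \<theta> * real n) sequentially" using \<theta> by real_asymp
    have "eventually (\<lambda>n. norm (martin_kernel mu (lam n) - p_U U mu) < e) sequentially"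
      using ev1 ev2 ev3 eventually_ge_at_top[of 2] eventually_ge_at_top[of "Suc k"]
    proof eventually_elim
      case (elim n)
      let ?W = "desc_class {1..n} (t n)"
      let ?\<Omega> = "PiE {1..k} (V n)"
      have len: "length (t n) = n - 1" "card {1..n} = Suc (length (t n))" using t(2)[OF elim(4)] elim(4) by auto
      have mn: "\<alpha> * real n \<le> real (m n)" "0 < m n" using m\<alpha>[OF elim(5)] by auto
      have W: "finite ?W" "0 < card ?W" using card_desc_class_pos[OF _ len(2)] by auto
      have f\<Omega>: "finite ?\<Omega>" by (intro finite_PiE) (auto simp: V_def)
      have c\<Omega>: "card ?\<Omega> = m n ^ k" using V2 by (simp add: card_PiE)
      define pat where "pat s \<sigma> \<longleftrightarrow> filter (\<lambda>y. y \<in> set (map s w)) \<sigma> = map s w" for s :: "nat \<Rightarrow> nat" and \<sigma>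
      \<comment> \<open>For a single permutation, the chance that a random choice s of values shows
        the pattern.\<close>
      define f where "f \<sigma> = real (card {s \<in> ?\<Omega>. pat s \<sigma>}) / real (m n) ^ k" for \<sigma>
      have mk: "0 < real (m n) ^ k" using mn by simp
      have f01: "0 \<le> f \<sigma>" "f \<sigma> \<le> 1" for \<sigma>
      proof -
        have "card {s \<in> ?\<Omega>. pat s \<sigma>} \<le> m n ^ k" unfolding c\<Omega>[symmetric] using f\<Omega> by (intro card_mono) auto
        then have "real (card {s \<in> ?\<Omega>. pat s \<sigma>}) \<le> real (m n) ^ k" by (metis of_nat_le_iff of_nat_power)
        then show "0 \<le> f \<sigma>" "f \<sigma> \<le> 1" using mk by (auto simp: f_def pos_divide_le_eq)
      qed
      have cnt: "card {\<sigma> \<in> ?W. pat s \<sigma>} = d_Z mu (lam n)" if s: "s \<in> ?\<Omega>" for s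
      proof -
        have sV: "s a \<in> V n a" if "a \<in> {1..k}" for a using s that by (rule PiE_mem)
        have lt: "s a < s b" if "a \<in> {1..k}" "b \<in> {1..k}" "a < b" for a b
          using V4[OF that sV[OF that(1)] sV[OF that(2)]] .
        have "s a < s b \<longleftrightarrow> a < b" if "a \<in> {1..k}" "b \<in> {1..k}" for a b
          using lt[OF that] lt[OF that(2,1)] by (metis less_asym less_irrefl nat_neq_iff)
        moreover have "s a \<in> {1..n}" if "a \<in> {1..k}" for a using sV[OF that] V1[OF that] by blast
        ultimately show ?thesis
          unfolding pat_def t(1)[OF elim(4)] using w mu len(2)
          by (intro card_pattern) (auto simp: k_def)
      qed
      \<comment> \<open>Double counting of pairs of s and \<sigma>: by \<open>cnt\<close> every s
        contributes the same number, so the kernel is the mean of f over the descent class.\<close>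
      have "(\<Sum>\<sigma>\<in>?W. card {s \<in> ?\<Omega>. pat s \<sigma>}) = (\<Sum>s\<in>?\<Omega>. card {\<sigma> \<in> ?W. pat s \<sigma>})"
        unfolding card_eq_sum by (rule sum.swap_restrict[OF W(1) f\<Omega>])
      also have "\<dots> = m n ^ k * d_Z mu (lam n)" using cnt c\<Omega> by simp
      finally have "real (\<Sum>\<sigma>\<in>?W. card {s \<in> ?\<Omega>. pat s \<sigma>}) = real (m n ^ k * d_Z mu (lam n))" by simp
      then have "(\<Sum>\<sigma>\<in>?W. f \<sigma>) = real (d_Z mu (lam n))"
        unfolding f_def sum_divide_distrib[symmetric] using mk by (simp add: field_simps)
      moreover have "d_Z [] (lam n) = card ?W" using card_desc_class[OF _ len(2)] t(1)[OF elim(4)] by simp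
      ultimately have K: "martin_kernel mu (lam n) = (\<Sum>\<sigma>\<in>?W. f \<sigma>) / real (card ?W)"
        by (simp add: martin_kernel_def)
      define Bd where "Bd = (\<Union>p\<in>{1..k} \<times> {..M}. bad n (fst p) (snd p))"
      have BdW: "Bd \<subseteq> ?W" by (auto simp: Bd_def bad_def)
      have "card Bd \<le> (\<Sum>p\<in>{1..k} \<times> {..M}. card (bad n (fst p) (snd p)))"
        unfolding Bd_def by (rule card_UN_le) simp
      then have "real (card Bd) \<le> (\<Sum>p\<in>{1..k} \<times> {..M}. real (card (bad n (fst p) (snd p))))"
        by (simp only: of_nat_sum[symmetric] of_nat_le_iff)
      then have "real (card Bd) / real (card ?W) \<le> (\<Sum>p\<in>{1..k} \<times> {..M}. real (card (bad n (fst p) (snd p)))) / real (card ?W)"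
        by (rule divide_right_mono) simp
      then have Bd: "real (card Bd) / real (card ?W) < e / 4"
        using elim(1) unfolding sum_divide_distrib by (rule le_less_trans)
      have good: "\<bar>f \<sigma> - paintbox_prob U w\<bar> \<le> 3 * e / 8" if \<sigma>: "\<sigma> \<in> ?W" "\<sigma> \<notin> Bd" for \<sigma>
      proof -
        have "\<bar>f \<sigma> - target k w\<bar>
          \<le> real k * (\<rho> / 2) + real k ^ 2 * (\<epsilon> + (2 * \<delta> + \<rho> / 2)) + real M ^ k * (real k * (2 * \<delta> + \<rho> / 2))"
          unfolding f_def pat_def
        proof (rule word_estimate[OF elim(4) len(1) \<sigma>(1) V1 V2 mn(2) V4 elim(2) \<theta> _ _ _ w(1)])
          fix a i assume ai: "a \<in> {1..k}" "i \<le> M"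
          then have "\<sigma> \<notin> bad n a i" using \<sigma>(2) by (force simp: Bd_def)
          then show "\<bar>real (card (set (take (nat \<lfloor>\<beta> i * real n\<rfloor>) \<sigma>) \<inter> V n a)) / real (m n) - \<beta> i\<bar> \<le> \<delta>"
            using \<sigma>(1) V2[OF ai(1)] by (simp add: bad_def)
        next
          show "real (M + 1) * (2 * \<theta> * real n + 5) \<le> \<rho> / 2 * real (m n)"
          proof -
            have "real (M + 1) * (2 * \<theta> * real n + 5) \<le> real (M + 1) * (3 * \<theta> * real n)"
              using elim(3) by (intro mult_left_mono) auto
            also have "\<dots> = 3 * (real (M + 1) * \<theta>) * real n" by (simp only: mult_ac)
            also have "real (M + 1) * \<theta> = \<alpha> * \<rho> / 6"
            proof -
              have "x * (c / (6 * x)) = c / 6" if "x \<noteq> 0" for x c :: real using that by simp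
              from this[of "real (M + 1)"] show ?thesis unfolding \<theta>_def of_nat_eq_0_iff by simp
            qed
            also have "3 * (\<alpha> * \<rho> / 6) * real n = \<rho> / 2 * (\<alpha> * real n)" by simp
            also have "\<dots> \<le> \<rho> / 2 * real (m n)" using mn \<rho> by (intro mult_left_mono) auto
            finally show ?thesis .
          qed
        qed (use \<delta> in auto)
        also have "\<dots> \<le> D * \<rho> + real k ^ 2 * \<epsilon>"
        proof -
          have "real k * (\<rho> / 2) \<le> real k * \<rho>" using \<rho> by (intro mult_left_mono) auto
          moreover have "2 * \<delta> + \<rho> / 2 = \<rho>" by (simp add: \<delta>_def)
          ultimately show ?thesis by (simp add: D_def algebra_simps)
        qed
        finally have "\<bar>f \<sigma> - target k w\<bar> \<le> e / 4" using D\<rho> k\<epsilon> by linarith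
        then show ?thesis using paintbox_estimate[OF w(1)] k\<epsilon> by linarith
      qed
      have "\<bar>(\<Sum>\<sigma>\<in>?W. f \<sigma> - paintbox_prob U w)\<bar> \<le> (\<Sum>\<sigma>\<in>?W. \<bar>f \<sigma> - paintbox_prob U w\<bar>)"
        by (rule sum_abs)
      \<comment> \<open>Permutations in \<open>Bd\<close> form less than the fraction e / 4 of the
        class and cost at most 1 more each; 3 e / 8 is the sum of e / 4 from the permutation side
        and e / 8 from the paintbox side.\<close>
      also have "\<dots> \<le> (\<Sum>\<sigma>\<in>?W. 3 * e / 8 + (if \<sigma> \<in> Bd then 1 else 0))"
      proof (rule sum_mono)
        fix \<sigma> assume \<sigma>: "\<sigma> \<in> ?W"
        show "\<bar>f \<sigma> - paintbox_prob U w\<bar> \<le> 3 * e / 8 + (if \<sigma> \<in> Bd then 1 else 0)"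
        proof (cases "\<sigma> \<in> Bd")
          case True
          have "\<bar>f \<sigma> - paintbox_prob U w\<bar> \<le> 3 * e / 8 + 1" using f01[of \<sigma>] p01 e by linarith
          then show ?thesis using True by simp
        next
          case False
          then show ?thesis using good[OF \<sigma> False] by simp
        qed
      qed
      also have "\<dots> = real (card ?W) * (3 * e / 8) + real (card (?W \<inter> Bd))"
        using W(1) by (simp add: sum.distrib sum.If_cases)
      also have "?W \<inter> Bd = Bd" using BdW by blast
      finally have "\<bar>(\<Sum>\<sigma>\<in>?W. f \<sigma> - paintbox_prob U w)\<bar> / real (card ?W)
         \<le> (real (card ?W) * (3 * e / 8) + real (card Bd)) / real (card ?W)"
        by (rule divide_right_mono) simp
      also have "\<dots> = 3 * e / 8 + real (card Bd) / real (card ?W)" using W(2) by (auto simp: add_divide_distrib)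
      also have "\<dots> < e" using Bd e by linarith
      finally have "\<bar>(\<Sum>\<sigma>\<in>?W. f \<sigma> - paintbox_prob U w)\<bar> / real (card ?W) < e" .
      moreover have "martin_kernel mu (lam n) - p_U U mu = (\<Sum>\<sigma>\<in>?W. f \<sigma> - paintbox_prob U w) / real (card ?W)"
        unfolding K pU using W(2) by (auto simp: sum_subtractf diff_divide_distrib)
      ultimately show ?case by simp
    qed
    then show "\<exists>no. \<forall>n\<ge>no. norm (martin_kernel mu (lam n) - p_U U mu) < e"
      by (simp add: eventually_sequentially)
  qed
qed

end
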